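(* There exist a proper, geodesic, line-convex, Gromov-hyperbolic metric space $X$ with bounded geometry and a discrete, torsion-free, cocompact group $\Gamma<\mathrm{Isom}(X)$ such that: (i) $\Gamma\backslash X$ is a locally $\mathrm{CAT}(-1)$, locally geodesically complete, compact metric space; however, $X$ is not simply connected, so it is not the universal cover of $\Gamma\backslash X$, and $\Gamma\backslash\mathrm{Geod}(X)$ is a proper subset of $\mathrm{Loc\text{-}Geod}(\Gamma\backslash X)$; (ii) it holds that $$h_{\mathrm{top}}(\mathrm{Loc\text{-}Geod}(\Gamma\backslash X),\Phi_1)=h_{\mathrm{crit}}(\tilde X;\pi_1(\Gamma\backslash X))>h_{\mathrm{crit}}(X;\Gamma)=h_{\mathrm{top}}(\Gamma\backslash\mathrm{Geod}(X),\bar\Phi_1),$$ where $\tilde X$ is the universal cover of $\Gamma\backslash X$.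
   Context: Let $(X,d)$ be a metric space. $X$ is proper if closed balls are compact. A geodesic line is an isometric embedding $\gamma\colon\mathbb{R}\to X$. A map $\gamma\colon I\to X$ on an interval $I$ is a local geodesic if every $t\in I$ has some $\varepsilon>0$ such that $\gamma|_{[t-\varepsilon,t+\varepsilon]\cap I}$ is an isometric embedding. $X$ is locally geodesically complete if every local geodesic can be extended to a local geodesic defined on $\mathbb{R}$. $X$ is line-convex if for every two geodesic lines $\gamma,\gamma'$ the function $t\mapsto d(\gamma(t),\gamma'(t))$ is convex on $\mathbb{R}$. $X$ is Gromov-hyperbolic if there is $\delta\ge 0$ such that $(x,z)_w\ge\min\{(x,y)_w,(y,z)_w\}-\delta$ for all $x,y,z,w\in X$, where $(y,z)_x=\frac12(d(x,y)+d(x,z)-d(y,z))$. $X$ has bounded geometry if $\sup_{x\in X}\mathrm{Cov}(\overline B(x,R),r)<+\infty$ for every $0<r\le R$, where $\mathrm{Cov}(B,r)$ is the minimal number of balls of radius $r$ needed to cover $B$. $\Gamma<\mathrm{Isom}(X)$ is discrete if $\{g\in\Gamma: d(x,gx)\le R\}$ is finite for all $x\in X$, $R\ge0$, and cocompact if $\Gamma\backslash X$ is compact. $\Gamma\backslash X$ carries the metric $\bar d([x],[y])=\inf_{g\in\Gamma}d(x,gy)$. The critical exponent is $h_{\mathrm{crit}}(X;\Gamma)=\limsup_{T\to+\infty}\frac1T\log\#(\Gamma x\cap B(x,T))$, for any $x\in X$ (independent of $x$). The universal cover $\tilde X$ carries the lifted length metric, on which $\pi_1(\Gamma\backslash X)$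 acts by deck transformations. $\mathrm{Loc\text{-}Geod}(X)$ (local geodesics defined on $\mathbb{R}$) and $\mathrm{Geod}(X)$ (geodesic lines) have the topology of uniform convergence on compact subsets of $\mathbb{R}$, with flow $(\Phi_t\gamma)(\cdot)=\gamma(\cdot+t)$. $\Gamma$ acts on $\mathrm{Geod}(X)$ by $(g\gamma)(\cdot)=g\gamma(\cdot)$, commuting with $\Phi_t$; $\bar\Phi_t$ is the induced action on $\Gamma\backslash\mathrm{Geod}(X)$. The space $\Gamma\backslash\mathrm{Geod}(X)$ is regarded as a subset of $\mathrm{Loc\text{-}Geod}(\Gamma\backslash X)$ via $[\gamma]\mapsto\pi\circ\gamma$, with $\pi\colon X\to\Gamma\backslash X$ the projection. For a metrizable space $Y$ and continuous $T\colon Y\to Y$, $$h_{\mathrm{top}}(Y,T)=\inf_{\rho}\sup_K\lim_{r\to0}\limsup_{n\to+\infty}\frac1n\log\mathrm{Cov}_{\rho^n}(K,r),$$ where $\rho$ ranges over metrics inducing the topology of $Y$, $K$ over compact subsets of $Y$, $\rho^n(y,y')=\max_{0\le i\le n-1}\rho(T^iy,T^iy')$, and $\mathrm{Cov}_{\rho^n}(K,r)$ is the minimal number of $\rho^n$-balls of radius $r$ needed to cover $K$. *)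

theory Defs
  imports "HOL-Analysis.Analysis" "HOL-Algebra.Bij"
begin

section \<open>Geodesics in abstract metric spaces\<close>

definition isometric_on :: "'a metric \<Rightarrow> real set \<Rightarrow> (real \<Rightarrow> 'a) \<Rightarrow> bool" where
  "isometric_on X I c \<longleftrightarrow>
     c ` I \<subseteq> mspace X \<and> (\<forall>s\<in>I. \<forall>t\<in>I. mdist X (c s) (c t) = \<bar>s - t\<bar>)"

definition geodesic_from_to :: "'a metric \<Rightarrow> (real \<Rightarrow> 'a) \<Rightarrow> 'a \<Rightarrow> 'a \<Rightarrow> bool" where
  "geodesic_from_to X c x y \<longleftrightarrow>
     isometric_on X {0..mdist X x y} c \<and> c 0 = x \<and> c (mdist X x y) = y"

definition geodesic_space :: "'a metric \<Rightarrow> bool" where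
  "geodesic_space X \<longleftrightarrow> (\<forall>x\<in>mspace X. \<forall>y\<in>mspace X. \<exists>c. geodesic_from_to X c x y)"

definition proper_space :: "'a metric \<Rightarrow> bool" where
  "proper_space X \<longleftrightarrow> (\<forall>x\<in>mspace X. \<forall>r. compactin (mtopology_of X) (mcball_of X x r))"

definition Geod :: "'a metric \<Rightarrow> (real \<Rightarrow> 'a) set" where
  "Geod X = {\<gamma>. isometric_on X UNIV \<gamma>}"

definition local_geodesic_on :: "'a metric \<Rightarrow> real set \<Rightarrow> (real \<Rightarrow> 'a) \<Rightarrow> bool" where
  "local_geodesic_on X I \<gamma> \<longleftrightarrow> (\<forall>t\<in>I. \<exists>\<epsilon>>0. isometric_on X ({t - \<epsilon>..t + \<epsilon>} \<inter> I) \<gamma>)"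

definition Loc_Geod :: "'a metric \<Rightarrow> (real \<Rightarrow> 'a) set" where
  "Loc_Geod X = {\<gamma>. local_geodesic_on X UNIV \<gamma>}"

definition locally_geodesically_complete :: "'a metric \<Rightarrow> bool" where
  "locally_geodesically_complete X \<longleftrightarrow>
     (\<forall>I \<gamma>. is_interval I \<and> I \<noteq> {} \<and> local_geodesic_on X I \<gamma> \<longrightarrow>
        (\<exists>\<gamma>'\<in>Loc_Geod X. \<forall>t\<in>I. \<gamma>' t = \<gamma> t))"

definition line_convex :: "'a metric \<Rightarrow> bool" where
  "line_convex X \<longleftrightarrow>
     (\<forall>\<gamma>\<in>Geod X. \<forall>\<gamma>'\<in>Geod X. convex_on UNIV (\<lambda>t. mdist X (\<gamma> t) (\<gamma>' t)))"

definition gromov_product :: "'a metric \<Rightarrow> 'a \<Rightarrow> 'a \<Rightarrow> 'a \<Rightarrow> real" where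
  "gromov_product X y z x = (mdist X x y + mdist X x z - mdist X y z) / 2"

definition gromov_hyperbolic :: "'a metric \<Rightarrow> bool" where
  "gromov_hyperbolic X \<longleftrightarrow>
     (\<exists>\<delta>\<ge>0. \<forall>x\<in>mspace X. \<forall>y\<in>mspace X. \<forall>z\<in>mspace X. \<forall>w\<in>mspace X.
        gromov_product X x z w \<ge> min (gromov_product X x y w) (gromov_product X y z w) - \<delta>)"


section \<open>Covering numbers and bounded geometry\<close>

text \<open>Open balls with centres in \<open>M\<close>; the value is \<open>\<infinity>\<close> if no finite cover exists.\<close>

definition covering_number :: "'a set \<Rightarrow> ('a \<Rightarrow> 'a \<Rightarrow> real) \<Rightarrow> 'a set \<Rightarrow> real \<Rightarrow> enat" where
  "covering_number M d B r =
     (INF F \<in> {F. finite F \<and> F \<subseteq> M \<and> B \<subseteq> (\<Union>x\<in>F. {y\<in>M. d x y < r})}. enat (card F))"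

definition bounded_geometry :: "'a metric \<Rightarrow> bool" where
  "bounded_geometry X \<longleftrightarrow>
     (\<forall>r R. 0 < r \<and> r \<le> R \<longrightarrow>
        (SUP x\<in>mspace X. covering_number (mspace X) (mdist X) (mcball_of X x R) r) < \<infinity>)"


section \<open>Locally CAT(-1) spaces\<close>

text \<open>
  The comparison space is the upper half-plane model of the hyperbolic plane (curvature -1). The
  absolute value is only there because \<^locale>\<open>Metric_space\<close> wants the distance to be
  nonnegative outside of the carrier, too.
\<close>

definition hyp_dist :: "complex \<Rightarrow> complex \<Rightarrow> real" where
  "hyp_dist z w = arcosh (1 + (cmod (z - w))\<^sup>2 / (2 * \<bar>Im z * Im w\<bar>))"

definition hyperbolic_plane :: "complex metric" where
  "hyperbolic_plane = metric ({z. Im z > 0}, hyp_dist)"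

text \<open>
  Two points on different sides of a geodesic triangle lie on two sides with a common vertex, which
  is called \<open>p\<close> here; points on the same side satisfy the comparison inequality trivially.
  The third side enters only through its length.
\<close>

definition CAT_minus_1 :: "'a metric \<Rightarrow> bool" where
  "CAT_minus_1 X \<longleftrightarrow> geodesic_space X \<and>
     (\<forall>p\<in>mspace X. \<forall>q\<in>mspace X. \<forall>r\<in>mspace X. \<forall>c1 c2.
        geodesic_from_to X c1 p q \<and> geodesic_from_to X c2 p r \<longrightarrow>
        (\<forall>p'\<in>mspace hyperbolic_plane. \<forall>q'\<in>mspace hyperbolic_plane. \<forall>r'\<in>mspace hyperbolic_plane.
           \<forall>c1' c2'.
           mdist hyperbolic_plane p' q' = mdist X p q \<and>
           mdist hyperbolic_plane p' r' = mdist X p r \<and>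
           mdist hyperbolic_plane q' r' = mdist X q r \<and>
           geodesic_from_to hyperbolic_plane c1' p' q' \<and>
           geodesic_from_to hyperbolic_plane c2' p' r' \<longrightarrow>
           (\<forall>s\<in>{0..mdist X p q}. \<forall>t\<in>{0..mdist X p r}.
              mdist X (c1 s) (c2 t) \<le> mdist hyperbolic_plane (c1' s) (c2' t))))"

definition locally_CAT_minus_1 :: "'a metric \<Rightarrow> bool" where
  "locally_CAT_minus_1 X \<longleftrightarrow>
     (\<forall>x\<in>mspace X. \<exists>r>0. CAT_minus_1 (submetric X (mball_of X x r)))"


section \<open>Groups of isometries and quotients\<close>

definition Isom :: "'a metric \<Rightarrow> ('a \<Rightarrow> 'a) monoid" where
  "Isom X = BijGroup (mspace X)
     \<lparr>carrier := {f \<in> Bij (mspace X).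
        \<forall>x\<in>mspace X. \<forall>y\<in>mspace X. mdist X (f x) (f y) = mdist X x y}\<rparr>"

definition torsion_free :: "'a metric \<Rightarrow> ('a \<Rightarrow> 'a) set \<Rightarrow> bool" where
  "torsion_free X \<Gamma> \<longleftrightarrow>
     (\<forall>g\<in>\<Gamma>. g \<noteq> \<one>\<^bsub>Isom X\<^esub> \<longrightarrow> (\<forall>n::nat. n > 0 \<longrightarrow> g [^]\<^bsub>Isom X\<^esub> n \<noteq> \<one>\<^bsub>Isom X\<^esub>))"

definition discrete_action :: "'a metric \<Rightarrow> ('a \<Rightarrow> 'a) set \<Rightarrow> bool" where
  "discrete_action X \<Gamma> \<longleftrightarrow> (\<forall>x\<in>mspace X. \<forall>R\<ge>0. finite {g\<in>\<Gamma>. mdist X x (g x) \<le> R})"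

definition orbit_of :: "('a \<Rightarrow> 'a) set \<Rightarrow> 'a \<Rightarrow> 'a set" where
  "orbit_of \<Gamma> x = (\<lambda>g. g x) ` \<Gamma>"

definition orbit_space :: "('a \<Rightarrow> 'a) set \<Rightarrow> 'a set \<Rightarrow> 'a set set" where
  "orbit_space \<Gamma> S = orbit_of \<Gamma> ` S"

text \<open>
  For a group of isometries, the infimum of \<open>d x (g y)\<close> over \<open>g\<close> is the infimum of the distances
  between points of the two orbits. The value \<open>0\<close> for empty sets, which are not orbits,
  is only there because \<^locale>\<open>Metric_space\<close> wants the distance to be nonnegative
  outside of the carrier, too.
\<close>

definition quotient_dist :: "'a metric \<Rightarrow> 'a set \<Rightarrow> 'a set \<Rightarrow> real" where
  "quotient_dist X A B =
     (if A = {} \<or> B = {} then 0 else (INF (x, y) \<in> A \<times> B. mdist X x y))"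

text \<open>
  Meaningful only if \<^const>\<open>quotient_dist\<close> is a metric on the orbit space, which is not implied
  by this definition and has to be stated separately.
\<close>

definition quotient_metric :: "'a metric \<Rightarrow> ('a \<Rightarrow> 'a) set \<Rightarrow> 'a set metric" where
  "quotient_metric X \<Gamma> = metric (orbit_space \<Gamma> (mspace X), quotient_dist X)"

definition cocompact :: "'a metric \<Rightarrow> ('a \<Rightarrow> 'a) set \<Rightarrow> bool" where
  "cocompact X \<Gamma> \<longleftrightarrow> compact_space (mtopology_of (quotient_metric X \<Gamma>))"


section \<open>Universal covers\<close>

text \<open>The counterpart of \<^const>\<open>covering_space\<close> for abstract topologies.\<close>

definition covering_map :: "'a topology \<Rightarrow> 'b topology \<Rightarrow> ('a \<Rightarrow> 'b) \<Rightarrow> bool" where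
  "covering_map C S p \<longleftrightarrow>
     continuous_map C S p \<and> p ` topspace C = topspace S \<and>
     (\<forall>x\<in>topspace S. \<exists>T. x \<in> T \<and> openin S T \<and>
        (\<exists>\<V>. \<Union>\<V> = {c\<in>topspace C. p c \<in> T} \<and> (\<forall>V\<in>\<V>. openin C V) \<and> pairwise disjnt \<V> \<and>
             (\<forall>V\<in>\<V>. homeomorphic_map (subtopology C V) (subtopology S T) p)))"

definition simply_connected_space :: "'a topology \<Rightarrow> bool" where
  "simply_connected_space T \<longleftrightarrow>
     path_connected_space T \<and>
     (\<forall>c. pathin T c \<and> c 0 = c 1 \<longrightarrow>
        homotopic_with (\<lambda>h. h 0 = c 0 \<and> h 1 = c 0) (top_of_set {0..1}) T c (\<lambda>_. c 0))"

definition curve_length :: "'a metric \<Rightarrow> (real \<Rightarrow> 'a) \<Rightarrow> ereal" where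
  "curve_length X c =
     (SUP ts \<in> {ts. sorted ts \<and> set ts \<subseteq> {0..1}}.
        ereal (\<Sum>i<length ts - 1. mdist X (c (ts ! i)) (c (ts ! Suc i))))"

text \<open>The last clause says that \<open>Y\<close> carries the length metric lifted from \<open>Q\<close>.\<close>

definition universal_cover :: "'a metric \<Rightarrow> ('a \<Rightarrow> 'b) \<Rightarrow> 'b metric \<Rightarrow> bool" where
  "universal_cover Y p Q \<longleftrightarrow>
     covering_map (mtopology_of Y) (mtopology_of Q) p \<and>
     simply_connected_space (mtopology_of Y) \<and>
     (\<forall>x\<in>mspace Y. \<forall>y\<in>mspace Y.
        ereal (mdist Y x y) =
          (INF c \<in> {c. pathin (mtopology_of Y) c \<and> c 0 = x \<and> c 1 = y}. curve_length Q (p \<circ> c)))"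

text \<open>
  For a universal cover this is the image of the fundamental group of the base under its (faithful)
  action by deck transformations.
\<close>

definition deck_transformations :: "'a metric \<Rightarrow> ('a \<Rightarrow> 'b) \<Rightarrow> ('a \<Rightarrow> 'a) set" where
  "deck_transformations Y p =
     {f \<in> Bij (mspace Y). homeomorphic_map (mtopology_of Y) (mtopology_of Y) f \<and>
        (\<forall>x\<in>mspace Y. p (f x) = p x)}"


section \<open>Critical exponent and topological entropy\<close>

definition ecard :: "'a set \<Rightarrow> enat" where
  "ecard A = (if finite A then enat (card A) else \<infinity>)"

text \<open>
  \<open>elog 0 = - \<infinity>\<close>, whereas \<open>ln 0 = 0\<close> in the library. In particular, the empty space has
  topological entropy \<open>- \<infinity>\<close>.
\<close>

definition elog :: "enat \<Rightarrow> ereal" where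
  "elog k = (case k of enat n \<Rightarrow> if n = 0 then - \<infinity> else ereal (ln (real n)) | \<infinity> \<Rightarrow> \<infinity>)"

definition h_crit :: "'a metric \<Rightarrow> ('a \<Rightarrow> 'a) set \<Rightarrow> 'a \<Rightarrow> ereal" where
  "h_crit X \<Gamma> x =
     Limsup at_top (\<lambda>T::real. elog (ecard (orbit_of \<Gamma> x \<inter> mball_of X x T)) / ereal T)"

definition dyn_dist :: "('a \<Rightarrow> 'a) \<Rightarrow> ('a \<Rightarrow> 'a \<Rightarrow> real) \<Rightarrow> nat \<Rightarrow> 'a \<Rightarrow> 'a \<Rightarrow> real" where
  "dyn_dist f \<rho> n y y' = Max ((\<lambda>i. \<rho> ((f ^^ i) y) ((f ^^ i) y')) ` {..<n})"

definition h_top :: "'a topology \<Rightarrow> ('a \<Rightarrow> 'a) \<Rightarrow> ereal" where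
  "h_top Y f =
     (INF \<rho> \<in> {\<rho>. Metric_space (topspace Y) \<rho> \<and> Metric_space.mtopology (topspace Y) \<rho> = Y}.
      SUP K \<in> {K. compactin Y K}.
        Lim (at_right 0) (\<lambda>r.
          limsup (\<lambda>n. elog (covering_number (topspace Y) (dyn_dist f \<rho> n) K r) / ereal (real n))))"


section \<open>Spaces of (local) geodesics and their flows\<close>

text \<open>The topology of uniform convergence on compact subsets of the real line.\<close>

definition ucc_topology :: "'a metric \<Rightarrow> (real \<Rightarrow> 'a) set \<Rightarrow> (real \<Rightarrow> 'a) topology" where
  "ucc_topology X S = topology (\<lambda>U. U \<subseteq> S \<and>
     (\<forall>\<gamma>\<in>U. \<exists>K \<epsilon>. compact K \<and> \<epsilon> > 0 \<and>
        {\<gamma>'\<in>S. \<forall>t\<in>K. mdist X (\<gamma> t) (\<gamma>' t) < \<epsilon>} \<subseteq> U))"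

definition quotient_topology :: "'a topology \<Rightarrow> ('a \<Rightarrow> 'a) set \<Rightarrow> 'a set topology" where
  "quotient_topology T \<Gamma> =
     topology (\<lambda>U. U \<subseteq> orbit_space \<Gamma> (topspace T) \<and>
       openin T {x\<in>topspace T. orbit_of \<Gamma> x \<in> U})"

definition Loc_Geod_top :: "'a metric \<Rightarrow> (real \<Rightarrow> 'a) topology" where
  "Loc_Geod_top X = ucc_topology X (Loc_Geod X)"

definition Geod_top :: "'a metric \<Rightarrow> (real \<Rightarrow> 'a) topology" where
  "Geod_top X = ucc_topology X (Geod X)"

definition flow :: "real \<Rightarrow> (real \<Rightarrow> 'a) \<Rightarrow> real \<Rightarrow> 'a" where
  "flow t \<gamma> = (\<lambda>s. \<gamma> (s + t))"

definition line_action :: "('a \<Rightarrow> 'a) set \<Rightarrow> ((real \<Rightarrow> 'a) \<Rightarrow> (real \<Rightarrow> 'a)) set" where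
  "line_action \<Gamma> = (\<lambda>g \<gamma>. g \<circ> \<gamma>) ` \<Gamma>"

definition quotient_Geod_top :: "'a metric \<Rightarrow> ('a \<Rightarrow> 'a) set \<Rightarrow> (real \<Rightarrow> 'a) set topology" where
  "quotient_Geod_top X \<Gamma> = quotient_topology (Geod_top X) (line_action \<Gamma>)"

text \<open>The flow commutes with the action, so it maps orbits to orbits.\<close>

definition quotient_flow :: "real \<Rightarrow> (real \<Rightarrow> 'a) set \<Rightarrow> (real \<Rightarrow> 'a) set" where
  "quotient_flow t A = flow t ` A"

text \<open>The map \<open>[\<gamma>] \<mapsto> \<pi> \<circ> \<gamma>\<close>; the choice of representative is irrelevant.\<close>

definition project_line :: "('a \<Rightarrow> 'a) set \<Rightarrow> (real \<Rightarrow> 'a) set \<Rightarrow> real \<Rightarrow> 'a set" where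
  "project_line \<Gamma> A = orbit_of \<Gamma> \<circ> (SOME \<gamma>. \<gamma> \<in> A)"


section \<open>Well-formedness of the constructions\<close>

lemma openin_ucc_topology:
  "openin (ucc_topology X S) U \<longleftrightarrow> U \<subseteq> S \<and>
     (\<forall>\<gamma>\<in>U. \<exists>K \<epsilon>. compact K \<and> \<epsilon> > 0 \<and>
        {\<gamma>'\<in>S. \<forall>t\<in>K. mdist X (\<gamma> t) (\<gamma>' t) < \<epsilon>} \<subseteq> U)"
proof -
  have "istopology (\<lambda>U. U \<subseteq> S \<and>
     (\<forall>\<gamma>\<in>U. \<exists>K \<epsilon>. compact K \<and> \<epsilon> > 0 \<and>
        {\<gamma>'\<in>S. \<forall>t\<in>K. mdist X (\<gamma> t) (\<gamma>' t) < \<epsilon>} \<subseteq> U))" (is "istopology ?P")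
    unfolding istopology_def
  proof (intro conjI allI impI)
    fix U V assume U: "?P U" and V: "?P V"
    have "\<exists>K \<epsilon>. compact K \<and> \<epsilon> > 0 \<and> {\<gamma>'\<in>S. \<forall>t\<in>K. mdist X (\<gamma> t) (\<gamma>' t) < \<epsilon>} \<subseteq> U \<inter> V"
      if "\<gamma> \<in> U \<inter> V" for \<gamma>
    proof -
      from U that obtain K1 e1 where 1: "compact K1" "e1 > (0::real)"
        "{\<gamma>'\<in>S. \<forall>t\<in>K1. mdist X (\<gamma> t) (\<gamma>' t) < e1} \<subseteq> U" by blast
      from V that obtain K2 e2 where 2: "compact K2" "e2 > (0::real)"
        "{\<gamma>'\<in>S. \<forall>t\<in>K2. mdist X (\<gamma> t) (\<gamma>' t) < e2} \<subseteq> V" by blast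
      have "compact (K1 \<union> K2)" "min e1 e2 > 0"
        "{\<gamma>'\<in>S. \<forall>t\<in>K1 \<union> K2. mdist X (\<gamma> t) (\<gamma>' t) < min e1 e2} \<subseteq> U \<inter> V"
        using 1 2 by (auto simp: compact_Un)
      then show ?thesis by blast
    qed
    then show "U \<inter> V \<subseteq> S" "\<forall>\<gamma>\<in>U \<inter> V. \<exists>K \<epsilon>. compact K \<and> \<epsilon> > 0 \<and>
        {\<gamma>'\<in>S. \<forall>t\<in>K. mdist X (\<gamma> t) (\<gamma>' t) < \<epsilon>} \<subseteq> U \<inter> V"
      using U by blast+
  next
    fix \<K> assume "\<forall>K\<in>\<K>. ?P K"
    then have *: "?P U" if "U \<in> \<K>" for U
      using that by blast
    then show "\<Union>\<K> \<subseteq> S" by blast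
    show "\<forall>\<gamma>\<in>\<Union>\<K>. \<exists>K \<epsilon>. compact K \<and> \<epsilon> > 0 \<and>
        {\<gamma>'\<in>S. \<forall>t\<in>K. mdist X (\<gamma> t) (\<gamma>' t) < \<epsilon>} \<subseteq> \<Union>\<K>"
    proof
      fix \<gamma> assume "\<gamma> \<in> \<Union>\<K>"
      then obtain U where U: "U \<in> \<K>" "\<gamma> \<in> U" by blast
      with *[OF U(1)] obtain K \<epsilon> where "compact K" "\<epsilon> > (0::real)"
        "{\<gamma>'\<in>S. \<forall>t\<in>K. mdist X (\<gamma> t) (\<gamma>' t) < \<epsilon>} \<subseteq> U" by blast
      moreover have "U \<subseteq> \<Union>\<K>" using U by blast
      ultimately show "\<exists>K \<epsilon>. compact K \<and> \<epsilon> > 0 \<and>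
        {\<gamma>'\<in>S. \<forall>t\<in>K. mdist X (\<gamma> t) (\<gamma>' t) < \<epsilon>} \<subseteq> \<Union>\<K>" by (meson order_trans)
    qed
  qed
  then show ?thesis
    by (simp add: ucc_topology_def topology_inverse')
qed

lemma topspace_ucc_topology [simp]: "topspace (ucc_topology X S) = S"
proof -
  have "openin (ucc_topology X S) S"
    unfolding openin_ucc_topology by (auto intro!: exI[of _ "{}"] exI[of _ "1::real"])
  then show ?thesis
    by (meson openin_subset openin_topspace openin_ucc_topology subset_antisym)
qed

lemma openin_quotient_topology:
  "openin (quotient_topology T \<Gamma>) U \<longleftrightarrow> U \<subseteq> orbit_space \<Gamma> (topspace T) \<and>
     openin T {x\<in>topspace T. orbit_of \<Gamma> x \<in> U}"
proof -
  have 1: "openin T {x\<in>topspace T. orbit_of \<Gamma> x \<in> U \<inter> V}"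
    if "openin T {x\<in>topspace T. orbit_of \<Gamma> x \<in> U}" "openin T {x\<in>topspace T. orbit_of \<Gamma> x \<in> V}" for U V
  proof -
    have "{x\<in>topspace T. orbit_of \<Gamma> x \<in> U \<inter> V} =
      {x\<in>topspace T. orbit_of \<Gamma> x \<in> U} \<inter> {x\<in>topspace T. orbit_of \<Gamma> x \<in> V}" by blast
    then show ?thesis using that by (simp add: openin_Int)
  qed
  have 2: "openin T {x\<in>topspace T. orbit_of \<Gamma> x \<in> \<Union>\<K>}"
    if "\<forall>K\<in>\<K>. openin T {x\<in>topspace T. orbit_of \<Gamma> x \<in> K}" for \<K>
  proof -
    have "{x\<in>topspace T. orbit_of \<Gamma> x \<in> \<Union>\<K>} =
      \<Union>((\<lambda>K. {x\<in>topspace T. orbit_of \<Gamma> x \<in> K}) ` \<K>)" by blast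
    then show ?thesis using that by auto
  qed
  have "istopology (\<lambda>U. U \<subseteq> orbit_space \<Gamma> (topspace T) \<and>
       openin T {x\<in>topspace T. orbit_of \<Gamma> x \<in> U})"
    unfolding istopology_def using 1 2 by (intro conjI allI impI) blast+
  then show ?thesis
    by (simp add: quotient_topology_def topology_inverse')
qed

lemma group_Isom: "group (Isom X)"
proof -
  let ?M = "mspace X"
  interpret B: group "BijGroup ?M" by (rule group_BijGroup)
  let ?C = "{f \<in> Bij ?M. \<forall>x\<in>?M. \<forall>y\<in>?M. mdist X (f x) (f y) = mdist X x y}"
  have map: "f x \<in> ?M" if "f \<in> Bij ?M" "x \<in> ?M" for f x
    using Bij_imp_funcset[OF that(1)] that(2) by blast
  have "subgroup ?C (BijGroup ?M)"
  proof (rule B.subgroupI)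
    show "?C \<subseteq> carrier (BijGroup ?M)" by (auto simp: BijGroup_def)
    show "?C \<noteq> {}"
      using id_Bij[of ?M] by (auto intro!: exI[of _ "\<lambda>x\<in>?M. x"])
  next
    fix f assume f: "f \<in> ?C"
    have inv: "inv\<^bsub>BijGroup ?M\<^esub> f = (\<lambda>x\<in>?M. inv_into ?M f x)"
    proof (rule B.inv_equality)
      show "(\<lambda>x\<in>?M. inv_into ?M f x) \<otimes>\<^bsub>BijGroup ?M\<^esub> f = \<one>\<^bsub>BijGroup ?M\<^esub>"
        using f restrict_inv_into_Bij[of f ?M] Bij_compose_restrict_eq[of f ?M]
        by (simp add: BijGroup_def)
    qed (use f restrict_inv_into_Bij[of f ?M] in \<open>auto simp: BijGroup_def\<close>)
    have "mdist X (inv_into ?M f x) (inv_into ?M f y) = mdist X x y" if "x \<in> ?M" "y \<in> ?M" for x y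
    proof -
      have im: "f ` ?M = ?M" using f by (simp add: Bij_def bij_betw_def)
      have mem: "inv_into ?M f x \<in> ?M" "inv_into ?M f y \<in> ?M"
        and eq: "f (inv_into ?M f x) = x" "f (inv_into ?M f y) = y"
        using that im by (auto simp: inv_into_into f_inv_into_f)
      have "mdist X (f (inv_into ?M f x)) (f (inv_into ?M f y)) =
          mdist X (inv_into ?M f x) (inv_into ?M f y)"
        using f mem by blast
      then show ?thesis by (simp only: eq)
    qed
    then show "inv\<^bsub>BijGroup ?M\<^esub> f \<in> ?C"
      using f restrict_inv_into_Bij[of f ?M] by (simp add: inv)
  next
    fix f g assume "f \<in> ?C" "g \<in> ?C"
    then show "f \<otimes>\<^bsub>BijGroup ?M\<^esub> g \<in> ?C"
      using compose_Bij[of f ?M g] map by (auto simp: BijGroup_def compose_def)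
  qed
  then show ?thesis
    unfolding Isom_def by (rule B.subgroup_imp_group)
qed

text \<open>
  The triangle inequality is Ptolemy's inequality for \<open>z\<close>, \<open>w\<close>, \<open>u\<close> and \<open>cnj w\<close>.
\<close>

lemma hyp_dist_nonneg: "hyp_dist z w \<ge> 0"
  unfolding hyp_dist_def by (rule arcosh_nonneg_real) simp

lemma hyp_dist_half:
  assumes "Im z > 0" "Im w > 0"
  shows "sinh (hyp_dist z w / 2) = cmod (z - w) / (2 * sqrt (Im z * Im w))"
    and "cosh (hyp_dist z w / 2) = cmod (z - cnj w) / (2 * sqrt (Im z * Im w))"
proof -
  let ?d = "hyp_dist z w"
  have pos: "Im z * Im w > 0" using assms by simp
  have nn: "?d \<ge> 0" by (rule hyp_dist_nonneg)
  have c: "cosh ?d = 1 + (cmod (z - w))\<^sup>2 / (2 * (Im z * Im w))"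
    unfolding hyp_dist_def using pos by (subst cosh_arcosh_real) auto
  have c2: "cosh ?d = 2 * (cosh (?d/2))\<^sup>2 - 1"
    using cosh_double_cosh[of "?d/2"] by simp
  have s2: "(cosh (?d/2))\<^sup>2 = (sinh (?d/2))\<^sup>2 + 1" by (simp add: cosh_square_eq)
  have S: "(sinh (?d/2))\<^sup>2 = (cmod (z - w))\<^sup>2 / (4 * (Im z * Im w))"
    using c c2 s2 by simp
  also have "\<dots> = (cmod (z - w) / (2 * sqrt (Im z * Im w)))\<^sup>2"
    using pos by (simp add: power_divide power_mult_distrib)
  finally show "sinh (?d/2) = cmod (z - w) / (2 * sqrt (Im z * Im w))"
    using nn pos by (subst (asm) power2_eq_iff_nonneg) auto
  have id: "(cmod (z - cnj w))\<^sup>2 = (cmod (z - w))\<^sup>2 + 4 * (Im z * Im w)"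
    by (simp add: cmod_power2) (simp add: power2_eq_square algebra_simps)
  have "(cosh (?d/2))\<^sup>2 = (cmod (z - cnj w))\<^sup>2 / (4 * (Im z * Im w))"
    unfolding s2 S id using assms by (simp add: add_divide_distrib)
  also have "\<dots> = (cmod (z - cnj w) / (2 * sqrt (Im z * Im w)))\<^sup>2"
    using pos by (simp add: power_divide power_mult_distrib)
  finally show "cosh (?d/2) = cmod (z - cnj w) / (2 * sqrt (Im z * Im w))"
    using pos by (subst (asm) power2_eq_iff_nonneg) auto
qed

lemma Metric_space_hyp_dist: "Metric_space {z. Im z > 0} hyp_dist"
proof
  fix z w
  show "hyp_dist z w \<ge> 0" by (rule hyp_dist_nonneg)
  show "hyp_dist z w = hyp_dist w z"
    by (simp add: hyp_dist_def norm_minus_commute mult.commute)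
next
  fix z w assume "z \<in> {z. Im z > 0}" "w \<in> {z. Im z > 0}"
  then have pos: "Im z > 0" "Im w > 0" by auto
  have "hyp_dist z w = 0 \<longleftrightarrow> sinh (hyp_dist z w / 2) = 0" by simp
  also have "\<dots> \<longleftrightarrow> z = w" unfolding hyp_dist_half(1)[OF pos] using pos by simp
  finally show "hyp_dist z w = 0 \<longleftrightarrow> z = w" .
next
  fix z w u assume "z \<in> {z. Im z > 0}" "w \<in> {z. Im z > 0}" "u \<in> {z. Im z > 0}"
  then have pos: "Im z > 0" "Im w > 0" "Im u > 0" by auto
  have "(z - u) * (w - cnj w) = (z - w) * (u - cnj w) + (z - cnj w) * (w - u)"
    by (simp add: algebra_simps)
  then have "cmod (z - u) * cmod (w - cnj w) \<le>
      cmod (z - w) * cmod (u - cnj w) + cmod (z - cnj w) * cmod (w - u)"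
    by (metis norm_mult norm_triangle_ineq)
  moreover have "cmod (w - cnj w) = 2 * Im w"
    using pos by (simp add: complex_diff_cnj norm_mult)
  moreover have "cmod (u - cnj w) = cmod (w - cnj u)"
    by (metis complex_cnj_cnj complex_cnj_diff complex_mod_cnj norm_minus_commute)
  ultimately have ptolemy: "cmod (z - u) * (2 * Im w) \<le>
      cmod (z - w) * cmod (w - cnj u) + cmod (z - cnj w) * cmod (w - u)" by simp
  define a b c where "a = sqrt (Im z)" and "b = sqrt (Im w)" and "c = sqrt (Im u)"
  have abc: "a > 0" "b > 0" "c > 0" "Im w = b\<^sup>2" using pos by (auto simp: a_def b_def c_def)
  have "sinh (hyp_dist z u / 2) = cmod (z - u) * (2 * Im w) / (4 * (a * b) * (b * c))"
    using pos abc by (simp add: hyp_dist_half real_sqrt_mult power2_eq_square flip: a_def b_def c_def)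
  also have "\<dots> \<le> (cmod (z - w) * cmod (w - cnj u) + cmod (z - cnj w) * cmod (w - u)) /
      (4 * (a * b) * (b * c))"
    using ptolemy abc by (intro divide_right_mono) auto
  also have "\<dots> = sinh (hyp_dist z w / 2 + hyp_dist w u / 2)"
    using pos abc unfolding sinh_add
    by (simp add: hyp_dist_half real_sqrt_mult add_divide_distrib flip: a_def b_def c_def)
  finally show "hyp_dist z u \<le> hyp_dist z w + hyp_dist w u" by simp
qed


lemma mspace_hyperbolic_plane [simp]: "mspace hyperbolic_plane = {z. Im z > 0}"
  by (simp add: hyperbolic_plane_def Metric_space.mspace_metric Metric_space_hyp_dist)

lemma mdist_hyperbolic_plane [simp]: "mdist hyperbolic_plane = hyp_dist"
  by (simp add: hyperbolic_plane_def Metric_space.mdist_metric Metric_space_hyp_dist)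

text \<open>
  A proper metric space is separable, hence has at most the cardinality of the continuum. So it is
  no restriction to look for such a space, or for the universal cover of its compact locally CAT(-1)
  quotient (which is proper as well), in the type \<^typ>\<open>real metric\<close>, whose elements are arbitrary
  metrics on arbitrary sets of real numbers.
\<close>

end

theory Submission
  imports Defs "HOL-Complex_Analysis.Winding_Numbers" "HOL-Real_Asymp.Real_Asymp"
begin

text \<open>
  The space is the real line with a loop of length 1 attached at every integer, on which the integers
  act by translation. The quotient is the rose with two petals of length 1, and its universal cover is
  the 4-regular tree. Geodesic lines never enter the loops: they run along the real line, which gives
  line-convexity, and since the translations by integers are factored out, the flow at time 1 acts
  trivially on the classes of lines; orbits grow linearly, so both quantities vanish. The local
  geodesics of the rose, however, are the bi-infinite reduced words over the four oriented petals
  together with a phase. There are \<open>4 * 3 ^ (n - 1)\<close> reduced words of length \<open>n\<close>, which gives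
  the value \<open>ln 3\<close> both for the entropy and for the growth of the fibres of the tree.
\<close>

section \<open>Geodesics\<close>

text \<open>Line-convexity and the flow on lines see only bi-infinite geodesics. A space may
  therefore carry short loops that no line enters, while the local geodesics of its quotient run
  through them freely. The line with loops is an intermediate cover of the rose with the integers as
  deck group; the universal cover has a free group of rank two, and the gap is that between linear
  and exponential growth. Small balls of the rose are trees, so the curvature bound needs no
  hyperbolic trigonometry, only the triangle inequality in the comparison plane. The entropy is an
  infimum over all compatible metrics. One weighted supremum metric gives the upper bound; the lower
  bound must work for an arbitrary metric and comes from a Lebesgue number on the compact set of
  local geodesics of phase 0, which the flow at time 1 preserves. The fundamental group is never
  computed: the critical exponent depends only on deck orbits, and these turn out to be the fibres,
  because left multiplications by letters already connect all points of a fibre. Vertices of the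
  tree are finite words, and their countability allows a coding in the reals.\<close>

definition joined :: "'a metric \<Rightarrow> 'a \<Rightarrow> 'a \<Rightarrow> bool" where
  "joined X x y \<longleftrightarrow> (\<exists>c. geodesic_from_to X c x y)"

text \<open>The arc between the two parameters may be traversed in either direction;
  \<open>e\<close> is the sign of the reparametrization.\<close>

lemma joined_isometric:
  assumes f: "isometric_on X {a..b} f" and st: "s \<in> {a..b}" "t \<in> {a..b}"
  shows "joined X (f s) (f t)"
proof -
  have d: "mdist X (f s) (f t) = \<bar>s - t\<bar>"
    using f st by (auto simp: isometric_on_def)
  define e where "e = (if s \<le> t then 1 else -1 :: real)"
  have e: "s + e * \<bar>s - t\<bar> = t" "\<bar>e\<bar> = 1" by (auto simp: e_def)
  have in_ab: "s + e * u \<in> {a..b}" if "u \<in> {0..\<bar>s - t\<bar>}" for u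
    using that st by (auto simp: e_def abs_if split: if_splits)
  have "\<bar>(s + e * u) - (s + e * v)\<bar> = \<bar>u - v\<bar>" for u v
    by (auto simp: e_def abs_if)
  then have "geodesic_from_to X (\<lambda>u. f (s + e * u)) (f s) (f t)"
    unfolding geodesic_from_to_def d using f in_ab e
    by (simp add: isometric_on_def image_subset_iff)
  then show ?thesis by (auto simp: joined_def)
qed

lemma joined_commute: "joined X x y \<Longrightarrow> joined X y x"
proof -
  assume "joined X x y"
  then obtain c where c: "isometric_on X {0..mdist X x y} c" "c 0 = x" "c (mdist X x y) = y"
    by (auto simp: joined_def geodesic_from_to_def)
  then show ?thesis
    using joined_isometric[OF c(1), of "mdist X x y" 0] by simp
qed

lemma joined_refl: "x \<in> mspace X \<Longrightarrow> joined X x x"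
  using joined_isometric[of X 0 0 "\<lambda>_. x" 0 0] by (simp add: isometric_on_def)

text \<open>Two geodesics concatenate to a geodesic as soon as their lengths add up: a shortcut
  between a point of the first and a point of the second would shorten the way from \<open>x\<close>
  to \<open>y\<close> below their distance.\<close>

lemma joined_trans:
  assumes "joined X x m" "joined X m y" and d: "mdist X x y = mdist X x m + mdist X m y"
  shows "joined X x y"
proof -
  define a b where "a = mdist X x m" and "b = mdist X m y"
  obtain c1 where c1: "c1 ` {0..a} \<subseteq> mspace X"
      "\<And>s t. s \<in> {0..a} \<Longrightarrow> t \<in> {0..a} \<Longrightarrow> mdist X (c1 s) (c1 t) = \<bar>s - t\<bar>" "c1 0 = x" "c1 a = m"
    using assms(1) by (auto simp: joined_def geodesic_from_to_def isometric_on_def a_def)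
  obtain c2 where c2: "c2 ` {0..b} \<subseteq> mspace X"
      "\<And>s t. s \<in> {0..b} \<Longrightarrow> t \<in> {0..b} \<Longrightarrow> mdist X (c2 s) (c2 t) = \<bar>s - t\<bar>" "c2 0 = m" "c2 b = y"
    using assms(2) by (auto simp: joined_def geodesic_from_to_def isometric_on_def b_def)
  have ab: "0 \<le> a" "0 \<le> b" by (auto simp: a_def b_def)
  define c where "c t = (if t \<le> a then c1 t else c2 (t - a))" for t
  have mem1: "c1 s \<in> mspace X" if "s \<in> {0..a}" for s using c1(1) that by blast
  have mem2: "c2 s \<in> mspace X" if "s \<in> {0..b}" for s using c2(1) that by blast
  have mix: "mdist X (c1 s) (c2 t) = t + a - s" if s: "s \<in> {0..a}" and t: "t \<in> {0..b}" for s t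
  proof (rule antisym)
    have "mdist X (c1 s) (c2 t) \<le> mdist X (c1 s) (c1 a) + mdist X (c2 0) (c2 t)"
      using mdist_triangle[OF mem1[OF s] mem1[of a] mem2[OF t]] ab c1(4) c2(3) by simp
    then show "mdist X (c1 s) (c2 t) \<le> t + a - s"
      using c1(2)[of s a] c2(2)[of 0 t] s t ab by auto
    have "mdist X x y \<le> mdist X (c1 0) (c1 s) + mdist X (c1 s) (c2 t) + mdist X (c2 t) (c2 b)"
      using mdist_triangle[OF mem1[of 0] mem1[OF s] mem2[OF t]]
        mdist_triangle[OF mem1[of 0] mem2[OF t] mem2[of b]] ab c1(3) c2(4) by simp
    then show "t + a - s \<le> mdist X (c1 s) (c2 t)"
      using c1(2)[of 0 s] c2(2)[of t b] s t ab d by (auto simp flip: a_def b_def)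
  qed
  have dd: "mdist X (c s) (c t) = \<bar>s - t\<bar>" if st: "s \<in> {0..a+b}" "t \<in> {0..a+b}" for s t
  proof -
    consider "s \<le> a" "t \<le> a" | "s \<le> a" "a < t" | "a < s" "t \<le> a" | "a < s" "a < t" by linarith
    then show ?thesis
    proof cases
      case 1 then show ?thesis using st c1(2)[of s t] by (simp add: c_def)
    next
      case 2 then show ?thesis using st mix[of s "t - a"] by (simp add: c_def)
    next
      case 3 then show ?thesis using st mix[of t "s - a"] by (simp add: c_def mdist_commute)
    next
      case 4 then show ?thesis using st c2(2)[of "s - a" "t - a"] by (simp add: c_def)
    qed
  qed
  have "c t \<in> mspace X" if "t \<in> {0..a+b}" for t
    using that mem1[of t] mem2[of "t - a"] by (auto simp: c_def)
  then have "isometric_on X {0..a+b} c"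
    using dd by (auto simp: isometric_on_def)
  moreover have "c 0 = x" "c (a + b) = y"
    using c1 c2 ab by (auto simp: c_def)
  ultimately show ?thesis
    unfolding joined_def geodesic_from_to_def using d by (auto simp flip: a_def b_def)
qed

lemma geodesic_space_joined: "geodesic_space X \<longleftrightarrow> (\<forall>x\<in>mspace X. \<forall>y\<in>mspace X. joined X x y)"
  by (simp add: geodesic_space_def joined_def)

text \<open>The bound at scale \<epsilon> is summed over steps of length at most \<epsilon>. Curves
  that preserve distances only locally, such as local geodesics and projected geodesics, become
  globally nonexpansive in this way.\<close>

lemma nonexpansive_of_local:
  fixes D :: "'b \<Rightarrow> 'b \<Rightarrow> real"
  assumes tri: "\<And>r s t. r \<in> {a..b} \<Longrightarrow> s \<in> {a..b} \<Longrightarrow> t \<in> {a..b} \<Longrightarrow> D (f r) (f t) \<le> D (f r) (f s) + D (f s) (f t)"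
    and loc: "\<And>s t. s \<in> {a..b} \<Longrightarrow> t \<in> {a..b} \<Longrightarrow> \<bar>s - t\<bar> \<le> \<epsilon> \<Longrightarrow> D (f s) (f t) \<le> \<bar>s - t\<bar>"
    and \<epsilon>: "\<epsilon> > 0" and st: "s \<in> {a..b}" "t \<in> {a..b}"
  shows "D (f s) (f t) \<le> \<bar>s - t\<bar>"
proof -
  have *: "D (f s) (f t) \<le> \<bar>s - t\<bar>" if "s \<in> {a..b}" "t \<in> {a..b}" "\<bar>s - t\<bar> \<le> real n * \<epsilon>" for n s t
    using that
  proof (induction n arbitrary: s t)
    case 0
    then show ?case using loc[of s t] \<epsilon> by simp
  next
    case (Suc n)
    define e where "e = (if s \<le> t then 1 else -1 :: real)"
    define m where "m = s + e * min \<epsilon> \<bar>s - t\<bar>"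
    have m: "m \<in> {a..b}" "\<bar>s - m\<bar> \<le> \<epsilon>" "\<bar>s - t\<bar> = \<bar>s - m\<bar> + \<bar>m - t\<bar>" "\<bar>m - t\<bar> \<le> real n * \<epsilon>"
      using Suc.prems \<epsilon> by (auto simp: m_def e_def min_def abs_if algebra_simps split: if_splits)
    then show ?case
      using tri[of s m t] loc[of s m] Suc.IH[of m t] Suc.prems by fastforce
  qed
  obtain n :: nat where "\<bar>s - t\<bar> \<le> real n * \<epsilon>"
    using \<epsilon> by (metis ex_less_of_nat_mult less_imp_le)
  then show ?thesis using * st by blast
qed

section \<open>Continuity and homeomorphisms from metric estimates\<close>

lemma continuous_map_nonexpansive:
  assumes "\<And>s. s \<in> S \<Longrightarrow> f s \<in> mspace X"
    and "\<And>s t. s \<in> S \<Longrightarrow> t \<in> S \<Longrightarrow> mdist X (f s) (f t) \<le> C * \<bar>s - t\<bar>"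
  shows "continuous_map (top_of_set S) (mtopology_of X) f"
proof -
  have "Lipschitz_continuous_map (submetric euclidean_metric S) X f"
    unfolding Lipschitz_continuous_map_def using assms by (auto simp: dist_real_def)
  then show ?thesis
    using Lipschitz_continuous_imp_continuous_map by (fastforce simp: mtopology_of_submetric)
qed

lemma compactin_nonexpansive_image:
  assumes "\<And>s. s \<in> {a..b} \<Longrightarrow> f s \<in> mspace X"
    and "\<And>s t. s \<in> {a..b} \<Longrightarrow> t \<in> {a..b} \<Longrightarrow> mdist X (f s) (f t) \<le> \<bar>s - t\<bar>"
  shows "compactin (mtopology_of X) (f ` {a..b::real})"
proof -
  have "continuous_map (top_of_set {a..b}) (mtopology_of X) f"
    using continuous_map_nonexpansive[of "{a..b}" f X 1] assms by simp
  moreover have "compactin (top_of_set {a..b}) {a..b}"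
    by (simp add: compactin_subtopology)
  ultimately show ?thesis using image_compactin by blast
qed

lemma continuous_map_metricI:
  assumes "f ` mspace A \<subseteq> mspace B"
    and "\<And>x e. x \<in> mspace A \<Longrightarrow> e > 0 \<Longrightarrow> \<exists>\<delta>>0. \<forall>y\<in>mspace A. mdist A x y < \<delta> \<longrightarrow> mdist B (f x) (f y) < e"
  shows "continuous_map (mtopology_of A) (mtopology_of B) f"
  unfolding mtopology_of_def
  using Metric_space.metric_continuous_map[OF Metric_space_mspace_mdist Metric_space_mspace_mdist, of A B f] assms
  by meson

lemma homeomorphic_map_isometry:
  assumes im: "f ` mspace A = mspace B"
    and d: "\<And>x y. x \<in> mspace A \<Longrightarrow> y \<in> mspace A \<Longrightarrow> mdist B (f x) (f y) = mdist A x y"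
  shows "homeomorphic_map (mtopology_of A) (mtopology_of B) f"
proof -
  have inj: "inj_on f (mspace A)"
    using d im by (intro inj_onI) (metis image_eqI mdist_zero)
  define g where "g = inv_into (mspace A) f"
  have g: "g y \<in> mspace A" "f (g y) = y" if "y \<in> mspace B" for y
    using that im by (auto simp: g_def inv_into_into f_inv_into_f)
  have "continuous_map (mtopology_of A) (mtopology_of B) f"
    using im d by (intro continuous_map_metricI) auto
  moreover have "continuous_map (mtopology_of B) (mtopology_of A) g"
    using g d by (intro continuous_map_metricI) (auto, metis)
  ultimately have "homeomorphic_maps (mtopology_of A) (mtopology_of B) f g"
    using g inj im by (auto simp: homeomorphic_maps_def g_def)
  then show ?thesis by (auto simp: homeomorphic_map_maps)
qed

section \<open>Trees are CAT(-1)\<close>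

text \<open>
  In a 0-hyperbolic space the distance of points on two sides is the lower bound that the triangle
  inequality enforces in every comparison triangle.
\<close>

lemma CAT_minus_1_if_zero_hyperbolic:
  assumes geo: "geodesic_space X"
    and hyp: "\<And>x y z w. x \<in> mspace X \<Longrightarrow> y \<in> mspace X \<Longrightarrow> z \<in> mspace X \<Longrightarrow> w \<in> mspace X \<Longrightarrow>
      min (gromov_product X x y w) (gromov_product X y z w) \<le> gromov_product X x z w"
  shows "CAT_minus_1 X"
  unfolding CAT_minus_1_def
proof (intro conjI geo ballI allI impI; elim conjE)
  fix p q r c1 c2 p' q' r' c1' c2' s t
  assume mem: "p \<in> mspace X" "q \<in> mspace X" "r \<in> mspace X"
    and c: "geodesic_from_to X c1 p q" "geodesic_from_to X c2 p r"
    and s: "s \<in> {0..mdist X p q}" and t: "t \<in> {0..mdist X p r}"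
    and mem': "p' \<in> mspace hyperbolic_plane" "q' \<in> mspace hyperbolic_plane" "r' \<in> mspace hyperbolic_plane"
    and dist: "mdist hyperbolic_plane p' q' = mdist X p q" "mdist hyperbolic_plane p' r' = mdist X p r"
      "mdist hyperbolic_plane q' r' = mdist X q r"
    and c': "geodesic_from_to hyperbolic_plane c1' p' q'" "geodesic_from_to hyperbolic_plane c2' p' r'"
  have seg: "c 0 = x" "c (mdist Y x y) = y" "c u \<in> mspace Y" "mdist Y x (c u) = u" "mdist Y (c u) y = mdist Y x y - u"
    if "geodesic_from_to Y c x y" "u \<in> {0..mdist Y x y}" for Y :: "'z metric" and c x y u
  proof -
    have iso: "\<And>u v. u \<in> {0..mdist Y x y} \<Longrightarrow> v \<in> {0..mdist Y x y} \<Longrightarrow> mdist Y (c u) (c v) = \<bar>u - v\<bar>"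
      and *: "c 0 = x" "c (mdist Y x y) = y" "c u \<in> mspace Y"
      using that by (auto simp: geodesic_from_to_def isometric_on_def)
    show "c 0 = x" "c (mdist Y x y) = y" "c u \<in> mspace Y" by fact+
    show "mdist Y x (c u) = u" "mdist Y (c u) y = mdist Y x y - u"
      using iso[of 0 u] iso[of u "mdist Y x y"] * that by auto
  qed
  define a b where "a = c1 s" and "b = c2 t"
  define a' b' where "a' = c1' s" and "b' = c2' t"
  have a: "a \<in> mspace X" "mdist X p a = s" "mdist X a q = mdist X p q - s"
    using seg[OF c(1) s] by (auto simp: a_def)
  have b: "b \<in> mspace X" "mdist X p b = t" "mdist X b r = mdist X p r - t"
    using seg[OF c(2) t] by (auto simp: b_def)
  have a': "a' \<in> mspace hyperbolic_plane" "mdist hyperbolic_plane p' a' = s"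
      "mdist hyperbolic_plane a' q' = mdist X p q - s"
    using seg[OF c'(1), of s] s dist(1) by (auto simp: a'_def)
  have b': "b' \<in> mspace hyperbolic_plane" "mdist hyperbolic_plane p' b' = t"
      "mdist hyperbolic_plane b' r' = mdist X p r - t"
    using seg[OF c'(2), of t] t dist(2) by (auto simp: b'_def)
  let ?d = "mdist hyperbolic_plane"
  have l1: "\<bar>s - t\<bar> \<le> ?d a' b'"
    using mdist_triangle[OF mem'(1) a'(1) b'(1)] mdist_triangle[OF mem'(1) b'(1) a'(1)] a' b'
    by (simp add: mdist_commute[of hyperbolic_plane] del: mdist_hyperbolic_plane)
  have l2: "mdist X q r \<le> mdist X p q - s + ?d a' b' + (mdist X p r - t)"
    using mdist_triangle[OF mem'(2) a'(1) mem'(3)] mdist_triangle[OF a'(1) b'(1) mem'(3)] a' b' dist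
    by (simp add: mdist_commute[of hyperbolic_plane] del: mdist_hyperbolic_plane)
  \<comment> \<open>In a tree, \<open>g\<close> is the length for which the sides from
    \<open>p\<close> to \<open>q\<close> and to \<open>r\<close> run together.\<close>
  define g where "g = gromov_product X q r p"
  have "gromov_product X a q p = s"
    using a by (simp add: gromov_product_def)
  moreover have "gromov_product X r b p = t"
    using b by (simp add: gromov_product_def mdist_commute)
  moreover have "min (gromov_product X a q p) (gromov_product X q b p) \<le> gromov_product X a b p"
    by (rule hyp) (use a b mem in auto)
  moreover have "min (gromov_product X q r p) (gromov_product X r b p) \<le> gromov_product X q b p"
    by (rule hyp) (use a b mem in auto)
  \<comment> \<open>The product of \<open>a\<close> and \<open>b\<close> at \<open>p\<close> is
    bounded from below along the chain \<open>a\<close>, \<open>q\<close>, \<open>r\<close>,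
    \<open>b\<close>.\<close>
  ultimately have "min s (min g t) \<le> gromov_product X a b p"
    by (auto simp: g_def min_def split: if_splits)
  then have "mdist X a b \<le> max \<bar>s - t\<bar> (s + t - 2 * g)"
    using a b by (auto simp: gromov_product_def min_def max_def split: if_splits)
  \<comment> \<open>\<open>s + t - 2 * g\<close> is what remains of the distance of \<open>q\<close>
    and \<open>r\<close> after the two end pieces are removed, and \<open>l2\<close> bounds this by
    the comparison distance.\<close>
  also have "\<dots> \<le> ?d a' b'"
    using l1 l2 by (simp add: g_def gromov_product_def field_simps)
  finally show "mdist X (c1 s) (c2 t) \<le> ?d (c1' s) (c2' t)"
    by (simp add: a_def b_def a'_def b'_def)
qed

section \<open>Universal covers\<close>

text \<open>
  The free contraction turns a loop \<open>c\<close> into \<open>\<beta>\<close> followed by its reverse, where \<open>\<beta>\<close> is the track of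
  the base point; this path is then shortened to the base point.
\<close>

lemma contractible_imp_simply_connected_space:
  assumes "contractible_space T"
  shows "simply_connected_space T"
  unfolding simply_connected_space_def
proof (intro conjI allI impI; (elim conjE)?)
  show "path_connected_space T" using assms by (rule contractible_imp_path_connected_space)
next
  fix c assume c: "pathin T c" "c 0 = c 1"
  let ?I = "{0..1::real}"
  let ?P = "\<lambda>h. h 0 = c 0 \<and> h 1 = c 0"
  have cin: "c t \<in> topspace T" if "t \<in> ?I" for t
    using c(1) that path_image_subset_topspace by fastforce
  obtain h a where h: "continuous_map (prod_topology (top_of_set ?I) T) T h"
      and h01: "\<And>x. h (0, x) = x" "\<And>x. h (1, x) = a"
    using assms unfolding contractible_space_def homotopic_with_def by auto
  define F where "F = (\<lambda>(s, t). h (s, c t))"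
  have F: "continuous_map (top_of_set (?I \<times> ?I)) T F"
  proof -
    have "continuous_map (prod_topology (top_of_set ?I) (top_of_set ?I))
        (prod_topology (top_of_set ?I) T) (\<lambda>(s, t). (s, c t))"
      using c(1) unfolding pathin_def
      by (intro continuous_map_prod_top[THEN iffD2]) auto
    from continuous_map_compose[OF this h] show ?thesis
      by (simp add: F_def o_def case_prod_unfold)
  qed
  \<comment> \<open>\<open>m\<close> rises to 1 on the first third, stays there and falls back on
    the last third; \<open>k\<close> is 0, runs from 0 to 1 on the middle third, and is 1
    afterwards. So \<open>F (m t, k t)\<close> follows the track of the base point, then the
    completely contracted loop, then the track backwards.\<close>
  define m where "m t = min (min (3 * t) (3 - 3 * t)) (1::real)" for t
  define k where "k t = max 0 (min 1 (3 * t - 1 :: real))" for t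
  have m01: "m t \<in> ?I" if "t \<in> ?I" for t using that by (auto simp: m_def min_def)
  have k01: "k t \<in> ?I" for t by (auto simp: k_def min_def max_def)
  have cont_m: "continuous_on S (\<lambda>x. m (f x))" and cont_k: "continuous_on S (\<lambda>x. k (f x))"
    if "continuous_on S f" for S :: "(real \<times> real) set" and f
    unfolding m_def k_def using that by (intro continuous_intros; simp)+
  define \<phi> where "\<phi> = (\<lambda>(s, t). (s * m t, (1 - s) * t + s * k t))"
  have \<phi>: "continuous_map (top_of_set (?I \<times> ?I)) (top_of_set (?I \<times> ?I)) \<phi>"
  proof -
    have "continuous_on (?I \<times> ?I) \<phi>"
      unfolding \<phi>_def case_prod_unfold by (intro continuous_intros cont_m cont_k)
    moreover have "\<phi> ` (?I \<times> ?I) \<subseteq> ?I \<times> ?I"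
    proof (clarsimp simp: \<phi>_def)
      fix s t :: real assume st: "0 \<le> s" "s \<le> 1" "0 \<le> t" "t \<le> 1"
      have "s * m t \<le> 1" "0 \<le> s * m t" using m01[of t] st by (auto intro: mult_le_one)
      moreover have "(1 - s) * t + s * k t \<le> 1"
        using k01[of t] st by (intro convex_bound_le) auto
      moreover have "0 \<le> (1 - s) * t + s * k t" using k01[of t] st by auto
      ultimately show "0 \<le> s * m t \<and> s * m t \<le> 1 \<and> 0 \<le> (1 - s) * t + s * k t \<and> (1 - s) * t + s * k t \<le> 1"
        by blast
    qed
    ultimately show ?thesis by (auto simp: continuous_map_subtopology_eu)
  qed
  \<comment> \<open>The second homotopy follows the track only up to time \<open>1 - s\<close>, so
    it ends in the constant curve at the base point.\<close>
  define \<psi> where "\<psi> = (\<lambda>(s, t). ((1 - s) * m t, 0::real))"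
  have \<psi>: "continuous_map (top_of_set (?I \<times> ?I)) (top_of_set (?I \<times> ?I)) \<psi>"
  proof -
    have "continuous_on (?I \<times> ?I) \<psi>"
      unfolding \<psi>_def case_prod_unfold by (intro continuous_intros cont_m)
    moreover have "\<psi> ` (?I \<times> ?I) \<subseteq> ?I \<times> ?I"
      using m01 by (auto simp: \<psi>_def intro!: mult_le_one)
    ultimately show ?thesis by (auto simp: continuous_map_subtopology_eu)
  qed
  have hom: "homotopic_with ?P (top_of_set ?I) T f g"
    if "continuous_map (top_of_set (?I \<times> ?I)) T G" "\<And>t. t \<in> ?I \<Longrightarrow> G (0, t) = f t"
      "\<And>t. t \<in> ?I \<Longrightarrow> G (1, t) = g t" "\<And>s. s \<in> ?I \<Longrightarrow> G (s, 0) = c 0 \<and> G (s, 1) = c 0" for G f g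
    using that by (subst homotopic_with) (auto intro!: exI[of _ G])
  have "homotopic_with ?P (top_of_set ?I) T c (\<lambda>t. h (m t, c 0))"
  proof (rule hom)
    show "continuous_map (top_of_set (?I \<times> ?I)) T (F \<circ> \<phi>)"
      using \<phi> F by (rule continuous_map_compose)
    show "(F \<circ> \<phi>) (1, t) = h (m t, c 0)" if "t \<in> ?I" for t
    proof -
      consider "t \<le> 1/3" | "1/3 \<le> t" "t \<le> 2/3" | "2/3 \<le> t" by linarith
      then show ?thesis
      proof cases
        case 1
        then have "k t = 0" using that by (auto simp: k_def min_def max_def)
        then show ?thesis by (simp add: F_def \<phi>_def)
      next
        case 2
        then have "m t = 1" using that by (auto simp: m_def min_def)
        then show ?thesis by (simp add: F_def \<phi>_def h01)
      next
        case 3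
        then have "k t = 1" using that by (auto simp: k_def min_def max_def)
        then show ?thesis by (simp add: F_def \<phi>_def c)
      qed
    qed
  qed (auto simp: F_def \<phi>_def m_def k_def h01 c)
  moreover have "homotopic_with ?P (top_of_set ?I) T (\<lambda>t. h (m t, c 0)) (\<lambda>_. c 0)"
  proof (rule hom)
    show "continuous_map (top_of_set (?I \<times> ?I)) T (F \<circ> \<psi>)"
      using \<psi> F by (rule continuous_map_compose)
  qed (auto simp: F_def \<psi>_def m_def h01)
  ultimately show "homotopic_with ?P (top_of_set ?I) T c (\<lambda>_. c 0)"
    by (rule homotopic_with_trans)
qed

text \<open>The scale \<epsilon> is uniform in the point. Together, \<open>iso\<close> and
  \<open>lift\<close> make \<open>p\<close> an isometry from each ball of radius
  \<open>\<epsilon> / 2\<close> onto a ball of the base, which yields even covering and lets lengths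
  be compared upstairs and downstairs.\<close>

locale local_isometry =
  fixes Y :: "'a metric" and Q :: "'b metric" and p :: "'a \<Rightarrow> 'b" and \<epsilon> :: real
  assumes pos: "\<epsilon> > 0" and surj: "p ` mspace Y = mspace Q"
    and iso: "\<And>u v. u \<in> mspace Y \<Longrightarrow> v \<in> mspace Y \<Longrightarrow> mdist Y u v < \<epsilon> \<Longrightarrow> mdist Q (p u) (p v) = mdist Y u v"
    and lift: "\<And>u x. u \<in> mspace Y \<Longrightarrow> x \<in> mspace Q \<Longrightarrow> mdist Q (p u) x < \<epsilon> \<Longrightarrow>
      \<exists>v\<in>mspace Y. p v = x \<and> mdist Y u v = mdist Q (p u) x"
begin

lemma p_in: "u \<in> mspace Y \<Longrightarrow> p u \<in> mspace Q"
  using surj by blast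

lemma covering: "covering_map (mtopology_of Y) (mtopology_of Q) p"
  unfolding covering_map_def
proof (intro conjI ballI)
  show "continuous_map (mtopology_of Y) (mtopology_of Q) p"
  proof (rule continuous_map_metricI)
    fix x and e :: real assume "x \<in> mspace Y" "e > 0"
    then show "\<exists>\<delta>>0. \<forall>y\<in>mspace Y. mdist Y x y < \<delta> \<longrightarrow> mdist Q (p x) (p y) < e"
      using iso pos by (intro exI[of _ "min e \<epsilon>"]) auto
  qed (use surj in auto)
  show "p ` topspace (mtopology_of Y) = topspace (mtopology_of Q)" using surj by simp
next
  fix x assume "x \<in> topspace (mtopology_of Q)"
  then have x: "x \<in> mspace Q" by simp
  \<comment> \<open>Half the scale: points of one ball are closer than \<epsilon>, and if two balls
    about points of the fibre met, their centres would be closer than \<epsilon> with equal images,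
    hence equal.\<close>
  define r where "r = \<epsilon> / 2"
  have r: "r > 0" using pos by (simp add: r_def)
  define B where "B = mball_of Q x r"
  define F where "F = {y \<in> mspace Y. p y = x}"
  define V where "V = mball_of Y"
  have opn: "openin (mtopology_of Z) (mball_of Z z r)" for Z :: "'z metric" and z
    by (simp add: mball_of_def mtopology_of_def Metric_space.openin_mball)
  have close: "mdist Y u v < \<epsilon>" if "y \<in> F" "u \<in> V y r" "v \<in> V y r" for y u v
    using mdist_triangle[of u Y y v] that by (auto simp: V_def F_def r_def mdist_commute)
  have "\<Union>((\<lambda>y. V y r) ` F) = {c \<in> topspace (mtopology_of Y). p c \<in> B}"
  proof (intro equalityI subsetI)
    fix c assume "c \<in> \<Union>((\<lambda>y. V y r) ` F)"
    then obtain y where "y \<in> F" "c \<in> V y r" by blast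
    then show "c \<in> {c \<in> topspace (mtopology_of Y). p c \<in> B}"
      using iso[of y c] pos x p_in by (auto simp: V_def F_def B_def r_def)
  next
    fix c assume c: "c \<in> {c \<in> topspace (mtopology_of Y). p c \<in> B}"
    then obtain y where "y \<in> mspace Y" "p y = x" "mdist Y c y = mdist Q (p c) x"
      using lift[of c x] x pos by (auto simp: B_def r_def mdist_commute)
    then show "c \<in> \<Union>((\<lambda>y. V y r) ` F)"
      using c by (auto simp: V_def F_def B_def mdist_commute)
  qed
  moreover have "\<forall>W\<in>(\<lambda>y. V y r) ` F. openin (mtopology_of Y) W"
    using opn by (auto simp: V_def)
  moreover have "pairwise disjnt ((\<lambda>y. V y r) ` F)"
  proof (clarsimp simp: pairwise_def)
    fix y y' assume y: "y \<in> F" "y' \<in> F" and ne: "V y r \<noteq> V y' r"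
    show "disjnt (V y r) (V y' r)"
    proof (rule ccontr)
      assume "\<not> disjnt (V y r) (V y' r)"
      then obtain z where z: "z \<in> V y r" "z \<in> V y' r" by (auto simp: disjnt_def)
      then have "mdist Y y y' < \<epsilon>"
        using mdist_triangle[of y Y z y'] y by (auto simp: V_def r_def F_def mdist_commute)
      moreover have "mdist Q x x = 0" using x by simp
      ultimately have "mdist Y y y' = 0" using iso[of y y'] y by (simp add: F_def)
      then have "y = y'" using y by (simp add: F_def)
      then show False using ne by simp
    qed
  qed
  moreover have "\<forall>W\<in>(\<lambda>y. V y r) ` F. homeomorphic_map (subtopology (mtopology_of Y) W) (subtopology (mtopology_of Q) B) p"
  proof (clarsimp)
    fix y assume y: "y \<in> F"
    have sub: "V y r \<inter> mspace Y = V y r" "B \<inter> mspace Q = B" by (auto simp: V_def B_def)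
    have "homeomorphic_map (mtopology_of (submetric Y (V y r))) (mtopology_of (submetric Q B)) p"
    proof (rule homeomorphic_map_isometry; simp add: sub)
      show "p ` V y r = B"
      proof (intro equalityI subsetI)
        fix z assume "z \<in> p ` V y r"
        then show "z \<in> B" using iso[of y] y x pos p_in by (auto simp: V_def B_def F_def r_def)
      next
        fix z assume z: "z \<in> B"
        then obtain v where "v \<in> mspace Y" "p v = z" "mdist Y y v = mdist Q x z"
          using lift[of y z] y pos by (auto simp: B_def F_def r_def)
        then show "z \<in> p ` V y r" using z y by (auto simp: V_def B_def F_def)
      qed
      show "mdist Q (p u) (p v) = mdist Y u v" if "u \<in> V y r" "v \<in> V y r" for u v
        using iso[of u v] close[OF y that] that by (auto simp: V_def)
    qed
    then show "homeomorphic_map (subtopology (mtopology_of Y) (V y r)) (subtopology (mtopology_of Q) B) p"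
      by (simp add: mtopology_of_submetric)
  qed
  moreover have "mdist Q x x < r" using x r by (metis mdist_zero)
  ultimately show "\<exists>T. x \<in> T \<and> openin (mtopology_of Q) T \<and>
      (\<exists>\<V>. \<Union>\<V> = {c \<in> topspace (mtopology_of Y). p c \<in> T} \<and> (\<forall>V\<in>\<V>. openin (mtopology_of Y) V) \<and>
        pairwise disjnt \<V> \<and>
        (\<forall>V\<in>\<V>. homeomorphic_map (subtopology (mtopology_of Y) V) (subtopology (mtopology_of Q) T) p))"
    using opn[of Q x] x r by (intro exI[of _ B] conjI exI[of _ "(\<lambda>y. V y r) ` F"]) (auto simp: B_def)
qed

text \<open>A path is uniformly continuous, so a fine equidistant partition has steps shorter than
  \<epsilon>. These have the same length in \<open>Q\<close> as in \<open>Y\<close>, where the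
  triangle inequality bounds their sum from below.\<close>

lemma dist_le_curve_length:
  assumes c: "pathin (mtopology_of Y) c"
  shows "ereal (mdist Y (c 0) (c 1)) \<le> curve_length Q (p \<circ> c)"
proof -
  let ?I = "{0..1::real}"
  have c_in: "c t \<in> mspace Y" if "t \<in> ?I" for t
    using path_image_subset_topspace[OF c] that by auto
  have "uniformly_continuous_map (submetric euclidean_metric ?I) Y c"
  proof -
    have cp: "compact_space (mtopology_of (submetric euclidean_metric ?I))"
      by (simp add: mtopology_of_submetric compact_space_subtopology)
    have "continuous_map (mtopology_of (submetric euclidean_metric ?I)) (mtopology_of Y) c"
      using c by (simp add: pathin_def mtopology_of_submetric)
    with cp show ?thesis using continuous_imp_uniformly_continuous_map by blast
  qed
  then obtain \<delta> where \<delta>: "\<delta> > 0" and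
      "\<forall>s\<in>?I. \<forall>t\<in>?I. dist s t < \<delta> \<longrightarrow> mdist Y (c s) (c t) < \<epsilon>"
    unfolding uniformly_continuous_map_def using pos by (auto simp: dist_commute)
  then have unif: "mdist Y (c s) (c t) < \<epsilon>" if "s \<in> ?I" "t \<in> ?I" "\<bar>s - t\<bar> < \<delta>" for s t
    using that by (auto simp: dist_real_def)
  obtain n :: nat where n: "1 / real (Suc n) < \<delta>"
    using \<delta> nat_approx_posE by blast
  define N where "N = Suc n"
  define x where "x i = real i / real N" for i
  have x: "x i \<in> ?I" if "i \<le> N" for i using that by (simp add: x_def N_def)
  define ts where "ts = map x [0..<Suc N]"
  have nth: "ts ! i = x i" if "i \<le> N" for i using that by (simp add: ts_def nth_append del: upt_Suc)
  have len: "length ts = Suc N" by (simp add: ts_def)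
  have ts: "sorted ts" "set ts \<subseteq> ?I"
    using x by (auto simp: sorted_iff_nth_mono len nth x_def divide_right_mono) (auto simp: ts_def x_def)
  have step: "mdist Q (p (c (x i))) (p (c (x (Suc i)))) = mdist Y (c (x i)) (c (x (Suc i)))" if "i < N" for i
  proof -
    have "\<bar>x i - x (Suc i)\<bar> = 1 / real N" by (simp add: x_def N_def diff_divide_distrib[symmetric])
    then show ?thesis
      using unif[of "x i" "x (Suc i)"] x[of i] x[of "Suc i"] n that
      by (intro iso c_in) (auto simp: N_def)
  qed
  have tri: "mdist Y (c (x 0)) (c (x k)) \<le> (\<Sum>i<k. mdist Y (c (x i)) (c (x (Suc i))))" if "k \<le> N" for k
    using that
  proof (induction k)
    case 0
    have "mdist Y (c (x 0)) (c (x 0)) = 0" using c_in[OF x[of 0]] by simp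
    then show ?case by simp
  next
    case (Suc k)
    then show ?case
      using mdist_triangle[of "c (x 0)" Y "c (x k)" "c (x (Suc k))"] c_in x by force
  qed
  have "mdist Y (c 0) (c 1) \<le> (\<Sum>i<N. mdist Y (c (x i)) (c (x (Suc i))))"
    using tri[of N] by (simp add: x_def N_def)
  also have "\<dots> = (\<Sum>i<length ts - 1. mdist Q ((p \<circ> c) (ts ! i)) ((p \<circ> c) (ts ! Suc i)))"
    by (rule sum.cong) (auto simp: len nth step)
  finally show ?thesis
    unfolding curve_length_def using ts
    by (intro SUP_upper2[of ts]) auto
qed

text \<open>The metric of a geodesic \<open>Y\<close> is the lifted length metric: no path is
  shorter downstairs than the distance of its end points in \<open>Y\<close>, and the projection of
  a geodesic, being nonexpansive, is not longer.\<close>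

lemma universal_cover:
  assumes geo: "geodesic_space Y" and con: "contractible_space (mtopology_of Y)"
  shows "universal_cover Y p Q"
  unfolding universal_cover_def
proof (intro conjI ballI covering contractible_imp_simply_connected_space con)
  fix x y assume xy: "x \<in> mspace Y" "y \<in> mspace Y"
  define d where "d = mdist Y x y"
  have d0: "d \<ge> 0" by (simp add: d_def)
  let ?C = "{c. pathin (mtopology_of Y) c \<and> c 0 = x \<and> c 1 = y}"
  obtain g where g: "isometric_on Y {0..d} g" "g 0 = x" "g d = y"
    using geo xy unfolding geodesic_space_def geodesic_from_to_def d_def by blast
  then have gin: "g t \<in> mspace Y" if "t \<in> {0..d}" for t
    using that by (auto simp: isometric_on_def)
  have gd: "mdist Y (g s) (g t) = \<bar>s - t\<bar>" if "s \<in> {0..d}" "t \<in> {0..d}" for s t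
    using that g by (auto simp: isometric_on_def)
  have short: "mdist Q (p (g s)) (p (g t)) \<le> \<bar>s - t\<bar>" if "s \<in> {0..d}" "t \<in> {0..d}" for s t
  proof (rule nonexpansive_of_local[where D = "mdist Q" and f = "\<lambda>t. p (g t)" and a = 0 and b = d and \<epsilon> = "\<epsilon> / 2"])
    show "mdist Q (p (g s)) (p (g t)) \<le> \<bar>s - t\<bar>" if "s \<in> {0..d}" "t \<in> {0..d}" "\<bar>s - t\<bar> \<le> \<epsilon> / 2" for s t
      using iso[of "g s" "g t"] gd[of s t] gin[of s] gin[of t] that pos by auto
  qed (use that pos in \<open>auto intro!: mdist_triangle p_in gin\<close>)
  define c where "c t = g (d * t)" for t
  have dI: "d * t \<in> {0..d}" if "t \<in> {0..1}" for t
    using that d0 by (simp add: mult_left_le)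
  have c: "c \<in> ?C"
  proof -
    have "continuous_map (top_of_set {0..1}) (mtopology_of Y) c"
      using gin gd dI d0 by (intro continuous_map_nonexpansive[where C = d])
        (auto simp: c_def simp flip: right_diff_distrib' abs_mult_pos')
    then show ?thesis using g d0 by (simp add: pathin_def c_def)
  qed
  have "curve_length Q (p \<circ> c) \<le> ereal d"
    unfolding curve_length_def
  proof (rule SUP_least, clarify)
    fix ts :: "real list" assume ts: "sorted ts" "set ts \<subseteq> {0..1}"
    have nth: "ts ! i \<in> {0..1}" if "i < length ts" for i using ts(2) that nth_mem by blast
    have sums: "(\<Sum>i<k. mdist Q ((p \<circ> c) (ts ! i)) ((p \<circ> c) (ts ! Suc i))) \<le> d * (ts ! k - ts ! 0)"
      if "k < length ts" for k
      using that
    proof (induction k)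
      case (Suc k)
      have "ts ! k \<le> ts ! Suc k" using ts(1) Suc.prems by (simp add: sorted_nth_mono)
      then have "mdist Q ((p \<circ> c) (ts ! k)) ((p \<circ> c) (ts ! Suc k)) \<le> d * (ts ! Suc k - ts ! k)"
        using short[OF dI[OF nth[of k]] dI[OF nth[of "Suc k"]]] Suc.prems d0
        by (simp add: c_def abs_mult flip: right_diff_distrib')
      then show ?case using Suc by (simp add: algebra_simps)
    qed simp
    have "(\<Sum>i<length ts - 1. mdist Q ((p \<circ> c) (ts ! i)) ((p \<circ> c) (ts ! Suc i))) \<le> d"
    proof (cases "ts = []")
      case False
      then have "d * (ts ! (length ts - 1) - ts ! 0) \<le> d * 1"
        using nth[of "length ts - 1"] nth[of 0] d0 by (intro mult_left_mono) auto
      then show ?thesis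
        using sums[of "length ts - 1"] False by fastforce
    qed (use d0 in auto)
    then show "ereal (\<Sum>i<length ts - 1. mdist Q ((p \<circ> c) (ts ! i)) ((p \<circ> c) (ts ! Suc i))) \<le> ereal d"
      by simp
  qed
  then have "(INF c\<in>?C. curve_length Q (p \<circ> c)) \<le> ereal d"
    using c by (intro INF_lower2) auto
  moreover have "ereal d \<le> (INF c\<in>?C. curve_length Q (p \<circ> c))"
    using dist_le_curve_length by (intro INF_greatest) (auto simp: d_def)
  ultimately show "ereal (mdist Y x y) = (INF c\<in>?C. curve_length Q (p \<circ> c))"
    by (simp add: d_def)
qed

end

section \<open>Topological entropy\<close>

lemma covering_number_le:
  assumes "finite F" "F \<subseteq> M" "B \<subseteq> (\<Union>x\<in>F. {y\<in>M. d x y < r})"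
  shows "covering_number M d B r \<le> enat (card F)"
  unfolding covering_number_def using assms by (intro INF_lower) auto

lemma covering_number_ge:
  assumes "\<And>F. finite F \<Longrightarrow> F \<subseteq> M \<Longrightarrow> B \<subseteq> (\<Union>x\<in>F. {y\<in>M. d x y < r}) \<Longrightarrow> k \<le> card F"
  shows "enat k \<le> covering_number M d B r"
  unfolding covering_number_def using assms by (intro INF_greatest) auto

lemma covering_number_antimono:
  assumes "r \<le> s"
  shows "covering_number M d B s \<le> covering_number M d B r"
  unfolding covering_number_def
proof (rule INF_superset_mono)
  have "{y\<in>M. d x y < r} \<subseteq> {y\<in>M. d x y < s}" for x using assms by auto
  then show "{F. finite F \<and> F \<subseteq> M \<and> B \<subseteq> (\<Union>x\<in>F. {y\<in>M. d x y < r})} \<subseteq>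
      {F. finite F \<and> F \<subseteq> M \<and> B \<subseteq> (\<Union>x\<in>F. {y\<in>M. d x y < s})}" by blast
qed simp

lemma elog_mono: "m \<le> n \<Longrightarrow> elog m \<le> elog n"
  by (auto simp: elog_def split: enat.splits)

lemma elog_enat: "0 < k \<Longrightarrow> elog (enat k) = ereal (ln (real k))"
  by (simp add: elog_def)

text \<open>Covering numbers grow as the radius shrinks, so the limit at 0 in the entropy is a
  supremum over all radii and can be bounded from below at a single radius.\<close>

lemma Lim_at_right_antimono:
  fixes h :: "real \<Rightarrow> ereal"
  assumes "\<And>r s. 0 < r \<Longrightarrow> r \<le> s \<Longrightarrow> h s \<le> h r"
  shows "Lim (at_right 0) h = (SUP r\<in>{0<..}. h r)"
proof (rule tendsto_Lim)
  show "\<not> trivial_limit (at_right (0::real))" by (rule trivial_limit_at_right_real)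
  show "(h \<longlongrightarrow> (SUP r\<in>{0<..}. h r)) (at_right 0)"
  proof (rule order_tendstoI)
    fix a assume "a < (SUP r\<in>{0<..}. h r)"
    then obtain s where s: "s > 0" "a < h s" by (auto simp: less_SUP_iff)
    have "eventually (\<lambda>r. r \<in> {0<..<s}) (at_right 0)"
      using s(1) by (rule eventually_at_right_real)
    then show "eventually (\<lambda>r. a < h r) (at_right 0)"
    proof eventually_elim
      case (elim r)
      then have "h s \<le> h r" using assms[of r s] by simp
      with s(2) show ?case by (rule less_le_trans)
    qed
  next
    fix a assume a: "(SUP r\<in>{0<..}. h r) < a"
    have "eventually (\<lambda>r. r \<in> {0<..<1}) (at_right (0::real))"
      by (rule eventually_at_right_real) simp
    then show "eventually (\<lambda>r. h r < a) (at_right 0)"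
    proof eventually_elim
      case (elim r)
      then have "h r \<le> (SUP r\<in>{0<..}. h r)" by (intro SUP_upper) simp
      then show ?case using a by (rule le_less_trans)
    qed
  qed
qed

definition entropy_rate where
  "entropy_rate M f \<rho> K r =
     limsup (\<lambda>n. elog (covering_number M (dyn_dist f \<rho> n) K r) / ereal (real n))"

lemma entropy_rate_antimono:
  assumes "r \<le> s"
  shows "entropy_rate M f \<rho> K s \<le> entropy_rate M f \<rho> K r"
  unfolding entropy_rate_def
proof (rule Limsup_mono)
  have "elog (covering_number M (dyn_dist f \<rho> n) K s) / ereal (real n)
      \<le> elog (covering_number M (dyn_dist f \<rho> n) K r) / ereal (real n)" if "n > 0" for n
    using that by (intro ereal_divide_right_mono elog_mono covering_number_antimono assms) simp
  then show "\<forall>\<^sub>F n in sequentially. elog (covering_number M (dyn_dist f \<rho> n) K s) / ereal (real n)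
      \<le> elog (covering_number M (dyn_dist f \<rho> n) K r) / ereal (real n)"
    by (rule eventually_mono[OF eventually_gt_at_top])
qed

text \<open>By the shape inf-sup-sup, the upper bound is checked for one metric but all compact sets
  and radii, the lower bound for all metrics but one compact set and one radius, which may depend on
  the metric.\<close>

lemma h_top_eqI:
  assumes metric: "Metric_space (topspace Y) \<rho>" "Metric_space.mtopology (topspace Y) \<rho> = Y"
    and upper: "\<And>K r. compactin Y K \<Longrightarrow> r > 0 \<Longrightarrow> entropy_rate (topspace Y) f \<rho> K r \<le> h"
    and lower: "\<And>\<sigma>. Metric_space (topspace Y) \<sigma> \<Longrightarrow> Metric_space.mtopology (topspace Y) \<sigma> = Y \<Longrightarrow>
      \<exists>K r. compactin Y K \<and> r > 0 \<and> h \<le> entropy_rate (topspace Y) f \<sigma> K r"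
  shows "h_top Y f = h"
proof -
  have lim: "Lim (at_right 0) (entropy_rate (topspace Y) f \<sigma> K) = (SUP r\<in>{0<..}. entropy_rate (topspace Y) f \<sigma> K r)"
    for \<sigma> K by (rule Lim_at_right_antimono) (rule entropy_rate_antimono)
  have "h_top Y f = (INF \<sigma> \<in> {\<sigma>. Metric_space (topspace Y) \<sigma> \<and> Metric_space.mtopology (topspace Y) \<sigma> = Y}.
      SUP K \<in> {K. compactin Y K}. SUP r\<in>{0<..}. entropy_rate (topspace Y) f \<sigma> K r)"
    unfolding h_top_def by (simp flip: lim entropy_rate_def)
  also have "\<dots> = h"
  proof (rule antisym)
    show "(INF \<sigma> \<in> {\<sigma>. Metric_space (topspace Y) \<sigma> \<and> Metric_space.mtopology (topspace Y) \<sigma> = Y}.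
      SUP K \<in> {K. compactin Y K}. SUP r\<in>{0<..}. entropy_rate (topspace Y) f \<sigma> K r) \<le> h"
      by (rule INF_lower2[of \<rho>]) (use metric upper in \<open>auto intro!: SUP_least\<close>)
    show "h \<le> (INF \<sigma> \<in> {\<sigma>. Metric_space (topspace Y) \<sigma> \<and> Metric_space.mtopology (topspace Y) \<sigma> = Y}.
      SUP K \<in> {K. compactin Y K}. SUP r\<in>{0<..}. entropy_rate (topspace Y) f \<sigma> K r)"
    proof (rule INF_greatest, clarify)
      fix \<sigma> assume "Metric_space (topspace Y) \<sigma>" "Metric_space.mtopology (topspace Y) \<sigma> = Y"
      from lower[OF this] obtain K r where "compactin Y K" "r > 0" "h \<le> entropy_rate (topspace Y) f \<sigma> K r"
        by blast
      then show "h \<le> (SUP K \<in> {K. compactin Y K}. SUP r\<in>{0<..}. entropy_rate (topspace Y) f \<sigma> K r)"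
        by (intro SUP_upper2[of K] SUP_upper2[of r]) auto
    qed
  qed
  finally show ?thesis .
qed

section \<open>Exponential growth rates\<close>

lemma affine_growth_rate:
  assumes "filterlim T at_top F"
  shows "((\<lambda>x. ereal (b + c * T x) / ereal (T x)) \<longlongrightarrow> ereal c) F"
proof -
  have "((\<lambda>x. b / T x) \<longlongrightarrow> 0) F"
    using assms by (intro tendsto_divide_0[OF tendsto_const] filterlim_at_top_imp_at_infinity)
  then have "((\<lambda>x. b / T x + c) \<longlongrightarrow> 0 + c) F"
    by (intro tendsto_add tendsto_const)
  then have lim: "((\<lambda>x. ereal (b / T x + c)) \<longlongrightarrow> ereal c) F" by simp
  have "eventually (\<lambda>x. T x > 0) F"
    using assms by (simp add: filterlim_at_top_dense)
  then have "eventually (\<lambda>x. ereal (b / T x + c) = ereal (b + c * T x) / ereal (T x)) F"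
    by eventually_elim (simp add: field_simps)
  with lim show ?thesis by (rule Lim_transform_eventually)
qed

text \<open>Constant factors in a count and bounded shifts of the time or the radius only change
  \<open>b\<close>. The filter is left open because entropy counts along the naturals and the
  critical exponent along the reals.\<close>

lemma Limsup_rate_le:
  assumes T: "filterlim T at_top F" and F: "F \<noteq> bot"
    and le: "\<forall>\<^sub>F x in F. N x \<le> ereal (b + c * T x)"
  shows "Limsup F (\<lambda>x. N x / ereal (T x)) \<le> ereal c"
proof -
  have ev: "eventually (\<lambda>x. T x > 0) F"
    using T by (simp add: filterlim_at_top_dense)
  have "Limsup F (\<lambda>x. N x / ereal (T x)) \<le> Limsup F (\<lambda>x. ereal (b + c * T x) / ereal (T x))"
    by (rule Limsup_mono, use le ev in eventually_elim) (intro ereal_divide_right_mono, auto)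
  also have "\<dots> = ereal c"
    by (intro lim_imp_Limsup F affine_growth_rate T)
  finally show ?thesis .
qed

lemma Limsup_rate_ge:
  assumes T: "filterlim T at_top F" and F: "F \<noteq> bot"
    and le: "\<forall>\<^sub>F x in F. ereal (b + c * T x) \<le> N x"
  shows "ereal c \<le> Limsup F (\<lambda>x. N x / ereal (T x))"
proof -
  have ev: "eventually (\<lambda>x. T x > 0) F"
    using T by (simp add: filterlim_at_top_dense)
  have "ereal c = Limsup F (\<lambda>x. ereal (b + c * T x) / ereal (T x))"
    by (intro lim_imp_Limsup[symmetric] F affine_growth_rate T)
  also have "\<dots> \<le> Limsup F (\<lambda>x. N x / ereal (T x))"
    by (rule Limsup_mono, use le ev in eventually_elim) (intro ereal_divide_right_mono, auto)
  finally show ?thesis .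
qed

text \<open>Truncating the distance makes the supremum meaningful for arbitrary curves.\<close>

definition sup_dist :: "'a metric \<Rightarrow> (real \<Rightarrow> 'a) \<Rightarrow> (real \<Rightarrow> 'a) \<Rightarrow> real" where
  "sup_dist Q \<gamma> \<gamma>' = (SUP t. min 1 (mdist Q (\<gamma> t) (\<gamma>' t)) / (1 + \<bar>t\<bar>))"

lemma sup_dist_bdd: "bdd_above (range (\<lambda>t::real. min 1 (mdist Q (\<gamma> t) (\<gamma>' t)) / (1 + \<bar>t\<bar>)))"
  by (intro bdd_aboveI[of _ 1]) (auto simp: divide_le_eq)

lemma sup_dist_upper: "min 1 (mdist Q (\<gamma> t) (\<gamma>' t)) / (1 + \<bar>t\<bar>) \<le> sup_dist Q \<gamma> \<gamma>'"
  unfolding sup_dist_def by (rule cSUP_upper[OF UNIV_I sup_dist_bdd])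

lemma sup_dist_least:
  assumes "\<And>t. min 1 (mdist Q (\<gamma> t) (\<gamma>' t)) \<le> c * (1 + \<bar>t\<bar>)"
  shows "sup_dist Q \<gamma> \<gamma>' \<le> c"
  unfolding sup_dist_def using assms by (intro cSUP_least) (auto simp: divide_le_eq)

lemma Metric_space_sup_dist:
  assumes S: "\<And>\<gamma> t. \<gamma> \<in> S \<Longrightarrow> \<gamma> t \<in> mspace Q"
  shows "Metric_space S (sup_dist Q)"
proof
  fix \<gamma> \<gamma>'
  show nonneg: "0 \<le> sup_dist Q \<gamma> \<gamma>'"
    by (rule order_trans[OF _ sup_dist_upper[of Q \<gamma> 0 \<gamma>']]) simp
  show "sup_dist Q \<gamma> \<gamma>' = sup_dist Q \<gamma>' \<gamma>"
    by (simp add: sup_dist_def mdist_commute)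
  assume mem: "\<gamma> \<in> S" "\<gamma>' \<in> S"
  show "sup_dist Q \<gamma> \<gamma>' = 0 \<longleftrightarrow> \<gamma> = \<gamma>'"
  proof
    assume 0: "sup_dist Q \<gamma> \<gamma>' = 0"
    show "\<gamma> = \<gamma>'"
    proof
      fix t
      have "min 1 (mdist Q (\<gamma> t) (\<gamma>' t)) / (1 + \<bar>t\<bar>) \<le> 0"
        using sup_dist_upper[of Q \<gamma> t \<gamma>'] 0 by simp
      then have "mdist Q (\<gamma> t) (\<gamma>' t) \<le> 0"
        by (auto simp: divide_le_0_iff)
      then have "mdist Q (\<gamma> t) (\<gamma>' t) = 0" using mdist_nonneg[of Q "\<gamma> t" "\<gamma>' t"] by linarith
      then show "\<gamma> t = \<gamma>' t" using S mem by simp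
    qed
  next
    assume "\<gamma> = \<gamma>'"
    then have "mdist Q (\<gamma> t) (\<gamma>' t) = 0" for t using S mem by simp
    then show "sup_dist Q \<gamma> \<gamma>' = 0" by (simp add: sup_dist_def)
  qed
next
  fix a b c assume mem: "a \<in> S" "b \<in> S" "c \<in> S"
  show "sup_dist Q a c \<le> sup_dist Q a b + sup_dist Q b c"
  proof (rule sup_dist_least)
    fix t
    have "mdist Q (a t) (c t) \<le> mdist Q (a t) (b t) + mdist Q (b t) (c t)"
      using S mem by (intro mdist_triangle) auto
    then have "min 1 (mdist Q (a t) (c t)) \<le> min 1 (mdist Q (a t) (b t)) + min 1 (mdist Q (b t) (c t))"
      using mdist_nonneg[of Q "a t" "b t"] mdist_nonneg[of Q "b t" "c t"] by linarith
    moreover have "min 1 (mdist Q (x t) (y t)) \<le> sup_dist Q x y * (1 + \<bar>t\<bar>)" for x y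
      using sup_dist_upper[of Q x t y] by (simp add: divide_le_eq)
    ultimately show "min 1 (mdist Q (a t) (c t)) \<le> (sup_dist Q a b + sup_dist Q b c) * (1 + \<bar>t\<bar>)"
      unfolding distrib_right by (meson add_mono order_trans)
  qed
qed

text \<open>Outside of the interval the truncated distance is at most 1 and its weight at most
  \<open>1 / (1 + N)\<close>, so only the times in \<open>[- N, N]\<close> have to be
  controlled.\<close>

lemma sup_dist_le_if_close:
  assumes N: "N \<ge> 0" "1 / (1 + N) \<le> e" and close: "\<And>t. \<bar>t\<bar> \<le> N \<Longrightarrow> mdist Q (\<gamma> t) (\<gamma>' t) \<le> e"
  shows "sup_dist Q \<gamma> \<gamma>' \<le> e"
proof (rule sup_dist_least)
  fix t :: real
  have e: "0 < e" using N by (auto intro: less_le_trans[rotated])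
  show "min 1 (mdist Q (\<gamma> t) (\<gamma>' t)) \<le> e * (1 + \<bar>t\<bar>)"
  proof (cases "\<bar>t\<bar> \<le> N")
    case True
    then have "min 1 (mdist Q (\<gamma> t) (\<gamma>' t)) \<le> e * 1" using close[of t] by simp
    also have "\<dots> \<le> e * (1 + \<bar>t\<bar>)" using e by (intro mult_left_mono) auto
    finally show ?thesis .
  next
    case False
    have "1 \<le> e * (1 + N)" using N by (simp add: divide_le_eq)
    also have "\<dots> \<le> e * (1 + \<bar>t\<bar>)" using e False by (intro mult_left_mono) auto
    finally show ?thesis by simp
  qed
qed

text \<open>The weight \<open>1 / (1 + |t|)\<close> is bounded below on a compact set of times, so a
  small distance implies uniform closeness there; it tends to 0 at infinity, so closeness on a large
  interval implies a small distance.\<close>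

lemma mtopology_sup_dist:
  assumes S: "\<And>\<gamma> t. \<gamma> \<in> S \<Longrightarrow> \<gamma> t \<in> mspace Q"
  shows "Metric_space.mtopology S (sup_dist Q) = ucc_topology Q S"
proof -
  interpret Metric_space S "sup_dist Q" using S by (rule Metric_space_sup_dist)
  show ?thesis
  proof (rule topology_eq[THEN iffD2], intro allI iffI)
    fix U assume U: "openin mtopology U"
    show "openin (ucc_topology Q S) U"
      unfolding openin_ucc_topology
    proof (intro conjI ballI)
      show "U \<subseteq> S" using U by (simp add: openin_mtopology)
      fix \<gamma> assume \<gamma>: "\<gamma> \<in> U"
      then obtain r where r: "r > 0" "mball \<gamma> r \<subseteq> U" using U by (auto simp: openin_mtopology)
      have \<gamma>S: "\<gamma> \<in> S" using \<gamma> \<open>U \<subseteq> S\<close> by blast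
      obtain n :: nat where n: "1 / real (Suc n) < r / 2" using r(1) nat_approx_posE half_gt_zero by blast
      have "\<gamma>' \<in> U" if "\<gamma>' \<in> S" "\<forall>t\<in>{- real n..real n}. mdist Q (\<gamma> t) (\<gamma>' t) < r / 2" for \<gamma>'
      proof -
        have "sup_dist Q \<gamma> \<gamma>' \<le> r / 2"
          by (rule sup_dist_le_if_close[of "real n"]) (use n that in \<open>auto simp: abs_le_iff less_imp_le\<close>)
        then show ?thesis using r that(1) \<gamma>S by (auto simp: subset_iff)
      qed
      then show "\<exists>K \<epsilon>. compact K \<and> \<epsilon> > 0 \<and> {\<gamma>'\<in>S. \<forall>t\<in>K. mdist Q (\<gamma> t) (\<gamma>' t) < \<epsilon>} \<subseteq> U"
        using r(1) by (intro exI[of _ "{- real n..real n}"] exI[of _ "r/2"]) auto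
    qed
  next
    fix U assume U: "openin (ucc_topology Q S) U"
    show "openin mtopology U"
      unfolding openin_mtopology
    proof (intro conjI allI impI)
      show "U \<subseteq> S" using U by (simp add: openin_ucc_topology)
      fix \<gamma> assume \<gamma>: "\<gamma> \<in> U"
      then obtain K \<epsilon> where K: "compact K" "\<epsilon> > 0" "{\<gamma>'\<in>S. \<forall>t\<in>K. mdist Q (\<gamma> t) (\<gamma>' t) < \<epsilon>} \<subseteq> U"
        using U by (auto simp: openin_ucc_topology)
      obtain N where N: "N > 0" "\<And>t. t \<in> K \<Longrightarrow> \<bar>t\<bar> \<le> N"
        using compact_imp_bounded[OF K(1)] by (auto simp: bounded_pos)
      \<comment> \<open>The minimum with 1 is taken because the truncated distance does not see
        anything beyond 1.\<close>
      have "\<gamma>' \<in> U" if "\<gamma>' \<in> mball \<gamma> (min 1 \<epsilon> / (1 + N))" for \<gamma>'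
      proof -
        have "mdist Q (\<gamma> t) (\<gamma>' t) < \<epsilon>" if t: "t \<in> K" for t
        proof -
          have "min 1 (mdist Q (\<gamma> t) (\<gamma>' t)) / (1 + N) \<le> min 1 (mdist Q (\<gamma> t) (\<gamma>' t)) / (1 + \<bar>t\<bar>)"
            using N(2)[OF t] N(1) by (intro divide_left_mono mult_pos_pos) auto
          also have "\<dots> < min 1 \<epsilon> / (1 + N)"
            using sup_dist_upper[of Q \<gamma> t \<gamma>'] \<open>\<gamma>' \<in> _\<close> by auto
          finally have "min 1 (mdist Q (\<gamma> t) (\<gamma>' t)) < min 1 \<epsilon>"
            using N(1) by (simp add: divide_less_cancel)
          then show ?thesis by linarith
        qed
        then show ?thesis using K(3) that by auto
      qed
      then show "\<exists>r>0. mball \<gamma> r \<subseteq> U"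
        using K(2) N(1) by (intro exI[of _ "min 1 \<epsilon> / (1 + N)"]) auto
    qed
  qed
qed

section \<open>The line with loops and the rose\<close>

text \<open>In a circle of length 1 with parameters in \<open>[0, 1]\<close>, \<open>hgt\<close> is
  the distance to the base point and \<open>circ\<close> the arc length distance.\<close>

definition hgt :: "real \<Rightarrow> real" where "hgt s = min s (1 - s)"

definition circ :: "real \<Rightarrow> real \<Rightarrow> real" where "circ s t = min \<bar>s - t\<bar> (1 - \<bar>s - t\<bar>)"

text \<open>
  The carrier encodes the line with a loop of length 1 attached at every integer: for \<open>0 \<le> s < 1\<close>,
  the real number \<open>2 * n + s\<close> is the point \<open>n + s\<close> of the line, and \<open>2 * n + 1 + s\<close> with \<open>s \<noteq> 0\<close> is the
  point at parameter \<open>s\<close> of the loop at \<open>n\<close>.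
\<close>

definition foot :: "real \<Rightarrow> real" where
  "foot u = of_int (\<lfloor>u\<rfloor> div 2) + (if odd \<lfloor>u\<rfloor> then 0 else frac u)"

definition height :: "real \<Rightarrow> real" where
  "height u = (if odd \<lfloor>u\<rfloor> then hgt (frac u) else 0)"

text \<open>A path between points that do not lie inside a common loop passes through both feet; the
  heights are the lengths of the ways to the feet.\<close>

definition LX_dist :: "real \<Rightarrow> real \<Rightarrow> real" where
  "LX_dist u v = (if odd \<lfloor>u\<rfloor> \<and> \<lfloor>u\<rfloor> = \<lfloor>v\<rfloor> then circ (frac u) (frac v)
     else \<bar>foot u - foot v\<bar> + height u + height v)"

definition LX_set :: "real set" where "LX_set = {u. odd \<lfloor>u\<rfloor> \<longrightarrow> frac u \<noteq> 0}"

definition LX :: "real metric" where "LX = metric (LX_set, LX_dist)"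

lemma frac_bounds: "0 \<le> frac (u::real)" "frac u \<le> 1" "frac u < 1"
  using frac_ge_0[of u] frac_lt_1[of u] by auto

lemma hgt_bounds: "0 \<le> s \<Longrightarrow> s \<le> 1 \<Longrightarrow> 0 \<le> hgt s \<and> hgt s \<le> 1/2"
  by (auto simp: hgt_def min_def)

lemma circ_commute: "circ s t = circ t s" by (simp add: circ_def abs_minus_commute)

lemma circ_nonneg: "\<lbrakk>0 \<le> s; s \<le> 1; 0 \<le> t; t \<le> 1\<rbrakk> \<Longrightarrow> 0 \<le> circ s t"
  by (auto simp: circ_def min_def abs_if)

lemma circ_le: "circ s t \<le> \<bar>s - t\<bar>" by (simp add: circ_def)

lemma circ_triangle: "\<lbrakk>0 \<le> s; s \<le> 1; 0 \<le> t; t \<le> 1; 0 \<le> r; r \<le> 1\<rbrakk> \<Longrightarrow> circ s t \<le> circ s r + circ r t"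
  by (auto simp: circ_def min_def abs_if)

lemma circ_le_hgt: "\<lbrakk>0 \<le> s; s \<le> 1; 0 \<le> t; t \<le> 1\<rbrakk> \<Longrightarrow> circ s t \<le> hgt s + hgt t"
  by (auto simp: circ_def hgt_def min_def abs_if)

lemma hgt_le_circ: "\<lbrakk>0 \<le> s; s \<le> 1; 0 \<le> t; t \<le> 1\<rbrakk> \<Longrightarrow> hgt s \<le> circ s t + hgt t"
  by (auto simp: circ_def hgt_def min_def abs_if)

lemma circ_eq_0: "\<lbrakk>0 \<le> s; s < 1; 0 \<le> t; t < 1\<rbrakk> \<Longrightarrow> circ s t = 0 \<longleftrightarrow> s = t"
  by (auto simp: circ_def min_def abs_if)

lemma height_bounds: "0 \<le> height u" "height u \<le> 1/2"
  using hgt_bounds[of "frac u"] frac_bounds[of u] by (auto simp: height_def)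

lemma Metric_space_LX: "Metric_space LX_set LX_dist"
proof
  fix u v
  show "0 \<le> LX_dist u v"
    using height_bounds[of u] height_bounds[of v] circ_nonneg[of "frac u" "frac v"] frac_bounds[of u] frac_bounds[of v]
    by (auto simp: LX_dist_def)
  show "LX_dist u v = LX_dist v u"
    by (auto simp: LX_dist_def circ_commute)
next
  fix u v assume u: "u \<in> LX_set" and v: "v \<in> LX_set"
  have uv: "u = v" if "\<lfloor>u\<rfloor> = \<lfloor>v\<rfloor>" "frac u = frac v" using that by (simp add: frac_def)
  show "LX_dist u v = 0 \<longleftrightarrow> u = v"
  proof
    assume 0: "LX_dist u v = 0"
    show "u = v"
    proof (cases "odd \<lfloor>u\<rfloor> \<and> \<lfloor>u\<rfloor> = \<lfloor>v\<rfloor>")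
      case True
      then show ?thesis using 0 uv circ_eq_0[of "frac u" "frac v"] frac_bounds[of u] frac_bounds[of v]
        unfolding LX_dist_def if_P[OF True] by simp
    next
      case False
      then have *: "\<bar>foot u - foot v\<bar> = 0" "height u = 0" "height v = 0"
        using 0 height_bounds[of u] height_bounds[of v] unfolding LX_dist_def by auto
      have ev: "even \<lfloor>w\<rfloor>" if "height w = 0" "w \<in> LX_set" for w
        using that frac_bounds[of w] by (auto simp: height_def LX_set_def hgt_def min_def split: if_splits)
      have eu: "even \<lfloor>u\<rfloor>" "even \<lfloor>v\<rfloor>" using ev * u v by auto
      then have "of_int (\<lfloor>u\<rfloor> div 2) + frac u = of_int (\<lfloor>v\<rfloor> div 2) + frac v"
        using *(1) by (simp add: foot_def)
      moreover from this have "\<lfloor>u\<rfloor> div 2 = \<lfloor>v\<rfloor> div 2"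
        using frac_bounds[of u] frac_bounds[of v] by linarith
      ultimately have "\<lfloor>u\<rfloor> div 2 = \<lfloor>v\<rfloor> div 2" "frac u = frac v" by auto
      then show ?thesis using eu uv by (metis dvd_div_mult_self)
    qed
  next
    assume "u = v"
    then show "LX_dist u v = 0"
      using u circ_eq_0 frac_bounds by (auto simp: LX_dist_def height_def)
  qed
next
  fix u v w :: real
  let ?L = "\<lambda>u v. odd \<lfloor>u\<rfloor> \<and> \<lfloor>u\<rfloor> = \<lfloor>v\<rfloor>"
  have L: "LX_dist x y = circ (frac x) (frac y) \<and> height x = hgt (frac x) \<and> height y = hgt (frac y) \<and> foot x = foot y"
    if "?L x y" for x y
    using that by (auto simp: height_def foot_def LX_dist_def)
  have N: "LX_dist x y = \<bar>foot x - foot y\<bar> + height x + height y" if "\<not> ?L x y" for x y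
    using that by (auto simp: LX_dist_def)
  note b = frac_bounds(1,2)[of u] frac_bounds(1,2)[of v] frac_bounds(1,2)[of w]
  note c = circ_triangle[OF b(1,2,5,6,3,4)] circ_le_hgt[OF b(1,2,5,6)]
    hgt_le_circ[OF b(1-4)] hgt_le_circ[OF b(5,6,3,4)] circ_commute[of "frac v" "frac w"]
  note hb = height_bounds[of u] height_bounds[of v] height_bounds[of w]
  \<comment> \<open>Lying inside the same loop is symmetric and transitive, so it never holds for
    exactly two of the three pairs, and five patterns remain.\<close>
  consider "?L u w" "?L u v" "?L v w" | "?L u w" "\<not> ?L u v" "\<not> ?L v w"
    | "\<not> ?L u w" "?L u v" "\<not> ?L v w" | "\<not> ?L u w" "\<not> ?L u v" "?L v w"
    | "\<not> ?L u w" "\<not> ?L u v" "\<not> ?L v w" by metis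
  then show "LX_dist u w \<le> LX_dist u v + LX_dist v w"
  proof cases
    case 1
    then show ?thesis using L[OF 1(1)] L[OF 1(2)] L[OF 1(3)] c by linarith
  next
    case 2
    then show ?thesis using L[OF 2(1)] N[OF 2(2)] N[OF 2(3)] c hb by linarith
  next
    case 3
    then show ?thesis using N[OF 3(1)] L[OF 3(2)] N[OF 3(3)] c hb by linarith
  next
    case 4
    then show ?thesis using N[OF 4(1)] N[OF 4(2)] L[OF 4(3)] c hb by linarith
  next
    case 5
    then show ?thesis using N[OF 5(1)] N[OF 5(2)] N[OF 5(3)] hb by linarith
  qed
qed

lemma mspace_LX [simp]: "mspace LX = LX_set"
  by (simp add: LX_def Metric_space.mspace_metric Metric_space_LX)

lemma mdist_LX [simp]: "mdist LX = LX_dist"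
  by (simp add: LX_def Metric_space.mdist_metric Metric_space_LX)

section \<open>Parametrizing the line and the loops\<close>

definition on_line :: "real \<Rightarrow> real" where "on_line x = of_int (2 * \<lfloor>x\<rfloor>) + frac x"

text \<open>The parameter runs over the closed interval. Both ends must be sent to the code
  \<open>2 * n\<close> of the attaching vertex: the code \<open>2 * n + 1\<close> is excluded from
  \<open>LX_set\<close>, and \<open>2 * n + 2\<close> is the next vertex.\<close>

definition on_loop :: "int \<Rightarrow> real \<Rightarrow> real" where
  "on_loop n s = (if s = 0 \<or> s = 1 then of_int (2 * n) else of_int (2 * n + 1) + s)"

lemma floor_frac_int_add:
  assumes "0 \<le> s" "s < 1" shows "\<lfloor>of_int k + s\<rfloor> = k" "frac (of_int k + s :: real) = s"
proof -
  show "\<lfloor>of_int k + s\<rfloor> = k" using assms by (intro floor_unique) auto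
  then show "frac (of_int k + s) = s" by (simp add: frac_def)
qed

lemma on_line [simp]: "\<lfloor>on_line x\<rfloor> = 2 * \<lfloor>x\<rfloor>" "frac (on_line x) = frac x" "foot (on_line x) = x"
    "height (on_line x) = 0" "on_line x \<in> LX_set"
proof -
  show 1: "\<lfloor>on_line x\<rfloor> = 2 * \<lfloor>x\<rfloor>" "frac (on_line x) = frac x"
    unfolding on_line_def using floor_frac_int_add[of "frac x" "2 * \<lfloor>x\<rfloor>"] frac_bounds[of x] by auto
  show "foot (on_line x) = x" using 1 by (simp add: foot_def frac_def)
  show "height (on_line x) = 0" "on_line x \<in> LX_set" using 1 by (simp_all add: height_def LX_set_def)
qed

lemma dist_on_line [simp]: "LX_dist (on_line x) (on_line y) = \<bar>x - y\<bar>"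
  by (simp add: LX_dist_def)

lemma on_loop_interior:
  assumes "0 < s" "s < 1"
  shows "\<lfloor>on_loop n s\<rfloor> = 2 * n + 1" "frac (on_loop n s) = s"
  using floor_frac_int_add[of s "2 * n + 1"] assms by (auto simp: on_loop_def)

lemma on_loop_end: "s = 0 \<or> s = 1 \<Longrightarrow> on_loop n s = on_line (of_int n)"
  by (auto simp: on_loop_def on_line_def)

lemma on_loop:
  assumes "0 \<le> s" "s \<le> 1"
  shows "on_loop n s \<in> LX_set" "foot (on_loop n s) = n" "height (on_loop n s) = hgt s"
proof -
  consider "s = 0 \<or> s = 1" | "0 < s" "s < 1" using assms by linarith
  then have "on_loop n s \<in> LX_set \<and> foot (on_loop n s) = n \<and> height (on_loop n s) = hgt s"
  proof cases
    case 1 then show ?thesis by (auto simp: on_loop_end hgt_def)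
  next
    case 2 then show ?thesis by (simp add: on_loop_interior LX_set_def foot_def height_def del: frac_eq_0_iff)
  qed
  then show "on_loop n s \<in> LX_set" "foot (on_loop n s) = n" "height (on_loop n s) = hgt s" by auto
qed

lemma dist_on_loop:
  assumes "0 \<le> s" "s \<le> 1" "0 \<le> t" "t \<le> 1"
  shows "LX_dist (on_loop n s) (on_loop n t) = circ s t"
proof -
  have e: "\<not> (odd \<lfloor>on_loop n s\<rfloor> \<and> \<lfloor>on_loop n s\<rfloor> = \<lfloor>on_loop n t\<rfloor>)" if "s = 0 \<or> s = 1 \<or> t = 0 \<or> t = 1"
    using that on_loop_end[of s n] on_loop_end[of t n] on_loop_interior[of s n] by auto
  consider "s = 0 \<or> s = 1 \<or> t = 0 \<or> t = 1" | "0 < s" "s < 1" "0 < t" "t < 1" using assms by linarith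
  then show ?thesis
  proof cases
    case 1
    then have "LX_dist (on_loop n s) (on_loop n t) = hgt s + hgt t"
      unfolding LX_dist_def if_not_P[OF e[OF 1]]
      using on_loop(2,3)[of s n] on_loop(2,3)[of t n] assms by simp
    also have "\<dots> = circ s t" using 1 assms by (auto simp: hgt_def circ_def min_def)
    finally show ?thesis .
  next
    case 2
    then show ?thesis by (simp add: LX_dist_def on_loop_interior)
  qed
qed

lemma LX_cases:
  assumes "u \<in> LX_set"
  obtains x where "u = on_line x" | n s where "0 < s" "s < 1" "u = on_loop n s"
proof (cases "odd \<lfloor>u\<rfloor>")
  case True
  then obtain n where n: "\<lfloor>u\<rfloor> = 2 * n + 1" by (auto elim: oddE)
  then have "u = on_loop n (frac u)" "0 < frac u" "frac u < 1"
    using assms True frac_bounds[of u] by (auto simp: on_loop_def LX_set_def frac_def)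
  then show ?thesis using that(2) by blast
next
  case False
  then obtain n where n: "\<lfloor>u\<rfloor> = 2 * n" by (auto elim: evenE)
  have "\<lfloor>of_int n + frac u\<rfloor> = n" "frac (of_int n + frac u) = frac u"
    using floor_frac_int_add[of "frac u" n] frac_bounds[of u] by auto
  then have "u = on_line (of_int n + frac u)"
    using n by (simp add: on_line_def) (simp add: frac_def)
  then show ?thesis using that(1) by blast
qed

lemma dist_foot_le: "\<bar>foot u - foot v\<bar> \<le> LX_dist u v" "LX_dist u v \<le> \<bar>foot u - foot v\<bar> + 1"
proof -
  have *: "foot u = foot v" if "odd \<lfloor>u\<rfloor>" "\<lfloor>u\<rfloor> = \<lfloor>v\<rfloor>" using that by (simp add: foot_def)
  note f = frac_bounds[of u] frac_bounds[of v]
  have c: "0 \<le> circ (frac u) (frac v)" "circ (frac u) (frac v) \<le> 1"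
    using circ_nonneg[of "frac u" "frac v"] circ_le[of "frac u" "frac v"] f by linarith+
  show "\<bar>foot u - foot v\<bar> \<le> LX_dist u v" "LX_dist u v \<le> \<bar>foot u - foot v\<bar> + 1"
    using * c height_bounds[of u] height_bounds[of v] by (auto simp: LX_dist_def)
qed

text \<open>Parameter intervals of length at most 1/2 are geodesic. If the parameters differ by
  more, the shorter arc passes through the base point, which has the two parameters 0 and 1.\<close>

lemma joined_circle:
  assumes mem: "\<And>s. s \<in> {0..1} \<Longrightarrow> f s \<in> mspace Z"
    and d: "\<And>s t. s \<in> {0..1} \<Longrightarrow> t \<in> {0..1} \<Longrightarrow> mdist Z (f s) (f t) = circ s t"
    and st: "s \<in> {0..1}" "t \<in> {0..1}"
  shows "joined Z (f s) (f t)"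
proof -
  have iso: "isometric_on Z {a..b} f" if "0 \<le> a" "b \<le> 1" "b - a \<le> 1/2" for a b
  proof -
    have "circ s t = \<bar>s - t\<bar>" if "s \<in> {a..b}" "t \<in> {a..b}" for s t
    proof -
      have "\<bar>s - t\<bar> \<le> 1/2" using that \<open>b - a \<le> 1/2\<close> unfolding atLeastAtMost_iff by linarith
      then show ?thesis by (simp add: circ_def)
    qed
    then show ?thesis using that mem d by (auto simp: isometric_on_def)
  qed
  have *: "joined Z (f s) (f t)" if st: "s \<in> {0..1}" "t \<in> {0..1}" and le: "s \<le> t" for s t
  proof (cases "t - s \<le> 1/2")
    case True
    then show ?thesis using joined_isometric[OF iso[of s t], of s t] that by auto
  next
    case False
    have "mdist Z (f 0) (f 1) = 0" using d by (simp add: circ_def)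
    then have 01: "f 0 = f 1" using mem by simp
    have "joined Z (f s) (f 0)" using joined_isometric[OF iso[of 0 s], of s 0] st False by auto
    moreover have "joined Z (f 0) (f t)" unfolding 01
      using joined_isometric[OF iso[of t 1], of 1 t] st False by auto
    moreover have "mdist Z (f s) (f t) = mdist Z (f s) (f 0) + mdist Z (f 0) (f t)"
      using d st False le by (auto simp: circ_def min_def)
    ultimately show ?thesis by (rule joined_trans)
  qed
  show ?thesis using *[of s t] *[of t s] st joined_commute by (cases "s \<le> t") auto
qed

text \<open>For points that do not share a loop the distance is additive along the two feet, so the
  geodesics to the feet and the segment of the line concatenate.\<close>

lemma geodesic_space_LX: "geodesic_space LX"
proof -
  have foot: "joined LX u (on_line (foot u))" "LX_dist u (on_line (foot u)) = height u" if u: "u \<in> LX_set" for u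
  proof -
    have "joined LX u (on_line (foot u)) \<and> LX_dist u (on_line (foot u)) = height u"
      using u
    proof (cases rule: LX_cases)
      case (1 x) then show ?thesis using joined_refl[of "on_line x" LX] by simp
    next
      case (2 n s)
      then have "joined LX (on_loop n s) (on_loop n 0)"
        by (intro joined_circle) (auto simp: on_loop dist_on_loop)
      moreover have "LX_dist (on_loop n s) (on_loop n 0) = hgt s"
        using 2 by (auto simp: dist_on_loop circ_def hgt_def)
      ultimately show ?thesis using 2 on_loop[of s n] on_loop_end[of 0 n] by simp
    qed
    then show "joined LX u (on_line (foot u))" "LX_dist u (on_line (foot u)) = height u" by auto
  qed
  have "isometric_on LX {x..y} on_line" for x y by (auto simp: isometric_on_def)
  then have line: "joined LX (on_line x) (on_line y)" for x y
    using joined_isometric[of LX "min x y" "max x y" on_line x y] by auto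
  have "joined LX u v" if u: "u \<in> LX_set" and v: "v \<in> LX_set" for u v
  proof (cases "odd \<lfloor>u\<rfloor> \<and> \<lfloor>u\<rfloor> = \<lfloor>v\<rfloor>")
    case True
    obtain n s where us: "0 < s" "s < 1" "u = on_loop n s" using u True by (cases rule: LX_cases) auto
    obtain m t where vt: "0 < t" "t < 1" "v = on_loop m t" using v True by (cases rule: LX_cases) auto
    have "m = n" using True us vt by (simp add: on_loop_interior)
    then show ?thesis using us vt joined_circle[of "on_loop n" LX s t] by (simp add: on_loop dist_on_loop)
  next
    case False
    then have d: "LX_dist u v = \<bar>foot u - foot v\<bar> + height u + height v" by (auto simp: LX_dist_def)
    have d1: "LX_dist u (on_line (foot v)) = height u + \<bar>foot u - foot v\<bar>"
      by (auto simp: LX_dist_def)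
    have "joined LX u (on_line (foot v))"
      using joined_trans[OF foot(1)[OF u] line, of "foot v"] d1 foot(2)[OF u] by simp
    moreover have "LX_dist (on_line (foot v)) v = height v"
      using foot(2)[OF v] mdist_commute[of LX v] by simp
    ultimately show ?thesis
      using joined_trans[OF _ joined_commute[OF foot(1)[OF v]], of u] d d1 by simp
  qed
  then show ?thesis by (simp add: geodesic_space_joined)
qed

text \<open>The foot map is nonexpansive, so a ball meets only a bounded part of the line and
  finitely many loops, all of them compact.\<close>

lemma proper_space_LX: "proper_space LX"
  unfolding proper_space_def
proof (intro ballI allI)
  fix u r assume u: "u \<in> mspace LX"
  obtain N :: nat where N: "\<bar>foot u\<bar> + r < real N" using reals_Archimedean2 by blast
  define K where "K = on_line ` {- real N..real N} \<union> (\<Union>n\<in>{- int N..int N}. on_loop n ` {0..1})"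
  have 1: "compactin (mtopology_of LX) (on_line ` {- real N..real N})"
    by (intro compactin_nonexpansive_image) auto
  have 2: "compactin (mtopology_of LX) (on_loop n ` {0..1})" for n
    by (intro compactin_nonexpansive_image) (auto simp: on_loop dist_on_loop circ_le)
  have "compactin (mtopology_of LX) K"
    unfolding K_def by (intro compactin_Un 1 compactin_Union) (auto simp: 2)
  moreover have "mcball_of LX u r \<subseteq> K"
  proof
    fix v assume v: "v \<in> mcball_of LX u r"
    then have "LX_dist u v \<le> r" by simp
    then have vf: "\<bar>foot v\<bar> \<le> real N" using N dist_foot_le(1)[of u v] by linarith
    from v have "v \<in> LX_set" by simp
    then show "v \<in> K"
    proof (cases rule: LX_cases)
      case (1 x) then show ?thesis using vf by (simp add: K_def image_iff) (metis abs_le_iff atLeastAtMost_iff minus_le_iff)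
    next
      case (2 n s)
      then have "\<bar>real_of_int n\<bar> \<le> real N" using vf on_loop(2)[of s n] by simp
      then have "real_of_int n \<le> real_of_int (int N)" "real_of_int (- int N) \<le> real_of_int n"
        by (auto simp: abs_le_iff)
      then have "n \<in> {- int N..int N}" by (simp only: of_int_le_iff) simp
      moreover have "v \<in> on_loop n ` {0..1}" using 2 by auto
      ultimately show ?thesis unfolding K_def by blast
    qed
  qed
  moreover have "closedin (mtopology_of LX) (mcball_of LX u r)"
    by (simp add: mtopology_of_def mcball_of_def Metric_space.closedin_mcball[OF Metric_space_LX])
  ultimately show "compactin (mtopology_of LX) (mcball_of LX u r)"
    by (meson closed_compactin)
qed

text \<open>A line through a point of positive height would come and leave through its foot and pay
  the height twice, whereas the points before and after are joined without this detour. The curve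
  thus stays on the real line and is an isometry of the reals, determined by its values at 0 and
  1.\<close>

lemma Geod_LX_cases:
  assumes \<gamma>: "\<gamma> \<in> Geod LX"
  obtains c \<sigma> where "\<sigma> \<in> {1, -1}" "\<gamma> = (\<lambda>t. on_line (c + \<sigma> * t))"
proof -
  have mem: "\<gamma> t \<in> LX_set" and d: "LX_dist (\<gamma> s) (\<gamma> t) = \<bar>s - t\<bar>" for s t
    using \<gamma> by (auto simp: Geod_def isometric_on_def)
  have h0: "height (\<gamma> t) = 0" for t
  proof -
    have big: "LX_dist (\<gamma> t) (\<gamma> s) = \<bar>foot (\<gamma> t) - foot (\<gamma> s)\<bar> + height (\<gamma> t) + height (\<gamma> s)"
      if "\<bar>t - s\<bar> > 1" for s
    proof -
      have "circ (frac (\<gamma> t)) (frac (\<gamma> s)) \<le> 1"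
        using circ_le[of "frac (\<gamma> t)" "frac (\<gamma> s)"] frac_bounds[of "\<gamma> t"] frac_bounds[of "\<gamma> s"] by linarith
      then have "\<not> (odd \<lfloor>\<gamma> t\<rfloor> \<and> \<lfloor>\<gamma> t\<rfloor> = \<lfloor>\<gamma> s\<rfloor>)"
        using d[of t s] that by (auto simp: LX_dist_def)
      then show ?thesis by (auto simp: LX_dist_def)
    qed
    \<comment> \<open>Points of one loop are at distance at most 1, so a time difference of 2
      ensures that \<open>\<gamma> t\<close> shares no loop with \<open>\<gamma> (t + T)\<close> or
      \<open>\<gamma> (t - T)\<close>.\<close>
    define T where "T = (2::real)"
    have "LX_dist (\<gamma> (t + T)) (\<gamma> (t - T)) \<le>
        \<bar>foot (\<gamma> (t + T)) - foot (\<gamma> (t - T))\<bar> + height (\<gamma> (t + T)) + height (\<gamma> (t - T))"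
    proof (cases "odd \<lfloor>\<gamma> (t + T)\<rfloor> \<and> \<lfloor>\<gamma> (t + T)\<rfloor> = \<lfloor>\<gamma> (t - T)\<rfloor>")
      case True
      then show ?thesis
        using circ_le_hgt[of "frac (\<gamma> (t + T))" "frac (\<gamma> (t - T))"] frac_bounds[of "\<gamma> (t + T)"] frac_bounds[of "\<gamma> (t - T)"]
        by (auto simp: LX_dist_def height_def)
    qed (auto simp: LX_dist_def)
    then show ?thesis
      using big[of "t + T"] big[of "t - T"] d[of t "t + T"] d[of t "t - T"] d[of "t + T" "t - T"]
        height_bounds(1)[of "\<gamma> t"] by (simp add: T_def)
  qed
  have line: "\<gamma> t = on_line (foot (\<gamma> t))" for t
    using mem[of t]
  proof (cases rule: LX_cases)
    case (2 n s)
    then show ?thesis using h0[of t] on_loop(3)[of s n] by (auto simp: hgt_def min_def split: if_splits)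
  qed auto
  define f where "f t = foot (\<gamma> t)" for t
  have f: "\<bar>f s - f t\<bar> = \<bar>s - t\<bar>" for s t
    using d[of s t] line[of s] line[of t] dist_on_line[of "f s" "f t"] by (simp add: f_def)
  define c \<sigma> where "c = f 0" and "\<sigma> = f 1 - f 0"
  have \<sigma>: "\<sigma> \<in> {1, -1}" using f[of 1 0] by (auto simp: \<sigma>_def abs_if split: if_splits)
  have "f t = c + \<sigma> * t" for t
  proof (cases "\<sigma> = 1")
    case True
    then have "f 1 = f 0 + 1" by (simp add: \<sigma>_def)
    then show ?thesis using f[of t 0] f[of t 1] True by (auto simp: c_def abs_if split: if_splits)
  next
    case False
    then have "f 1 = f 0 - 1" "\<sigma> = -1" using \<sigma> by (auto simp: \<sigma>_def)
    then show ?thesis using f[of t 0] f[of t 1] by (auto simp: c_def abs_if split: if_splits)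
  qed
  then have "\<gamma> = (\<lambda>t. on_line (c + \<sigma> * t))" using line by (auto simp: f_def)
  with \<sigma> show ?thesis by (rule that)
qed

lemma on_line_in_Geod: "\<sigma> \<in> {1, -1} \<Longrightarrow> (\<lambda>t. on_line (c + \<sigma> * t)) \<in> Geod LX"
  by (auto simp: Geod_def isometric_on_def)

text \<open>Along two lines the distance is the absolute value of an affine function of time. The
  two halves of a loop, distinct geodesics with common end points, do not extend to lines.\<close>

lemma line_convex_LX: "line_convex LX"
  unfolding line_convex_def
proof (intro ballI)
  fix \<gamma> \<gamma>' assume "\<gamma> \<in> Geod LX" "\<gamma>' \<in> Geod LX"
  then obtain c \<sigma> c' \<sigma>' where "\<gamma> = (\<lambda>t. on_line (c + \<sigma> * t))" "\<gamma>' = (\<lambda>t. on_line (c' + \<sigma>' * t))"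
    by (metis Geod_LX_cases)
  then have eq: "mdist LX (\<gamma> t) (\<gamma>' t) = norm ((c - c') + t *\<^sub>R (\<sigma> - \<sigma>'))" for t
    by (simp add: algebra_simps)
  show "convex_on UNIV (\<lambda>t. mdist LX (\<gamma> t) (\<gamma>' t))"
    unfolding eq
  proof (rule convex_onI)
    fix r s t :: real assume r: "0 < r" "r < 1"
    have "norm (c - c' + ((1 - r) *\<^sub>R s + r *\<^sub>R t) *\<^sub>R (\<sigma> - \<sigma>')) =
        norm ((1 - r) *\<^sub>R (c - c' + s *\<^sub>R (\<sigma> - \<sigma>')) + r *\<^sub>R (c - c' + t *\<^sub>R (\<sigma> - \<sigma>')))"
      by (simp add: algebra_simps)
    also have "\<dots> \<le> (1 - r) * norm (c - c' + s *\<^sub>R (\<sigma> - \<sigma>')) + r * norm (c - c' + t *\<^sub>R (\<sigma> - \<sigma>'))"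
      by (rule norm_triangle_le) (use r in \<open>simp add: abs_mult\<close>)
    finally show "norm (c - c' + ((1 - r) *\<^sub>R s + r *\<^sub>R t) *\<^sub>R (\<sigma> - \<sigma>')) \<le>
      (1 - r) * norm (c - c' + s *\<^sub>R (\<sigma> - \<sigma>')) + r * norm (c - c' + t *\<^sub>R (\<sigma> - \<sigma>'))" .
  qed simp
qed

text \<open>The foot map changes distances by at most 1, hence Gromov products by at most 1, and the
  real line satisfies the inequality without error. The constant 3 leaves room.\<close>

lemma gromov_hyperbolic_LX: "gromov_hyperbolic LX"
  unfolding gromov_hyperbolic_def
proof (intro exI[of _ 3] conjI ballI)
  fix x y z w
  note b = dist_foot_le[of x z] dist_foot_le[of x y] dist_foot_le[of y z]
    dist_foot_le[of w x] dist_foot_le[of w y] dist_foot_le[of w z]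
  have "min (\<bar>foot w - foot x\<bar> + \<bar>foot w - foot y\<bar> - \<bar>foot x - foot y\<bar>) (\<bar>foot w - foot y\<bar> + \<bar>foot w - foot z\<bar> - \<bar>foot y - foot z\<bar>)
      \<le> \<bar>foot w - foot x\<bar> + \<bar>foot w - foot z\<bar> - \<bar>foot x - foot z\<bar>"
    by (auto simp: min_def abs_if)
  then show "min (gromov_product LX x y w) (gromov_product LX y z w) - 3 \<le> gromov_product LX x z w"
    using b by (simp add: gromov_product_def min_le_iff_disj) argo
qed simp

section \<open>The integer translations as a group of isometries\<close>

definition shift :: "int \<Rightarrow> real \<Rightarrow> real" where
  "shift k = (\<lambda>u\<in>LX_set. u + 2 * of_int k)"

definition shifts :: "(real \<Rightarrow> real) set" where "shifts = range shift"

lemma frac_floor_add_int: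
  "\<lfloor>u + 2 * real_of_int k\<rfloor> = \<lfloor>u\<rfloor> + 2 * k" "frac (u + 2 * real_of_int k) = frac u"
proof -
  show "\<lfloor>u + 2 * real_of_int k\<rfloor> = \<lfloor>u\<rfloor> + 2 * k"
    using floor_add_int[of u "2 * k"] by simp
  then show "frac (u + 2 * real_of_int k) = frac u" by (simp add: frac_def)
qed

lemma shift_facts:
  assumes "u \<in> LX_set"
  shows "shift k u \<in> LX_set" "\<lfloor>shift k u\<rfloor> = \<lfloor>u\<rfloor> + 2 * k" "frac (shift k u) = frac u"
    "foot (shift k u) = foot u + k" "height (shift k u) = height u"
  using assms frac_floor_add_int[of u k]
  by (auto simp: shift_def LX_set_def foot_def height_def)

lemma shift_0: "shift 0 = (\<lambda>u\<in>LX_set. u)" by (simp add: shift_def)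

lemma shift_add: "u \<in> LX_set \<Longrightarrow> shift k (shift m u) = shift (k + m) u"
  using shift_facts(1)[of u m] by (simp add: shift_def)

lemma dist_shift: "u \<in> LX_set \<Longrightarrow> v \<in> LX_set \<Longrightarrow> LX_dist (shift k u) (shift k v) = LX_dist u v"
  by (cases "odd \<lfloor>u\<rfloor> \<and> \<lfloor>u\<rfloor> = \<lfloor>v\<rfloor>") (auto simp: LX_dist_def shift_facts)

lemma shift_on_line: "shift k (on_line x) = on_line (x + k)"
proof -
  have "shift k (on_line x) = on_line x + 2 * of_int k" by (simp add: shift_def)
  also have "\<dots> = on_line (x + k)" by (simp add: on_line_def frac_def)
  finally show ?thesis .
qed

lemma shift_in_Isom: "shift k \<in> carrier (Isom LX)"
proof -
  have "bij_betw (shift k) LX_set LX_set"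
    by (rule bij_betw_byWitness[where f' = "shift (- k)"])
      (auto simp: shift_facts shift_add shift_0)
  then show ?thesis
    by (auto simp: Isom_def Bij_def dist_shift) (simp add: shift_def)
qed

lemma mult_Isom: "f \<in> carrier (Isom X) \<Longrightarrow> g \<in> carrier (Isom X) \<Longrightarrow> f \<otimes>\<^bsub>Isom X\<^esub> g = compose (mspace X) f g"
  by (simp add: Isom_def BijGroup_def)

lemma one_Isom: "\<one>\<^bsub>Isom X\<^esub> = (\<lambda>x\<in>mspace X. x)"
  by (simp add: Isom_def BijGroup_def)

lemma shift_mult: "shift k \<otimes>\<^bsub>Isom LX\<^esub> shift m = shift (k + m)"
  by (auto simp: mult_Isom shift_in_Isom compose_def shift_add fun_eq_iff) (simp add: shift_def)

lemma shift_inv: "inv\<^bsub>Isom LX\<^esub> (shift k) = shift (- k)"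
  by (rule group.inv_equality[OF group_Isom])
    (simp_all add: shift_mult shift_in_Isom one_Isom shift_0)

lemma subgroup_shifts: "subgroup shifts (Isom LX)"
proof (rule group.subgroupI[OF group_Isom])
  show "shifts \<subseteq> carrier (Isom LX)" using shift_in_Isom by (auto simp: shifts_def)
qed (auto simp: shifts_def shift_inv shift_mult)

lemma zero_in_LX: "0 \<in> LX_set" by (simp add: LX_set_def)

lemma shift_eq_one: "shift k = \<one>\<^bsub>Isom LX\<^esub> \<longleftrightarrow> k = 0"
proof
  assume "shift k = \<one>\<^bsub>Isom LX\<^esub>"
  then have "shift k 0 = (\<lambda>x\<in>LX_set. x) 0" by (simp add: one_Isom)
  then show "k = 0" using zero_in_LX by (simp add: shift_def)
qed (simp add: one_Isom shift_0)

lemma shift_pow: "shift k [^]\<^bsub>Isom LX\<^esub> (n::nat) = shift (int n * k)"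
proof (induction n)
  case 0
  then show ?case using shift_eq_one[of 0] by simp
next
  case (Suc n)
  then show ?case by (simp add: shift_mult algebra_simps)
qed

lemma torsion_free_shifts: "torsion_free LX shifts"
  by (auto simp: torsion_free_def shifts_def shift_pow shift_eq_one)

text \<open>This displacement yields both the discreteness of the action and the linear growth of
  its orbits.\<close>

lemma dist_shift_self: "u \<in> LX_set \<Longrightarrow> \<bar>real_of_int k\<bar> \<le> LX_dist u (shift k u)"
  using dist_foot_le(1)[of u "shift k u"] by (simp add: shift_facts)

lemma bounded_ints: "{k::int. \<bar>real_of_int k\<bar> \<le> R} \<subseteq> {- \<lceil>R\<rceil>..\<lceil>R\<rceil>}"
  by (auto simp: abs_le_iff) (linarith+)

lemma discrete_shifts: "discrete_action LX shifts"
  unfolding discrete_action_def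
proof (intro ballI allI impI)
  fix u R assume u: "u \<in> mspace LX" "0 \<le> (R::real)"
  have "{g \<in> shifts. mdist LX u (g u) \<le> R} \<subseteq> shift ` {- \<lceil>R\<rceil>..\<lceil>R\<rceil>}"
  proof
    fix g assume "g \<in> {g \<in> shifts. mdist LX u (g u) \<le> R}"
    then obtain k where k: "g = shift k" "LX_dist u (shift k u) \<le> R" by (auto simp: shifts_def)
    then have "\<bar>real_of_int k\<bar> \<le> R" using dist_shift_self[of u k] u by simp
    then show "g \<in> shift ` {- \<lceil>R\<rceil>..\<lceil>R\<rceil>}" using bounded_ints k by blast
  qed
  then show "finite {g \<in> shifts. mdist LX u (g u) \<le> R}" by (rule finite_subset) simp
qed

lemma orbit_shifts: "orbit_of shifts u = range (\<lambda>k. shift k u)"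
  by (auto simp: orbit_of_def shifts_def)

lemma orbit_shift: "u \<in> LX_set \<Longrightarrow> orbit_of shifts (shift k u) = orbit_of shifts u"
proof -
  assume u: "u \<in> LX_set"
  have "range (\<lambda>m. shift (m + k) u) = range (\<lambda>m. shift m u)"
  proof -
    have "shift m u \<in> range (\<lambda>m. shift (m + k) u)" for m
      using rangeI[of "\<lambda>m. shift (m + k) u" "m - k"] by simp
    then show ?thesis by auto
  qed
  then show ?thesis using u unfolding orbit_shifts by (simp add: shift_add)
qed

text \<open>The codes in \<open>[0, 2)\<close> are those of one half-open unit segment of the line
  and of the loop at 0.\<close>

lemma shift_into_fundamental_domain:
  assumes "u \<in> LX_set"
  obtains v k where "v \<in> LX_set" "0 \<le> v" "v < 2" "u = shift k v"
proof -
  define k where "k = \<lfloor>u\<rfloor> div 2"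
  have v: "shift (- k) u \<in> LX_set" using assms by (rule shift_facts)
  have eq: "shift (-k) u = u - 2 * of_int k" using assms by (simp add: shift_def)
  have "2 * k \<le> \<lfloor>u\<rfloor>" "\<lfloor>u\<rfloor> < 2 * k + 2" by (auto simp: k_def)
  then have "of_int (2 * k) \<le> u" "u < of_int (2 * k + 2)" by (auto simp: le_floor_iff floor_less_iff)
  then have "0 \<le> shift (-k) u" "shift (-k) u < 2" unfolding eq by auto
  moreover have "u = shift k (shift (- k) u)" using assms by (simp add: shift_add shift_0)
  ultimately show ?thesis using v that by blast
qed

lemma dist_fundamental_domain:
  assumes "v \<in> LX_set" "0 \<le> v" "v < 2"
  shows "LX_dist 0 v \<le> 2"
proof -
  have "\<lfloor>v\<rfloor> = 0 \<or> \<lfloor>v\<rfloor> = 1" using assms by linarith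
  then have "\<bar>foot 0 - foot v\<bar> \<le> 1" using frac_bounds[of v] by (auto simp: foot_def)
  then show ?thesis using dist_foot_le(2)[of 0 v] by simp
qed

text \<open>A translation moves the centre into the fundamental domain and the ball into the one of
  radius \<open>R + 2\<close> about 0, where 2 bounds the distance of the domain from 0. A finite
  cover of that compact ball is translated back and so serves all centres.\<close>

lemma bounded_geometry_LX: "bounded_geometry LX"
  unfolding bounded_geometry_def
proof (intro allI impI)
  fix r R :: real assume rR: "0 < r \<and> r \<le> R"
  interpret L: Metric_space LX_set LX_dist by (rule Metric_space_LX)
  have "compactin L.mtopology (mcball_of LX 0 (R + 2))"
    using proper_space_LX zero_in_LX by (simp add: proper_space_def mtopology_of_def)
  then have "L.mtotally_bounded (mcball_of LX 0 (R + 2))" by (rule L.compactin_imp_mtotally_bounded)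
  then have "\<exists>K. finite K \<and> K \<subseteq> mcball_of LX 0 (R + 2) \<and> mcball_of LX 0 (R + 2) \<subseteq> (\<Union>x\<in>K. L.mball x r)"
    using rR unfolding L.mtotally_bounded_def by simp
  then obtain F where F: "finite F" "F \<subseteq> mcball_of LX 0 (R + 2)"
      "mcball_of LX 0 (R + 2) \<subseteq> (\<Union>x\<in>F. L.mball x r)"
    by (elim exE conjE) (rule that)
  have "covering_number (mspace LX) (mdist LX) (mcball_of LX u R) r \<le> enat (card F)" if u: "u \<in> LX_set" for u
  proof -
    obtain v k where v: "v \<in> LX_set" "0 \<le> v" "v < 2" "u = shift k v"
      using u by (rule shift_into_fundamental_domain)
    have "covering_number (mspace LX) (mdist LX) (mcball_of LX u R) r \<le> enat (card (shift k ` F))"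
    proof (rule covering_number_le)
      show "shift k ` F \<subseteq> mspace LX" using F(2) shift_facts(1) by fastforce
      show "mcball_of LX u R \<subseteq> (\<Union>x\<in>shift k ` F. {y \<in> mspace LX. mdist LX x y < r})"
      proof
        fix y assume y: "y \<in> mcball_of LX u R"
        then have yL: "y \<in> LX_set" "LX_dist u y \<le> R" by auto
        define z where "z = shift (- k) y"
        have z: "z \<in> LX_set" "y = shift k z" using yL by (auto simp: z_def shift_facts shift_add shift_0)
        have "LX_dist v z \<le> R" using yL(2) z v by (simp add: dist_shift)
        then have "LX_dist 0 z \<le> R + 2"
          using L.triangle[OF zero_in_LX v(1) z(1)] dist_fundamental_domain[OF v(1-3)] by simp
        then have "z \<in> mcball_of LX 0 (R + 2)" using z zero_in_LX by simp
        then obtain x where "x \<in> F" "z \<in> L.mball x r" using F(3) by blast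
        then have x: "x \<in> F" "LX_dist x z < r" "x \<in> LX_set" by auto
        then show "y \<in> (\<Union>x\<in>shift k ` F. {y \<in> mspace LX. mdist LX x y < r})"
          using dist_shift[OF x(3) z(1), of k] z(2) yL(1) by (intro UN_I[of "shift k x"]) simp_all
      qed
    qed (simp add: F(1))
    also have "\<dots> \<le> enat (card F)" using F(1) by (simp add: card_image_le)
    finally show ?thesis .
  qed
  then have "(SUP x\<in>mspace LX. covering_number (mspace LX) (mdist LX) (mcball_of LX x R) r) \<le> enat (card F)"
    by (intro SUP_least) simp
  then show "(SUP x\<in>mspace LX. covering_number (mspace LX) (mdist LX) (mcball_of LX x R) r) < \<infinity>"
    by (rule le_less_trans) simp
qed

lemma h_crit_LX:
  assumes "u \<in> LX_set"
  shows "h_crit LX shifts u = 0"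
proof -
  define S where "S T = orbit_of shifts u \<inter> mball_of LX u T" for T
  have S: "finite (S T)" "card (S T) \<le> nat (2 * \<lceil>T\<rceil> + 1)" if "T > 0" for T
  proof -
    have sub: "S T \<subseteq> (\<lambda>k. shift k u) ` {- \<lceil>T\<rceil>..\<lceil>T\<rceil>}"
    proof
      fix v assume "v \<in> S T"
      then obtain k where k: "v = shift k u" "LX_dist u (shift k u) < T" by (auto simp: S_def orbit_shifts)
      then have "\<bar>real_of_int k\<bar> \<le> T" using dist_shift_self[OF assms, of k] by simp
      then show "v \<in> (\<lambda>k. shift k u) ` {- \<lceil>T\<rceil>..\<lceil>T\<rceil>}" using bounded_ints k by blast
    qed
    show "finite (S T)" using sub by (rule finite_subset) simp
    have "card (S T) \<le> card {- \<lceil>T\<rceil>..\<lceil>T\<rceil>}" using surj_card_le[OF _ sub] by simp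
    then show "card (S T) \<le> nat (2 * \<lceil>T\<rceil> + 1)" by (simp add: algebra_simps)
  qed
  \<comment> \<open>The base point keeps the count positive, so \<open>elog\<close> does not take
    the value \<open>- \<infinity>\<close>.\<close>
  have mem: "u \<in> S T" if "T > 0" for T
  proof -
    have "u = shift 0 u" using assms by (simp add: shift_0)
    then have "u \<in> orbit_of shifts u" unfolding orbit_shifts by blast
    moreover have "LX_dist u u = 0" using assms mdist_zero[of u LX u] by simp
    ultimately show ?thesis using assms that by (simp add: S_def)
  qed
  have bnd: "0 \<le> elog (ecard (S T)) / ereal T \<and> elog (ecard (S T)) / ereal T \<le> ereal (ln (2 * T + 3) / T)"
    if T: "T > 0" for T
  proof -
    have c: "1 \<le> card (S T)" using S(1)[OF T] mem[OF T] by (simp add: Suc_le_eq card_gt_0_iff) blast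
    have eq: "elog (ecard (S T)) = ereal (ln (real (card (S T))))"
      using S(1)[OF T] c by (simp add: ecard_def elog_enat)
    have "real (card (S T)) \<le> real (nat (2 * \<lceil>T\<rceil> + 1))" using S(2)[OF T] by linarith
    also have "\<dots> \<le> 2 * T + 3" using T by linarith
    finally have "ln (real (card (S T))) \<le> ln (2 * T + 3)" using c by (intro ln_mono) auto
    moreover have "0 \<le> ln (real (card (S T)))" using c by simp
    ultimately show ?thesis unfolding eq using T by (simp add: divide_right_mono)
  qed
  have "Limsup at_top (\<lambda>T. elog (ecard (S T)) / ereal T) \<le> Limsup at_top (\<lambda>T. ereal (ln (2 * T + 3) / T))"
    by (rule Limsup_mono) (rule eventually_mono[OF eventually_gt_at_top[of 0]], use bnd in blast)
  also have "\<dots> = ereal 0"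
  proof (rule lim_imp_Limsup)
    have "((\<lambda>T::real. ln (2 * T + 3) / T) \<longlongrightarrow> 0) at_top" by real_asymp
    then show "((\<lambda>T. ereal (ln (2 * T + 3) / T)) \<longlongrightarrow> ereal 0) at_top" by simp
  qed simp
  finally have "Limsup at_top (\<lambda>T. elog (ecard (S T)) / ereal T) \<le> 0" by (simp only: zero_ereal_def)
  moreover have "0 \<le> Limsup at_top (\<lambda>T. elog (ecard (S T)) / ereal T)"
  proof -
    have "Limsup at_top (\<lambda>T::real. 0::ereal) \<le> Limsup at_top (\<lambda>T. elog (ecard (S T)) / ereal T)"
      by (rule Limsup_mono) (rule eventually_mono[OF eventually_gt_at_top[of 0]], use bnd in blast)
    then show ?thesis by (simp add: Limsup_const)
  qed
  ultimately show ?thesis unfolding h_crit_def S_def by (rule antisym)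
qed

text \<open>Collapsing everything but one loop maps that loop homeomorphically to the circle.\<close>

lemma not_simply_connected_LX: "\<not> simply_connected_space (mtopology_of LX)"
proof
  assume sc: "simply_connected_space (mtopology_of LX)"
  define r where "r u = (if \<lfloor>u\<rfloor> = 1 then cis (2 * pi * frac u) else 1)" for u :: real
  have cis_dist: "cmod (cis a - cis b) \<le> \<bar>a - b\<bar>" for a b
  proof -
    have "exp (\<i> * of_real (a - b)) = cis (a - b)" by (simp only: cis_conv_exp)
    then have "cis a - cis b = cis b * (exp (\<i> * of_real (a - b)) - 1)"
      by (simp only: right_diff_distrib cis_mult) simp
    then have "cmod (cis a - cis b) = 2 * \<bar>sin ((a - b) / 2)\<bar>"
      by (simp add: norm_mult dist_exp_i_1 del: of_real_diff)
    also have "\<dots> \<le> 2 * \<bar>(a - b) / 2\<bar>" using abs_sin_x_le_abs_x[of "(a - b) / 2"] by simp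
    finally show ?thesis by simp
  qed
  \<comment> \<open>\<open>cis (2 * pi * s)\<close> does not change if \<open>s\<close> is shifted
    by an integer, and \<open>circ s t\<close> is attained by one of the shifts 0, 1 and -1.\<close>
  have cis_circ: "cmod (cis (2 * pi * s) - cis (2 * pi * t)) \<le> 2 * pi * circ s t" if "\<bar>s - t\<bar> \<le> 1" for s t
  proof -
    have 1: "cmod (cis (2 * pi * s) - cis (2 * pi * t)) \<le> 2 * pi * \<bar>s - t + of_int k\<bar>" for k
    proof -
      have "cis (2 * pi * s) = cis (2 * pi * (s + of_int k))"
        using cis_mult[of "2 * pi * s" "2 * pi * of_int k"] by (simp add: distrib_left cis_multiple_2pi)
      then have "cmod (cis (2 * pi * s) - cis (2 * pi * t)) \<le> \<bar>2 * pi * (s + of_int k) - 2 * pi * t\<bar>"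
        using cis_dist by metis
      also have "\<dots> = 2 * pi * \<bar>s - t + of_int k\<bar>"
      proof -
        have "2 * pi * (s + of_int k) - 2 * pi * t = 2 * pi * (s - t + of_int k)"
          by (simp add: algebra_simps)
        then show ?thesis by (simp add: abs_mult)
      qed
      finally show ?thesis .
    qed
    have "circ s t = \<bar>s - t + of_int 0\<bar> \<or> circ s t = \<bar>s - t + of_int 1\<bar> \<or> circ s t = \<bar>s - t + of_int (- 1)\<bar>"
      using that by (auto simp: circ_def min_def abs_if)
    then show ?thesis using 1 by metis
  qed
  have hgt: "cmod (cis (2 * pi * s) - 1) \<le> 2 * pi * hgt s" if "0 \<le> s" "s \<le> 1" for s
    using cis_circ[of s 0] that by (simp add: circ_def hgt_def)
  have r_lip: "cmod (r u - r v) \<le> 2 * pi * LX_dist u v" for u v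
  proof -
    have nn: "0 \<le> LX_dist u v" by (metis mdist_LX mdist_nonneg)
    have h: "\<lfloor>w\<rfloor> = 1 \<Longrightarrow> height w = hgt (frac w)" for w by (simp add: height_def)
    consider "\<lfloor>u\<rfloor> = 1" "\<lfloor>v\<rfloor> = 1" | "\<lfloor>u\<rfloor> = 1" "\<lfloor>v\<rfloor> \<noteq> 1" | "\<lfloor>u\<rfloor> \<noteq> 1" "\<lfloor>v\<rfloor> = 1" | "\<lfloor>u\<rfloor> \<noteq> 1" "\<lfloor>v\<rfloor> \<noteq> 1" by blast
    then show ?thesis
    proof cases
      case 1
      have "\<bar>frac u - frac v\<bar> \<le> 1" using frac_bounds[of u] frac_bounds[of v] by linarith
      then show ?thesis using 1 cis_circ by (simp add: r_def LX_dist_def)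
    next
      case 2
      have "hgt (frac u) \<le> LX_dist u v" using 2 height_bounds[of v] by (auto simp: LX_dist_def h)
      then have "2 * pi * hgt (frac u) \<le> 2 * pi * LX_dist u v" by (intro mult_left_mono) auto
      then have "cmod (cis (2 * pi * frac u) - 1) \<le> 2 * pi * LX_dist u v"
        using hgt[of "frac u"] frac_bounds[of u] by linarith
      then show ?thesis
        using 2
        by (simp add: r_def)
    next
      case 3
      have "hgt (frac v) \<le> LX_dist u v" using 3 height_bounds[of u] by (auto simp: LX_dist_def h)
      then have "2 * pi * hgt (frac v) \<le> 2 * pi * LX_dist u v" by (intro mult_left_mono) auto
      then have "cmod (cis (2 * pi * frac v) - 1) \<le> 2 * pi * LX_dist u v"
        using hgt[of "frac v"] frac_bounds[of v] by linarith
      then show ?thesis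
        using 3
        by (simp add: r_def norm_minus_commute)
    next
      case 4
      then show ?thesis using nn by (simp add: r_def)
    qed
  qed
  have "continuous_map (mtopology_of LX) (mtopology_of euclidean_metric) r"
    by (intro Lipschitz_continuous_imp_continuous_map)
      (auto simp: Lipschitz_continuous_map_def dist_norm intro!: exI[of _ "2 * pi"] r_lip)
  then have cr: "continuous_map (mtopology_of LX) (top_of_set (- {0})) r"
    by (auto simp: continuous_map_in_subtopology r_def)
  define c where "c = on_loop 0"
  have c: "pathin (mtopology_of LX) c"
    unfolding pathin_def c_def
    by (rule continuous_map_nonexpansive[where C = 1]) (auto simp: on_loop dist_on_loop circ_le)
  have c01: "c 0 = 0" "c 1 = 0" by (auto simp: c_def on_loop_def)
  have "homotopic_with (\<lambda>h. h 0 = c 0 \<and> h 1 = c 0) (top_of_set {0..1}) (mtopology_of LX) c (\<lambda>_. c 0)"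
    using sc[unfolded simply_connected_space_def, THEN conjunct2, rule_format, of c] c c01 by simp
  then have hom: "homotopic_with (\<lambda>h. h 0 = 0 \<and> h 1 = 0) (top_of_set {0..1}) (mtopology_of LX) c (\<lambda>_. 0)"
    by (simp only: c01)
  have rc: "r (c t) = circlepath 0 1 t" if "t \<in> {0..1}" for t
  proof (cases "t = 0 \<or> t = 1")
    case True
    then show ?thesis by (auto simp: r_def c_def on_loop_def circlepath exp_eq_1)
  next
    case False
    then show ?thesis using that on_loop_interior[of t 0]
      by (simp add: r_def c_def circlepath cis_conv_exp mult_ac)
  qed
  have "homotopic_with (\<lambda>h. h 0 = 1 \<and> h 1 = 1) (top_of_set {0..1}) (top_of_set (- {0})) (r \<circ> c) (r \<circ> (\<lambda>_. 0))"
    by (rule homotopic_with_compose_continuous_map_left[OF hom cr]) (simp add: r_def)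
  then have "homotopic_with (\<lambda>h. h 0 = 1 \<and> h 1 = 1) (top_of_set {0..1}) (top_of_set (- {0})) (circlepath 0 1) (linepath 1 1)"
  proof (rule homotopic_with_eq)
    have "r 0 = 1" by (simp add: r_def)
    then show "linepath 1 1 x = (r \<circ> (\<lambda>_. 0)) x" for x by (simp add: linepath_refl)
    show "circlepath 0 1 x = (r \<circ> c) x" if "x \<in> topspace (top_of_set {0..1})" for x
      using rc[of x] that by simp
  qed auto
  \<comment> \<open>A contraction of the loop in the space would contract the unit circle in the
    punctured plane, against its winding number 1.\<close>
  then have "homotopic_paths (- {0}) (circlepath 0 1) (linepath 1 1)"
    by (simp add: homotopic_paths_def pathstart_def pathfinish_def circlepath exp_eq_1)
  then have "winding_number (circlepath 0 1) 0 = winding_number (linepath 1 1) 0"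
    by (rule winding_number_homotopic_paths)
  then show False by (simp add: winding_number_circlepath_centre)
qed

section \<open>The quotient metric: two circles of length 1 with a common point\<close>

definition rose_dist :: "real \<Rightarrow> real \<Rightarrow> real" where
  "rose_dist u v = (if odd \<lfloor>u\<rfloor> = odd \<lfloor>v\<rfloor> then circ (frac u) (frac v) else hgt (frac u) + hgt (frac v))"

definition rose :: "real set metric" where "rose = quotient_metric LX shifts"

lemma circ_0: "0 \<le> s \<Longrightarrow> s \<le> 1 \<Longrightarrow> circ 0 s = hgt s \<and> circ s 0 = hgt s"
  by (auto simp: circ_def hgt_def)

text \<open>\<open>circ s t\<close> is the distance of \<open>s - t\<close> from the integers. This
  bound and \<open>circ_attained\<close> allow the infimum over translates to be computed as an arc
  length.\<close>

lemma circ_le_int: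
  assumes "0 \<le> s" "s \<le> 1" "0 \<le> t" "t \<le> 1"
  shows "circ s t \<le> \<bar>of_int k + s - t\<bar>"
proof -
  consider "k = 0" | "1 \<le> k" | "k \<le> -1" by linarith
  then show ?thesis
  proof cases
    case 2
    then have "1 \<le> real_of_int k" by simp
    then show ?thesis using assms by (auto simp: circ_def min_def abs_if)
  next
    case 3
    then have "real_of_int k \<le> -1" by simp
    then show ?thesis using assms by (auto simp: circ_def min_def abs_if)
  qed (simp add: circ_def)
qed

lemma circ_attained:
  assumes "0 \<le> s" "s \<le> 1" "0 \<le> t" "t \<le> 1"
  shows "\<exists>k. \<bar>of_int k + s - t\<bar> = circ s t"
proof -
  have "\<bar>of_int 0 + s - t\<bar> = circ s t \<or> \<bar>of_int 1 + s - t\<bar> = circ s t \<or> \<bar>of_int (-1) + s - t\<bar> = circ s t"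
    using assms by (auto simp: circ_def min_def abs_if)
  then show ?thesis by blast
qed

lemma LX_dist_far:
  "\<not> (odd \<lfloor>u\<rfloor> \<and> \<lfloor>u\<rfloor> = \<lfloor>v\<rfloor>) \<Longrightarrow> LX_dist u v = \<bar>foot u - foot v\<bar> + height u + height v"
  unfolding LX_dist_def by (rule if_not_P)

text \<open>In terms of codes, the parity of the floor selects the petal and the fractional part the
  parameter on it. With \<open>rose_dist_attained\<close>, this bound identifies
  \<open>rose_dist\<close> with the quotient distance.\<close>

lemma rose_dist_le: "rose_dist u v \<le> LX_dist u v"
proof (cases "odd \<lfloor>u\<rfloor> \<and> \<lfloor>u\<rfloor> = \<lfloor>v\<rfloor>")
  case True
  then show ?thesis unfolding LX_dist_def if_P[OF True] by (simp add: rose_dist_def)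
next
  case False
  define a b where "a = \<lfloor>u\<rfloor> div 2" and "b = \<lfloor>v\<rfloor> div 2"
  note f = frac_bounds(1,2)[of u] frac_bounds(1,2)[of v]
  have c: "circ (frac u) (frac v) \<le> hgt (frac u) + hgt (frac v)" using f by (intro circ_le_hgt)
  have i1: "circ (frac u) (frac v) \<le> \<bar>of_int (a - b) + frac u - frac v\<bar>"
    using f by (intro circ_le_int)
  have i2: "hgt (frac v) \<le> \<bar>of_int (a - b) + 0 - frac v\<bar>"
    using circ_le_int[of 0 "frac v" "a - b"] circ_0[OF f(3,4)] f by simp
  have i3: "hgt (frac u) \<le> \<bar>of_int (a - b) + frac u - 0\<bar>"
    using circ_le_int[of "frac u" 0 "a - b"] circ_0[OF f(1,2)] f by simp
  have fu: "foot u = of_int a + (if odd \<lfloor>u\<rfloor> then 0 else frac u)"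
    and fv: "foot v = of_int b + (if odd \<lfloor>v\<rfloor> then 0 else frac v)"
    by (simp_all add: foot_def a_def b_def)
  consider "odd \<lfloor>u\<rfloor>" "odd \<lfloor>v\<rfloor>" | "odd \<lfloor>u\<rfloor>" "even \<lfloor>v\<rfloor>" | "even \<lfloor>u\<rfloor>" "odd \<lfloor>v\<rfloor>" | "even \<lfloor>u\<rfloor>" "even \<lfloor>v\<rfloor>"
    by blast
  then show ?thesis
  proof cases
    case 1
    then show ?thesis using c abs_ge_zero[of "foot u - foot v"]
      unfolding LX_dist_far[OF False] by (simp add: rose_dist_def height_def)
  next
    case 2
    then show ?thesis using i2
      unfolding LX_dist_far[OF False] fu fv by (simp add: rose_dist_def height_def algebra_simps)
  next
    case 3
    then show ?thesis using i3
      unfolding LX_dist_far[OF False] fu fv by (simp add: rose_dist_def height_def algebra_simps)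
  next
    case 4
    then show ?thesis using i1
      unfolding LX_dist_far[OF False] fu fv by (simp add: rose_dist_def height_def algebra_simps)
  qed
qed

lemma rose_dist_shift: "u \<in> LX_set \<Longrightarrow> v \<in> LX_set \<Longrightarrow> rose_dist (shift j u) (shift k v) = rose_dist u v"
  by (simp add: rose_dist_def shift_facts)

lemma rose_dist_attained:
  assumes uv: "u \<in> LX_set" "v \<in> LX_set"
  shows "\<exists>k. LX_dist u (shift k v) = rose_dist u v"
proof -
  define a b where "a = \<lfloor>u\<rfloor> div 2" and "b = \<lfloor>v\<rfloor> div 2"
  note f = frac_bounds(1,2)[of u] frac_bounds(1,2)[of v]
  show ?thesis
  proof (cases "odd \<lfloor>u\<rfloor> \<and> odd \<lfloor>v\<rfloor>")
    case True
    then have "\<lfloor>shift (a - b) v\<rfloor> = \<lfloor>u\<rfloor>" using uv by (simp add: shift_facts a_def b_def) presburger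
    then have "LX_dist u (shift (a - b) v) = rose_dist u v"
      using True uv by (simp add: LX_dist_def rose_dist_def shift_facts(3))
    then show ?thesis ..
  next
    case False
    define s where "s = (if odd \<lfloor>u\<rfloor> then 0 else frac u)"
    define t where "t = (if odd \<lfloor>v\<rfloor> then 0 else frac v)"
    have st: "0 \<le> s" "s \<le> 1" "0 \<le> t" "t \<le> 1" using f by (auto simp: s_def t_def)
    then obtain k where k: "\<bar>of_int k + s - t\<bar> = circ s t" using circ_attained by blast
    have "\<not> (odd \<lfloor>u\<rfloor> \<and> \<lfloor>u\<rfloor> = \<lfloor>shift (a - b - k) v\<rfloor>)" using False uv by (auto simp: shift_facts)
    \<comment> \<open>\<open>a - b\<close> aligns the integer parts of the feet, and the correction
      \<open>k\<close> selects the nearest translate.\<close>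
    then have "LX_dist u (shift (a - b - k) v) = \<bar>of_int a + s - (of_int b + t + of_int (a - b - k))\<bar> + height u + height v"
      using uv by (simp add: LX_dist_far shift_facts) (simp add: foot_def a_def b_def s_def t_def)
    also have "\<dots> = circ s t + height u + height v" using k by (simp add: algebra_simps)
    also have "\<dots> = rose_dist u v"
      using False f by (auto simp: s_def t_def rose_dist_def height_def circ_0)
    finally show ?thesis ..
  qed
qed

lemma quotient_dist_orbit:
  assumes uv: "u \<in> LX_set" "v \<in> LX_set"
  shows "quotient_dist LX (orbit_of shifts u) (orbit_of shifts v) = rose_dist u v"
proof -
  let ?A = "orbit_of shifts u" and ?B = "orbit_of shifts v"
  have ne: "?A \<noteq> {}" "?B \<noteq> {}" by (auto simp: orbit_shifts)
  have "Inf ((\<lambda>(x, y). mdist LX x y) ` (?A \<times> ?B)) = rose_dist u v"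
  proof (rule cInf_eq_minimum)
    obtain k where k: "LX_dist u (shift k v) = rose_dist u v" using rose_dist_attained[OF uv] by blast
    have "u = shift 0 u" using uv by (simp add: shift_0)
    then have "u \<in> ?A" unfolding orbit_shifts by blast
    moreover have "shift k v \<in> ?B" by (auto simp: orbit_shifts)
    ultimately have "(u, shift k v) \<in> ?A \<times> ?B" by blast
    then show "rose_dist u v \<in> (\<lambda>(x, y). mdist LX x y) ` (?A \<times> ?B)"
      using k by (intro image_eqI[of _ _ "(u, shift k v)"]) simp
  next
    fix z assume "z \<in> (\<lambda>(x, y). mdist LX x y) ` (?A \<times> ?B)"
    then obtain j k where "z = LX_dist (shift j u) (shift k v)" by (auto simp: orbit_shifts)
    then show "rose_dist u v \<le> z"
      using rose_dist_le[of "shift j u" "shift k v"] rose_dist_shift[OF uv] by simp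
  qed
  then show ?thesis using ne by (simp add: quotient_dist_def)
qed

lemma rose_dist_triangle: "rose_dist u w \<le> rose_dist u v + rose_dist v w"
proof -
  note b = frac_bounds(1,2)[of u] frac_bounds(1,2)[of v] frac_bounds(1,2)[of w]
  note c = circ_triangle[OF b(1,2,5,6,3,4)] circ_le_hgt[OF b(1,2,5,6)]
    hgt_le_circ[OF b(1-4)] hgt_le_circ[OF b(5,6,3,4)] circ_commute[of "frac v" "frac w"]
    hgt_bounds[OF b(1,2)] hgt_bounds[OF b(3,4)] hgt_bounds[OF b(5,6)]
  show ?thesis
    unfolding rose_dist_def using c
    by (cases "odd \<lfloor>u\<rfloor>"; cases "odd \<lfloor>v\<rfloor>"; cases "odd \<lfloor>w\<rfloor>"; simp only: simp_thms if_True if_False; linarith)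
qed

lemma rose_dist_eq_0:
  assumes uv: "u \<in> LX_set" "v \<in> LX_set"
  shows "rose_dist u v = 0 \<longleftrightarrow> orbit_of shifts u = orbit_of shifts v"
proof
  assume 0: "rose_dist u v = 0"
  note f = frac_bounds[of u] frac_bounds[of v]
  \<comment> \<open>Points of different petals at distance 0 both have fractional part 0, but an odd
    code with fractional part 0 is excluded from \<open>LX_set\<close>.\<close>
  have "odd \<lfloor>u\<rfloor> = odd \<lfloor>v\<rfloor>"
  proof (rule ccontr)
    assume ne: "odd \<lfloor>u\<rfloor> \<noteq> odd \<lfloor>v\<rfloor>"
    then have "hgt (frac u) = 0" "hgt (frac v) = 0"
      using 0 hgt_bounds[of "frac u"] hgt_bounds[of "frac v"] f by (auto simp: rose_dist_def)
    then have "frac u = 0" "frac v = 0" using f by (auto simp: hgt_def min_def split: if_splits)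
    then show False using uv ne by (auto simp: LX_set_def simp del: frac_eq_0_iff)
  qed
  then have par: "odd \<lfloor>u\<rfloor> = odd \<lfloor>v\<rfloor>" "frac u = frac v"
    using 0 circ_eq_0[of "frac u" "frac v"] f by (auto simp: rose_dist_def)
  define k where "k = (\<lfloor>v\<rfloor> - \<lfloor>u\<rfloor>) div 2"
  have "\<lfloor>v\<rfloor> = \<lfloor>u\<rfloor> + 2 * k" using par(1) by (simp add: k_def)
  then have "v = shift k u" using par(2) uv by (simp add: shift_def frac_def)
  then show "orbit_of shifts u = orbit_of shifts v" using orbit_shift uv by metis
next
  assume "orbit_of shifts u = orbit_of shifts v"
  then have "rose_dist u v = rose_dist u u" using quotient_dist_orbit uv by metis
  then show "rose_dist u v = 0" using circ_eq_0[of "frac u" "frac u"] frac_bounds[of u] by (simp add: rose_dist_def)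
qed

lemma Metric_space_rose: "Metric_space (orbit_space shifts (mspace LX)) (quotient_dist LX)"
proof
  fix A B
  show "0 \<le> quotient_dist LX A B"
    unfolding quotient_dist_def by (auto intro!: cINF_greatest simp flip: mdist_LX)
  have "(\<lambda>(x, y). mdist LX x y) ` (A \<times> B) = (\<lambda>(x, y). mdist LX x y) ` (B \<times> A)"
    by (auto simp: image_iff simp del: mdist_LX) (meson mdist_commute)+
  then show "quotient_dist LX A B = quotient_dist LX B A"
    by (simp add: quotient_dist_def disj_commute)
next
  fix A B assume "A \<in> orbit_space shifts (mspace LX)" "B \<in> orbit_space shifts (mspace LX)"
  then obtain u v where "u \<in> LX_set" "v \<in> LX_set" "A = orbit_of shifts u" "B = orbit_of shifts v"
    by (auto simp: orbit_space_def)
  then show "quotient_dist LX A B = 0 \<longleftrightarrow> A = B"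
    by (simp add: quotient_dist_orbit rose_dist_eq_0)
next
  fix A B C assume "A \<in> orbit_space shifts (mspace LX)" "B \<in> orbit_space shifts (mspace LX)" "C \<in> orbit_space shifts (mspace LX)"
  then obtain u v w where "u \<in> LX_set" "v \<in> LX_set" "A = orbit_of shifts u" "B = orbit_of shifts v"
     "w \<in> LX_set" "C = orbit_of shifts w"
    by (auto simp: orbit_space_def)
  then show "quotient_dist LX A C \<le> quotient_dist LX A B + quotient_dist LX B C"
    by (simp add: quotient_dist_orbit rose_dist_triangle)
qed

lemma mspace_rose: "mspace rose = orbit_of shifts ` LX_set"
  unfolding rose_def quotient_metric_def Metric_space.mspace_metric[OF Metric_space_rose]
  by (simp add: orbit_space_def)

lemma dist_rose_orbit:
  "u \<in> LX_set \<Longrightarrow> v \<in> LX_set \<Longrightarrow> mdist rose (orbit_of shifts u) (orbit_of shifts v) = rose_dist u v"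
  unfolding rose_def quotient_metric_def Metric_space.mdist_metric[OF Metric_space_rose]
  by (rule quotient_dist_orbit)

text \<open>A letter is an oriented petal; the petal \<open>False\<close> is the image of the line.\<close>

type_synonym letter = "bool \<times> bool"

definition linv :: "letter \<Rightarrow> letter" where "linv l = (fst l, \<not> snd l)"

text \<open>The parameter is the length travelled along the oriented petal from the vertex. Any
  representative of the orbit will do, so the petals are read off from the segment between 0 and 1
  and from the loop at 0.\<close>

definition pt :: "letter \<Rightarrow> real \<Rightarrow> real set" where
  "pt l \<sigma> = (let x = if snd l then \<sigma> else 1 - \<sigma> in
     orbit_of shifts (if fst l then on_loop 0 x else on_line x))"

lemma linv_linv [simp]: "linv (linv l) = l" by (simp add: linv_def)

lemma linv_neq [simp]: "linv l \<noteq> l" "l \<noteq> linv l" by (auto simp: linv_def prod_eq_iff)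

lemma linv_eq_iff: "linv l = m \<longleftrightarrow> l = linv m" by (auto simp: linv_def prod_eq_iff)

lemma letter_cases: "l' = l \<or> l' = linv l \<or> fst l' \<noteq> fst l"
  by (auto simp: linv_def prod_eq_iff)

lemma pt_linv: "pt (linv l) \<sigma> = pt l (1 - \<sigma>)"
  by (simp add: pt_def linv_def Let_def)

lemma pt_in: "0 \<le> \<sigma> \<Longrightarrow> \<sigma> \<le> 1 \<Longrightarrow> pt l \<sigma> \<in> mspace rose"
  by (auto simp: pt_def mspace_rose on_loop Let_def)

lemma circ_flip: "circ (1 - s) (1 - t) = circ s t"
  by (simp add: circ_def abs_minus_commute)

lemma hgt_flip: "hgt (1 - s) = hgt s" by (simp add: hgt_def min.commute)

lemma frac_01: "0 \<le> s \<Longrightarrow> s \<le> 1 \<Longrightarrow> frac s = (if s = 1 then 0 else s)"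
  by (auto simp: frac_eq)

lemma circ_frac:
  assumes "0 \<le> s" "s \<le> 1" "0 \<le> t" "t \<le> 1"
  shows "circ (frac s) (frac t) = circ s t" "hgt (frac s) = hgt s"
  using assms by (auto simp: frac_01 circ_def hgt_def)

lemma on_loop_floor:
  assumes "0 \<le> s" "s \<le> 1"
  shows "\<lfloor>on_loop 0 s\<rfloor> = (if s = 0 \<or> s = 1 then 0 else 1)" "frac (on_loop 0 s) = frac s"
proof -
  consider "s = 0" | "s = 1" | "0 < s" "s < 1" using assms by linarith
  then have "\<lfloor>on_loop 0 s\<rfloor> = (if s = 0 \<or> s = 1 then 0 else 1) \<and> frac (on_loop 0 s) = frac s"
    by cases (simp_all add: on_loop_end on_loop_interior frac_01)
  then show "\<lfloor>on_loop 0 s\<rfloor> = (if s = 0 \<or> s = 1 then 0 else 1)" "frac (on_loop 0 s) = frac s" by auto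
qed

lemma rose_dist_on_line: "rose_dist (on_line x) (on_line y) = circ (frac x) (frac y)"
  by (simp add: rose_dist_def)

lemma rose_dist_on_loop:
  assumes "0 \<le> s" "s \<le> 1" "0 \<le> t" "t \<le> 1"
  shows "rose_dist (on_loop 0 s) (on_loop 0 t) = circ s t"
    "rose_dist (on_loop 0 s) (on_line t) = hgt s + hgt t"
    "rose_dist (on_line t) (on_loop 0 s) = hgt s + hgt t"
proof -
  have z: "s = 0 \<or> s = 1 \<Longrightarrow> hgt s = 0" for s :: real by (auto simp: hgt_def)
  note c = circ_frac[OF assms] circ_frac(2)[OF assms(3,4,1,2)]
  have e: "circ s t = hgt t" if "s = 0 \<or> s = 1" using that assms by (auto simp: circ_def hgt_def)
  have e': "circ s t = hgt s" if "t = 0 \<or> t = 1" using that assms by (auto simp: circ_def hgt_def)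
  show "rose_dist (on_loop 0 s) (on_loop 0 t) = circ s t"
    unfolding rose_dist_def on_loop_floor[OF assms(1,2)] on_loop_floor[OF assms(3,4)] c
    using e e' z[of s] z[of t] by auto
  show "rose_dist (on_loop 0 s) (on_line t) = hgt s + hgt t"
    unfolding rose_dist_def on_loop_floor[OF assms(1,2)] on_line c using e z[of s] by auto
  show "rose_dist (on_line t) (on_loop 0 s) = hgt s + hgt t"
    unfolding rose_dist_def on_loop_floor[OF assms(1,2)] on_line c circ_commute[of "frac t"] using e z[of s] by auto
qed

lemma dist_pt_same:
  assumes "0 \<le> \<sigma>" "\<sigma> \<le> 1" "0 \<le> \<tau>" "\<tau> \<le> 1"
  shows "mdist rose (pt l \<sigma>) (pt l \<tau>) = circ \<sigma> \<tau>"
  using assms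
  by (simp add: pt_def Let_def dist_rose_orbit on_loop rose_dist_on_line circ_frac rose_dist_on_loop circ_flip)

lemma dist_pt_other:
  assumes "0 \<le> \<sigma>" "\<sigma> \<le> 1" "0 \<le> \<tau>" "\<tau> \<le> 1" "fst l \<noteq> fst l'"
  shows "mdist rose (pt l \<sigma>) (pt l' \<tau>) = hgt \<sigma> + hgt \<tau>"
  using assms
  by (simp add: pt_def Let_def dist_rose_orbit on_loop rose_dist_on_loop hgt_flip)

lemma pt_surj_pos:
  assumes "x \<in> mspace rose"
  obtains l \<sigma> where "snd l" "0 \<le> \<sigma>" "\<sigma> < 1" "x = pt l \<sigma>"
proof -
  obtain u where u: "u \<in> LX_set" "x = orbit_of shifts u" using assms by (auto simp: mspace_rose)
  have f: "0 \<le> frac u" "frac u < 1" using frac_bounds by auto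
  have "pt (odd \<lfloor>u\<rfloor>, True) (frac u) \<in> mspace rose" using f by (intro pt_in) auto
  moreover have "mdist rose x (pt (odd \<lfloor>u\<rfloor>, True) (frac u)) = 0"
  proof (cases "odd \<lfloor>u\<rfloor>")
    case True
    then have "frac u \<noteq> 0" using u by (simp add: LX_set_def)
    then have "0 < frac u" using f(1) by linarith
    then show ?thesis using True u f on_loop[of "frac u" 0] on_loop_interior[of "frac u" 0] circ_eq_0
      by (simp add: pt_def dist_rose_orbit rose_dist_def del: frac_gt_0_iff)
  next
    case False
    then show ?thesis using u f circ_eq_0
      by (simp add: pt_def dist_rose_orbit rose_dist_def)
  qed
  ultimately have "x = pt (odd \<lfloor>u\<rfloor>, True) (frac u)" using assms by simp
  then show ?thesis using that[of "(odd \<lfloor>u\<rfloor>, True)" "frac u"] f by simp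
qed

text \<open>Reversing the petal replaces \<sigma> by \<open>1 - \<sigma>\<close>, so the four
  letters name four half petals issuing from the vertex, which cover the rose.\<close>

lemma pt_surj:
  assumes "x \<in> mspace rose"
  obtains l \<sigma> where "0 \<le> \<sigma>" "\<sigma> \<le> 1/2" "x = pt l \<sigma>"
proof -
  obtain l \<sigma> where l: "0 \<le> \<sigma>" "\<sigma> < 1" "x = pt l \<sigma>" using assms by (rule pt_surj_pos)
  show ?thesis
  proof (cases "\<sigma> \<le> 1/2")
    case False
    then show ?thesis using that[of "1 - \<sigma>" "linv l"] l by (simp add: pt_linv)
  qed (use l that in blast)
qed

lemma dist_pt_near:
  assumes "0 \<le> \<sigma>" "\<sigma> \<le> 1" "0 \<le> \<tau>" "\<tau> \<le> 1" "\<bar>\<sigma> - \<tau>\<bar> \<le> 1/2"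
  shows "mdist rose (pt l \<sigma>) (pt l \<tau>) = \<bar>\<sigma> - \<tau>\<bar>"
  using assms by (simp add: dist_pt_same circ_def)

text \<open>Near the vertex the rose is a star with one ray for each letter; a letter and its
  inverse are the two ends of one petal and count as different rays.\<close>

lemma dist_pt_star:
  assumes "0 \<le> \<sigma>" "0 \<le> \<tau>" "\<sigma> + \<tau> \<le> 1/2" "l \<noteq> l'"
  shows "mdist rose (pt l \<sigma>) (pt l' \<tau>) = \<sigma> + \<tau>"
proof (cases "l' = linv l")
  case True
  have "mdist rose (pt l \<sigma>) (pt l (1 - \<tau>)) = circ \<sigma> (1 - \<tau>)" using assms by (intro dist_pt_same) auto
  also have "\<dots> = \<sigma> + \<tau>" using assms by (auto simp: circ_def min_def abs_if)
  finally show ?thesis by (simp add: True pt_linv)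
next
  case False
  then have "fst l \<noteq> fst l'" using letter_cases[of l' l] assms by auto
  then have "mdist rose (pt l \<sigma>) (pt l' \<tau>) = hgt \<sigma> + hgt \<tau>" using assms by (intro dist_pt_other) auto
  also have "\<dots> = \<sigma> + \<tau>" using assms by (simp add: hgt_def)
  finally show ?thesis .
qed

lemma pt_0: "pt l 0 = pt l' 0"
proof (cases "l = l'")
  case False
  then have "mdist rose (pt l 0) (pt l' 0) = 0" using dist_pt_star[of 0 0 l l'] by simp
  then show ?thesis using pt_in by simp
qed simp

lemma pt_1: "pt l 1 = pt l' 0"
  using pt_0[of "linv l" l'] pt_linv[of l 0] by simp

lemma dist_vertex: "0 \<le> \<sigma> \<Longrightarrow> \<sigma> \<le> 1/2 \<Longrightarrow> mdist rose (pt l 0) (pt l' \<sigma>) = \<sigma>"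
  using dist_pt_near[of 0 \<sigma> l'] pt_0[of l l'] by simp

lemma rose_polar:
  assumes "x \<in> mspace rose"
  obtains l' where "x = pt l' (mdist rose (pt l 0) x)" "mdist rose (pt l 0) x \<le> 1/2"
proof -
  obtain l' \<sigma> where "0 \<le> \<sigma>" "\<sigma> \<le> 1/2" "x = pt l' \<sigma>" using assms by (rule pt_surj)
  then show ?thesis using that[of l'] dist_vertex by simp
qed

text \<open>A ball that does not reach the vertex stays inside one petal, where the distance leaves
  only the choice of a side.\<close>

lemma rose_edge_ball:
  assumes \<sigma>: "0 < \<sigma>" "\<sigma> \<le> 1/2" and x: "x \<in> mspace rose" and d: "mdist rose (pt l \<sigma>) x < \<sigma>"
  obtains e where "e \<in> {1, -1}" "x = pt l (\<sigma> + e * mdist rose (pt l \<sigma>) x)"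
proof -
  obtain l' \<tau> where \<tau>: "0 \<le> \<tau>" "\<tau> \<le> 1/2" "x = pt l' \<tau>" using x by (rule pt_surj)
  have "fst l' = fst l"
  proof (rule ccontr)
    assume "fst l' \<noteq> fst l"
    then have "mdist rose (pt l \<sigma>) x = hgt \<sigma> + hgt \<tau>" using \<sigma> \<tau> by (simp add: dist_pt_other)
    then show False using d \<sigma> hgt_bounds[of \<tau>] \<tau> by (simp add: hgt_def)
  qed
  then have "l' = l \<or> l' = linv l" using letter_cases by blast
  then obtain \<tau>' where \<tau>': "0 \<le> \<tau>'" "\<tau>' \<le> 1" "x = pt l \<tau>'"
    using \<tau> pt_linv[of l \<tau>] by (elim disjE) (auto intro: that[of \<tau>] that[of "1 - \<tau>"])
  have c: "mdist rose (pt l \<sigma>) x = circ \<sigma> \<tau>'" using \<sigma> \<tau>' by (simp add: dist_pt_same)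
  then have c': "mdist rose (pt l \<sigma>) x = \<bar>\<sigma> - \<tau>'\<bar>"
    using d \<sigma> \<tau>' by (auto simp: circ_def min_def abs_if split: if_splits)
  show ?thesis
    using that[of 1] that[of "-1"] \<tau>' c' by (cases "\<sigma> \<le> \<tau>'") auto
qed

lemma compact_space_rose: "compact_space (mtopology_of rose)"
proof -
  have "compactin (mtopology_of rose) (pt l ` {0..1})" for l
    by (rule compactin_nonexpansive_image) (auto simp: pt_in dist_pt_same circ_le)
  then have "compactin (mtopology_of rose) (\<Union>l\<in>UNIV. pt l ` {0..1})"
    by (intro compactin_Union) auto
  also have "(\<Union>l\<in>UNIV. pt l ` {0..1}) = mspace rose"
  proof (intro equalityI subsetI)
    fix x assume "x \<in> mspace rose"
    then obtain l \<sigma> where "0 \<le> \<sigma>" "\<sigma> < 1" "x = pt l \<sigma>" by (rule pt_surj_pos)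
    then have "x \<in> pt l ` {0..1}" by auto
    then show "x \<in> (\<Union>l\<in>UNIV. pt l ` {0..1})" by blast
  qed (auto simp: pt_in)
  finally show ?thesis by (simp add: compact_space_def)
qed

text \<open>Here \<open>a\<close> names the ray and \<rho> is the distance from the centre of a
  star. The Gromov products \<open>g\<close> at the centre satisfy the ultrametric inequality, and
  the four-point condition follows by comparing the six products.\<close>

lemma four_point_star:
  fixes a :: "'i \<Rightarrow> 'j" and \<rho> :: "'i \<Rightarrow> real"
  assumes D: "\<And>x y. D x y = (if a x = a y then \<bar>\<rho> x - \<rho> y\<bar> else \<rho> x + \<rho> y)"
    and nn: "\<And>x. 0 \<le> \<rho> x"
  shows "D x z + D y w \<le> max (D x y + D z w) (D y z + D x w)"
proof -
  define g where "g x y = (if a x = a y then min (\<rho> x) (\<rho> y) else 0)" for x y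
  have Dg: "D x y = \<rho> x + \<rho> y - 2 * g x y" for x y
    by (auto simp: D g_def min_def abs_if)
  have u: "min (g x y) (g y z) \<le> g x z" for x y z using nn[of x] nn[of y] nn[of z] by (auto simp: g_def min_def)
  have c: "g x y = g y x" for x y by (simp add: g_def min.commute)
  have "min (g x y + g z w) (g y z + g x w) \<le> g x z + g y w"
    using u[of x y z] u[of x w z] u[of y x w] u[of y z w] u[of x z y] u[of z x y] u[of x y w] u[of x z w]
      u[of y x z] u[of y w z] u[of z y w] u[of z x w] u[of x w y] u[of y w x]
      c[of y x] c[of z x] c[of w x] c[of z y] c[of w y] c[of w z]
    by (auto simp: min_def split: if_splits)
  then show ?thesis by (auto simp: Dg min_def max_def split: if_splits)
qed

lemma four_point_real:
  "\<bar>x - z\<bar> + \<bar>y - w\<bar> \<le> max (\<bar>x - y\<bar> + \<bar>z - w\<bar>) (\<bar>y - z\<bar> + \<bar>x - (w::real)\<bar>)"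
  by (auto simp: max_def abs_if)

lemma gromov_product_four_point:
  assumes "mdist X p r + mdist X q w \<le> max (mdist X p q + mdist X r w) (mdist X q r + mdist X p w)"
  shows "min (gromov_product X p q w) (gromov_product X q r w) \<le> gromov_product X p r w"
  using assms unfolding gromov_product_def mdist_commute[of X w]
  by (auto simp: max_def min_def split: if_splits)

text \<open>Small balls are trees: a star about the vertex and an interval about any other point.
  Both satisfy the four-point condition without error, which gives the comparison
  inequality.\<close>

lemma locally_CAT_minus_1_rose: "locally_CAT_minus_1 rose"
  unfolding locally_CAT_minus_1_def
proof
  fix x assume x: "x \<in> mspace rose"
  then obtain l \<sigma> where \<sigma>: "0 \<le> \<sigma>" "\<sigma> \<le> 1/2" "x = pt l \<sigma>" by (rule pt_surj)
  show "\<exists>r>0. CAT_minus_1 (submetric rose (mball_of rose x r))"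
  proof (cases "\<sigma> = 0")
    case True
    define B where "B = mball_of rose x (1/8)"
    have B: "B \<inter> mspace rose = B" by (auto simp: B_def)
    define \<rho> where "\<rho> y = mdist rose x y" for y
    have "\<exists>l'. pt l' (\<rho> y) = y" if "y \<in> B" for y
      using that rose_polar[of y l] True \<sigma> unfolding B_def \<rho>_def by (metis in_mball_of)
    then obtain a where a: "\<And>y. y \<in> B \<Longrightarrow> pt (a y) (\<rho> y) = y" by metis
    have \<rho>: "0 \<le> \<rho> y" "y \<in> B \<Longrightarrow> \<rho> y < 1/8" for y by (auto simp: \<rho>_def B_def)
    have D: "mdist rose y z = (if a y = a z then \<bar>\<rho> y - \<rho> z\<bar> else \<rho> y + \<rho> z)" if "y \<in> B" "z \<in> B" for y z
    proof (cases "a y = a z")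
      case True
      have "mdist rose (pt (a y) (\<rho> y)) (pt (a y) (\<rho> z)) = \<bar>\<rho> y - \<rho> z\<bar>"
        using \<rho>(1)[of y] \<rho>(1)[of z] \<rho>(2)[OF that(1)] \<rho>(2)[OF that(2)] by (intro dist_pt_near; linarith)
      then show ?thesis using a[OF that(1)] a[OF that(2)] True by simp
    next
      case False
      have "mdist rose (pt (a y) (\<rho> y)) (pt (a z) (\<rho> z)) = \<rho> y + \<rho> z"
        by (rule dist_pt_star) (use \<rho>[of y] \<rho>[of z] that False in auto)
      then show ?thesis using a[OF that(1)] a[OF that(2)] False by simp
    qed
    have ptB: "pt l' s \<in> B \<and> \<rho> (pt l' s) = s" if "0 \<le> s" "s < 1/8" for l' s
      using that \<sigma> True x by (simp add: B_def \<rho>_def pt_in dist_vertex)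
    have iso: "isometric_on (submetric rose B) {0..s} (pt l')" if "s < 1/8" for l' s
    proof -
      have "mdist rose (pt l' u) (pt l' v) = \<bar>u - v\<bar>" if "u \<in> {0..s}" "v \<in> {0..s}" for u v
        by (rule dist_pt_near) (use that \<open>s < 1/8\<close> in \<open>auto simp: abs_if\<close>)
      moreover have "pt l' u \<in> B" if "u \<in> {0..s}" for u
        using ptB[of u l'] that \<open>s < 1/8\<close> by simp
      ultimately show ?thesis by (auto simp: isometric_on_def B)
    qed
    have ray: "joined (submetric rose B) y x" if "y \<in> B" for y
      using joined_isometric[OF iso[of "\<rho> y" "a y"], of "\<rho> y" 0] \<rho>[of y] a[OF that] that \<sigma> True pt_0[of "a y" l] by simp
    have "joined (submetric rose B) y z" if yz: "y \<in> B" "z \<in> B" for y z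
    proof (cases "a y = a z")
      case True
      then show ?thesis
        using joined_isometric[OF iso[of "max (\<rho> y) (\<rho> z)" "a y"], of "\<rho> y" "\<rho> z"] \<rho>[of y] \<rho>[of z] a[OF yz(1)] a[OF yz(2)] yz by simp
    next
      case False
      then show ?thesis
        using joined_trans[OF ray[OF yz(1)] joined_commute[OF ray[OF yz(2)]]] D[OF yz]
        by (simp add: \<rho>_def mdist_commute)
    qed
    then have "geodesic_space (submetric rose B)" by (simp add: geodesic_space_joined B)
    moreover have "min (gromov_product rose p q w) (gromov_product rose q r w) \<le> gromov_product rose p r w"
      if "p \<in> B" "q \<in> B" "r \<in> B" "w \<in> B" for p q r w
    proof (rule gromov_product_four_point)
      show "mdist rose p r + mdist rose q w \<le> max (mdist rose p q + mdist rose r w) (mdist rose q r + mdist rose p w)"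
        using four_point_star[of "\<lambda>y z. if a y = a z then \<bar>\<rho> y - \<rho> z\<bar> else \<rho> y + \<rho> z" a \<rho> p r q w] \<rho>(1)
        by (simp only: D that)
    qed
    ultimately have "CAT_minus_1 (submetric rose B)"
      by (intro CAT_minus_1_if_zero_hyperbolic) (auto simp: gromov_product_def B)
    then show ?thesis unfolding B_def by (intro exI[of _ "1/8"]) simp
  next
    case False
    then have \<sigma>0: "0 < \<sigma>" using \<sigma> by simp
    \<comment> \<open>The ball must not contain the vertex, and its parameters must differ by at
      most 1/2 for the arc length to be their difference.\<close>
    define r where "r = min \<sigma> (1/8)"
    define B where "B = mball_of rose x r"
    have B: "B \<inter> mspace rose = B" by (auto simp: B_def)
    have ex: "\<exists>\<tau>. pt l \<tau> = y \<and> \<bar>\<tau> - \<sigma>\<bar> < r" if y: "y \<in> B" for y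
    proof -
      have "y \<in> mspace rose" "mdist rose (pt l \<sigma>) y < \<sigma>" using y \<sigma> by (auto simp: B_def r_def)
      then obtain e where e: "e \<in> {1, -1}" "y = pt l (\<sigma> + e * mdist rose (pt l \<sigma>) y)"
        by (rule rose_edge_ball[OF \<sigma>0 \<sigma>(2)])
      have "mdist rose (pt l \<sigma>) y < r" using y \<sigma> by (simp add: B_def)
      then have "\<bar>\<sigma> + e * mdist rose (pt l \<sigma>) y - \<sigma>\<bar> < r" using e(1) by auto
      then show ?thesis using e(2)[symmetric] by blast
    qed
    then obtain f where f: "\<And>y. y \<in> B \<Longrightarrow> pt l (f y) = y \<and> \<bar>f y - \<sigma>\<bar> < r" by metis
    have near: "mdist rose (pt l s) (pt l t) = \<bar>s - t\<bar>" if "\<bar>s - \<sigma>\<bar> < r" "\<bar>t - \<sigma>\<bar> < r" for s t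
      by (rule dist_pt_near) (use that \<sigma> in \<open>auto simp: r_def abs_if split: if_splits\<close>)
    have D: "mdist rose y z = \<bar>f y - f z\<bar>" if "y \<in> B" "z \<in> B" for y z
      using near[of "f y" "f z"] f[OF that(1)] f[OF that(2)] by metis
    have inB: "pt l s \<in> B" if "\<bar>s - \<sigma>\<bar> < r" for s
    proof -
      have "pt l s \<in> mspace rose" by (rule pt_in) (use that \<sigma> in \<open>auto simp: r_def abs_if split: if_splits\<close>)
      moreover have "0 < r" using \<sigma>0 by (simp add: r_def)
      ultimately show ?thesis using near[of \<sigma> s] that x \<sigma> by (simp add: B_def abs_minus_commute)
    qed
    have "joined (submetric rose B) y z" if yz: "y \<in> B" "z \<in> B" for y z
    proof -
      have "\<bar>u - \<sigma>\<bar> < r" if "u \<in> {min (f y) (f z)..max (f y) (f z)}" for u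
        using that f[OF yz(1)] f[OF yz(2)] by (auto simp: abs_if min_def max_def split: if_splits)
      then have "isometric_on (submetric rose B) {min (f y) (f z)..max (f y) (f z)} (pt l)"
        using near inB by (auto simp: isometric_on_def B)
      from joined_isometric[OF this, of "f y" "f z"] show ?thesis
        using f[OF yz(1)] f[OF yz(2)] by simp
    qed
    then have "geodesic_space (submetric rose B)" by (simp add: geodesic_space_joined B)
    moreover have "min (gromov_product rose p q w) (gromov_product rose q r w) \<le> gromov_product rose p r w"
      if "p \<in> B" "q \<in> B" "r \<in> B" "w \<in> B" for p q r w
    proof (rule gromov_product_four_point)
      show "mdist rose p r + mdist rose q w \<le> max (mdist rose p q + mdist rose r w) (mdist rose q r + mdist rose p w)"
        using four_point_real by (simp only: D that)
    qed
    ultimately have "CAT_minus_1 (submetric rose B)"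
      by (intro CAT_minus_1_if_zero_hyperbolic) (auto simp: gromov_product_def B)
    then show ?thesis unfolding B_def using \<sigma>0 by (intro exI[of _ r]) (simp add: r_def)
  qed
qed

section \<open>Local geodesics of the rose\<close>

definition red :: "(int \<Rightarrow> letter) \<Rightarrow> bool" where "red W \<longleftrightarrow> (\<forall>k. W (k + 1) \<noteq> linv (W k))"

definition geo :: "(int \<Rightarrow> letter) \<Rightarrow> real \<Rightarrow> real set" where "geo W t = pt (W \<lfloor>t\<rfloor>) (frac t)"

lemma geo_on:
  assumes "of_int k \<le> t" "t \<le> of_int k + 1"
  shows "geo W t = pt (W k) (t - of_int k)"
proof (cases "t = of_int k + 1")
  case True
  then show ?thesis using pt_1[of "W k" "W (k + 1)"] by (simp add: geo_def frac_def)
next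
  case False
  then have "\<lfloor>t\<rfloor> = k" using assms by (intro floor_unique) auto
  then show ?thesis by (simp add: geo_def frac_def)
qed

lemma geo_in: "geo W t \<in> mspace rose"
  using frac_bounds[of t] by (simp add: geo_def pt_in)

lemma geo_shift: "geo W (t + of_int m) = geo (\<lambda>k. W (k + m)) t"
  by (simp add: geo_def frac_def)

lemma red_shift: "red W \<Longrightarrow> red (\<lambda>k. W (k + m))"
  unfolding red_def by (metis add.commute add.left_commute)

text \<open>Within time 1/4 at most one vertex is passed. Seen from the vertex, the curve arrives on
  the ray of \<open>linv (W k)\<close> and leaves on that of \<open>W (k + 1)\<close>; for a reduced
  word these rays differ, so the distances to the vertex add.\<close>

lemma dist_geo_near:
  assumes W: "red W" and st: "\<bar>s - t\<bar> \<le> 1/4"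
  shows "mdist rose (geo W s) (geo W t) = \<bar>s - t\<bar>"
proof -
  have *: "mdist rose (geo W s) (geo W t) = t - s" if "s \<le> t" "t - s \<le> 1/4" for s t
  proof -
    define k where "k = \<lfloor>s\<rfloor>"
    have k: "of_int k \<le> s" "s < of_int k + 1" by (auto simp: k_def)
    then have s: "geo W s = pt (W k) (s - of_int k)" by (intro geo_on) auto
    show ?thesis
    proof (cases "t \<le> of_int k + 1")
      case True
      then have "geo W t = pt (W k) (t - of_int k)" using k that by (intro geo_on) auto
      then show ?thesis using dist_pt_near[of "s - of_int k" "t - of_int k" "W k"] s k that True by simp
    next
      case False
      then have t: "geo W t = pt (W (k + 1)) (t - of_int (k + 1))" using k that by (intro geo_on) auto
      have s': "geo W s = pt (linv (W k)) (of_int k + 1 - s)" unfolding s pt_linv by simp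
      have "linv (W k) \<noteq> W (k + 1)" using W unfolding red_def by metis
      then show ?thesis unfolding s' t
        using dist_pt_star[of "of_int k + 1 - s" "t - of_int (k + 1)" "linv (W k)" "W (k + 1)"] k that False by simp
    qed
  qed
  show ?thesis using *[of s t] *[of t s] st by (cases "s \<le> t") (auto simp: mdist_commute)
qed

lemma dist_geo_le:
  assumes "red W"
  shows "mdist rose (geo W s) (geo W t) \<le> \<bar>s - t\<bar>"
proof (rule nonexpansive_of_local[where D = "mdist rose" and f = "geo W" and a = "min s t" and b = "max s t" and \<epsilon> = "1/4"])
  show "mdist rose (geo W u) (geo W v) \<le> \<bar>u - v\<bar>" if "\<bar>u - v\<bar> \<le> 1/4" for u v
    using dist_geo_near[OF assms that] by simp
qed (auto intro: mdist_triangle geo_in)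

lemma geo_Loc_Geod:
  assumes "red W" shows "(\<lambda>t. geo W (t - \<tau>)) \<in> Loc_Geod rose"
  unfolding Loc_Geod_def local_geodesic_on_def
proof (clarsimp)
  fix t
  have "isometric_on rose {t - 1/8..t + 1/8} (\<lambda>t. geo W (t - \<tau>))"
    unfolding isometric_on_def
  proof (intro conjI ballI)
    fix u v assume "u \<in> {t - 1/8..t + 1/8}" "v \<in> {t - 1/8..t + 1/8}"
    then have "\<bar>(u - \<tau>) - (v - \<tau>)\<bar> \<le> 1/4" unfolding atLeastAtMost_iff by linarith
    from dist_geo_near[OF assms this]
    show "mdist rose (geo W (u - \<tau>)) (geo W (v - \<tau>)) = \<bar>u - v\<bar>" by simp
  qed (use geo_in in auto)
  then show "\<exists>\<epsilon>>0. isometric_on rose {t - \<epsilon>..t + \<epsilon>} (\<lambda>t. geo W (t - \<tau>))"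
    by (intro exI[of _ "1/8"]) simp
qed

text \<open>Every isometric piece agrees near a given time with a piece of some
  \<open>geo W\<close>, though \<open>W\<close> is not yet the same for all times. At the vertex the
  branches before and after lie on different rays; inside a petal the direction is constant.\<close>

lemma local_model:
  assumes iso: "isometric_on rose J \<gamma>" and t: "t \<in> J"
  shows "\<exists>\<delta>>0. \<exists>W \<tau>. red W \<and> (\<forall>s\<in>J. \<bar>s - t\<bar> \<le> \<delta> \<longrightarrow> \<gamma> s = geo W (s - \<tau>))"
proof -
  have mem: "\<gamma> s \<in> mspace rose" if "s \<in> J" for s using iso that by (auto simp: isometric_on_def)
  have d: "mdist rose (\<gamma> s) (\<gamma> s') = \<bar>s - s'\<bar>" if "s \<in> J" "s' \<in> J" for s s'
    using iso that by (auto simp: isometric_on_def)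
  obtain l \<sigma> where \<sigma>: "0 \<le> \<sigma>" "\<sigma> \<le> 1/2" "\<gamma> t = pt l \<sigma>" using mem[OF t] by (rule pt_surj)
  show ?thesis
  proof (cases "\<sigma> = 0")
    case True
    define J' where "J' = {s\<in>J. \<bar>s - t\<bar> \<le> 1/8}"
    have J: "s \<in> J" "\<bar>s - t\<bar> \<le> 1/8" if "s \<in> J'" for s using that by (auto simp: J'_def)
    have "\<exists>l'. \<gamma> s = pt l' \<bar>s - t\<bar>" if "s \<in> J'" for s
      using rose_polar[OF mem[OF J(1)[OF that]], of l] d[OF t J(1)[OF that]] \<sigma> True
      by (metis abs_minus_commute)
    then obtain a where a: "\<And>s. s \<in> J' \<Longrightarrow> \<gamma> s = pt (a s) \<bar>s - t\<bar>" by metis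
    have same: "a s = a s'" if ss: "s \<in> J'" "s' \<in> J'" and side: "t < s \<and> t < s' \<or> s < t \<and> s' < t" for s s'
    proof (rule ccontr)
      assume ne: "a s \<noteq> a s'"
      have "mdist rose (pt (a s) \<bar>s - t\<bar>) (pt (a s') \<bar>s' - t\<bar>) = \<bar>s - t\<bar> + \<bar>s' - t\<bar>"
        by (rule dist_pt_star) (use ne J(2)[OF ss(1)] J(2)[OF ss(2)] in auto)
      then have "\<bar>s - s'\<bar> = \<bar>s - t\<bar> + \<bar>s' - t\<bar>"
        using d[OF J(1)[OF ss(1)] J(1)[OF ss(2)]] by (simp only: a[OF ss(1)] a[OF ss(2)])
      then show False using side by linarith
    qed
    have opp: "a s \<noteq> a s'" if ss: "s \<in> J'" "s' \<in> J'" and side: "s < t" "t < s'" for s s'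
    proof
      assume eq: "a s = a s'"
      have "mdist rose (pt (a s') \<bar>s - t\<bar>) (pt (a s') \<bar>s' - t\<bar>) = \<bar>\<bar>s - t\<bar> - \<bar>s' - t\<bar>\<bar>"
        using J(2)[OF ss(1)] J(2)[OF ss(2)] by (intro dist_pt_near; linarith)
      then have "\<bar>s - s'\<bar> = \<bar>\<bar>s - t\<bar> - \<bar>s' - t\<bar>\<bar>"
        using d[OF J(1)[OF ss(1)] J(1)[OF ss(2)]] by (simp only: a[OF ss(1)] a[OF ss(2)] eq)
      then show False using side by linarith
    qed
    \<comment> \<open>\<open>J\<close> may end at \<open>t\<close>. On a side without points the ray
      is free and is chosen different from the other one.\<close>
    obtain L R where LR: "L \<noteq> R" and R: "\<And>s. s \<in> J' \<Longrightarrow> t < s \<Longrightarrow> a s = R" and L: "\<And>s. s \<in> J' \<Longrightarrow> s < t \<Longrightarrow> a s = L"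
    proof (cases "\<exists>s\<in>J'. t < s")
      case True
      then obtain s1 where s1: "s1 \<in> J'" "t < s1" by blast
      show ?thesis
      proof (cases "\<exists>s\<in>J'. s < t")
        case True
        then obtain s2 where "s2 \<in> J'" "s2 < t" by blast
        then show ?thesis using that[of "a s2" "a s1"] s1 same opp by blast
      next
        case False
        then show ?thesis using that[of "linv (a s1)" "a s1"] s1 same linv_neq by blast
      qed
    next
      case no_right: False
      show ?thesis
      proof (cases "\<exists>s\<in>J'. s < t")
        case True
        then obtain s2 where "s2 \<in> J'" "s2 < t" by blast
        then show ?thesis using that[of "a s2" "linv (a s2)"] no_right same linv_neq by blast
      next
        case False
        then show ?thesis using that[of "linv l" l] no_right linv_neq by blast
      qed
    qed
    \<comment> \<open>Arriving on the ray \<open>L\<close> means traversing \<open>linv L\<close>;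
      constant continuation in both directions keeps the word reduced.\<close>
    define W where "W k = (if 0 \<le> k then R else linv L)" for k :: int
    have "red W"
      unfolding red_def
    proof
      fix k :: int
      consider "0 \<le> k" | "k = -1" | "k < -1" by linarith
      then show "W (k + 1) \<noteq> linv (W k)" using LR by cases (auto simp: W_def)
    qed
    moreover have "\<gamma> s = geo W (s - t)" if s: "s \<in> J" "\<bar>s - t\<bar> \<le> 1/8" for s
    proof -
      have sJ: "s \<in> J'" using s by (simp add: J'_def)
      consider "t < s" | "s = t" | "s < t" by linarith
      then show ?thesis
      proof cases
        case 1
        then have "geo W (s - t) = pt R (s - t)" using geo_on[of 0 "s - t" W] s by (simp add: W_def)
        then show ?thesis using a[OF sJ] R[OF sJ 1] 1 by simp
      next
        case 2
        then show ?thesis using \<sigma> True pt_0[of l] by (simp add: geo_def)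
      next
        case 3
        then have "geo W (s - t) = pt (linv L) (s - t + 1)" using geo_on[of "-1" "s - t" W] s by (simp add: W_def)
        then show ?thesis using a[OF sJ] L[OF sJ 3] 3 by (simp add: pt_linv)
      qed
    qed
    ultimately show ?thesis by (intro exI[of _ "1/8"]) auto
  next
    case False
    then have \<sigma>0: "0 < \<sigma>" using \<sigma> by simp
    define \<delta> where "\<delta> = min (\<sigma> / 2) (1/8)"
    have \<delta>: "0 < \<delta>" "\<delta> < \<sigma>" "\<delta> \<le> 1/8" using \<sigma>0 by (auto simp: \<delta>_def)
    define J' where "J' = {s\<in>J. \<bar>s - t\<bar> \<le> \<delta>}"
    have J: "s \<in> J" "\<bar>s - t\<bar> \<le> \<delta>" if "s \<in> J'" for s using that by (auto simp: J'_def)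
    have "\<exists>e. e \<in> {1, -1} \<and> \<gamma> s = pt l (\<sigma> + e * (s - t))" if sJ: "s \<in> J'" for s
    proof -
      have dd: "mdist rose (pt l \<sigma>) (\<gamma> s) = \<bar>s - t\<bar>"
        using d[OF t J(1)[OF sJ]] \<sigma> by (simp add: abs_minus_commute)
      have "mdist rose (pt l \<sigma>) (\<gamma> s) < \<sigma>" using dd J(2)[OF sJ] \<delta> by linarith
      then obtain e where e: "e \<in> {1, -1}" "\<gamma> s = pt l (\<sigma> + e * \<bar>s - t\<bar>)"
        using rose_edge_ball[OF \<sigma>0 \<sigma>(2) mem[OF J(1)[OF sJ]]] dd by metis
      show ?thesis
      proof (cases "t \<le> s")
        case True then show ?thesis using e by (intro exI[of _ e]) simp
      next
        case False then show ?thesis using e by (intro exI[of _ "- e"]) (auto simp: algebra_simps)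
      qed
    qed
    then obtain e where e: "\<And>s. s \<in> J' \<Longrightarrow> e s \<in> {1, -1} \<and> \<gamma> s = pt l (\<sigma> + e s * (s - t))" by metis
    \<comment> \<open>Opposite signs at \<open>s\<close> and \<open>s1\<close> would fold the
      interval, which an isometry does not allow unless \<open>s = t\<close>, where the sign is
      irrelevant.\<close>
    have "\<exists>f. f \<in> {1, -1} \<and> (\<forall>s\<in>J'. \<gamma> s = pt l (\<sigma> + f * (s - t)))"
    proof (cases "\<exists>s\<in>J'. s \<noteq> t")
      case True
      then obtain s1 where s1: "s1 \<in> J'" "s1 \<noteq> t" by blast
      have "\<gamma> s = pt l (\<sigma> + e s1 * (s - t))" if s: "s \<in> J'" for s
      proof (cases "e s = e s1")
        case True then show ?thesis using e[OF s] by simp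
      next
        case False
        have b: "\<bar>e u * (u - t)\<bar> \<le> \<delta>" if "u \<in> J'" for u using e[OF that] J(2)[OF that] by auto
        have "mdist rose (pt l (\<sigma> + e s * (s - t))) (pt l (\<sigma> + e s1 * (s1 - t))) =
            \<bar>(\<sigma> + e s * (s - t)) - (\<sigma> + e s1 * (s1 - t))\<bar>"
          using b[OF s] b[OF s1(1)] \<delta> \<sigma> by (intro dist_pt_near; linarith)
        then have "\<bar>s - s1\<bar> = \<bar>e s * (s - t) - e s1 * (s1 - t)\<bar>"
          using d[OF J(1)[OF s] J(1)[OF s1(1)]] e[OF s] e[OF s1(1)] by simp
        moreover have "e s = 1 \<and> e s1 = -1 \<or> e s = -1 \<and> e s1 = 1" using False e[OF s] e[OF s1(1)] by auto
        ultimately have "s = t" using s1(2) by (elim disjE) (auto simp: abs_if split: if_splits)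
        then show ?thesis using e[OF s] by simp
      qed
      then show ?thesis using e[OF s1(1)] by blast
    next
      case False
      then show ?thesis using \<sigma> by (intro exI[of _ 1]) auto
    qed
    then obtain f where f: "f \<in> {1, -1}" "\<And>s. s \<in> J' \<Longrightarrow> \<gamma> s = pt l (\<sigma> + f * (s - t))" by blast
    have rc: "red (\<lambda>_. m)" for m by (simp add: red_def)
    show ?thesis
    proof (cases "f = 1")
      case True
      have "\<gamma> s = geo (\<lambda>_. l) (s - (t - \<sigma>))" if "s \<in> J" "\<bar>s - t\<bar> \<le> \<delta>" for s
      proof -
        have "0 \<le> s - (t - \<sigma>)" "s - (t - \<sigma>) \<le> 1" using that \<delta> \<sigma> by linarith+
        then show ?thesis using geo_on[of 0 "s - (t - \<sigma>)" "\<lambda>_. l"] f(2)[of s] True that by (simp add: J'_def algebra_simps)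
      qed
      then show ?thesis using rc \<delta>(1) by blast
    next
      case False
      \<comment> \<open>Decreasing parameters mean running along the inverse letter, on which
        \<open>\<gamma> t\<close> has the parameter \<open>1 - \<sigma>\<close>.\<close>
      have "\<gamma> s = geo (\<lambda>_. linv l) (s - (t - (1 - \<sigma>)))" if "s \<in> J" "\<bar>s - t\<bar> \<le> \<delta>" for s
      proof -
        have "0 \<le> s - (t - (1 - \<sigma>))" "s - (t - (1 - \<sigma>)) \<le> 1" using that \<delta> \<sigma> by linarith+
        then show ?thesis using geo_on[of 0 "s - (t - (1 - \<sigma>))" "\<lambda>_. linv l"] f False that
          by (simp add: J'_def pt_linv algebra_simps)
      qed
      then show ?thesis using rc \<delta>(1) by blast
    qed
  qed
qed

section \<open>Uniqueness of words and phases\<close>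

lemma pt_inj:
  assumes "0 < x" "x < 1" "0 < y" "y < 1" and eq: "pt l x = pt l' y"
  shows "l' = l \<and> y = x \<or> l' = linv l \<and> y = 1 - x"
proof -
  have 0: "mdist rose (pt l x) (pt l' y) = 0" using eq pt_in[of y l'] assms by simp
  consider "l' = l" | "l' = linv l" | "fst l' \<noteq> fst l" using letter_cases by blast
  then show ?thesis
  proof cases
    case 1
    then show ?thesis using 0 dist_pt_same[of x y l] assms circ_eq_0[of x y] by simp
  next
    case 2
    then show ?thesis using 0 dist_pt_same[of x "1 - y" l] assms circ_eq_0[of x "1 - y"] by (simp add: pt_linv)
  next
    case 3
    then show ?thesis using 0 dist_pt_other[of x y l l'] assms by (auto simp: hgt_def min_def split: if_splits)
  qed
qed

text \<open>One point inside an edge determines the letter up to inversion; a second point on the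
  same edge fixes the direction and with it the letter and the phase.\<close>

lemma geo_unique:
  fixes k k' :: int
  assumes "s1 < s2" and k: "of_int k < s1 - \<tau>" "s2 - \<tau> < of_int k + 1"
    and k': "of_int k' < s1 - \<tau>'" "s2 - \<tau>' < of_int k' + 1"
    and eq: "geo W (s1 - \<tau>) = geo W' (s1 - \<tau>')" "geo W (s2 - \<tau>) = geo W' (s2 - \<tau>')"
  shows "\<tau> + of_int k = \<tau>' + of_int k' \<and> W k = W' k'"
proof -
  have "geo W (s - \<tau>) = pt (W k) (s - \<tau> - of_int k)" "geo W' (s - \<tau>') = pt (W' k') (s - \<tau>' - of_int k')"
    if "s \<in> {s1, s2}" for s
    using that assms(1-5) by (auto intro!: geo_on)
  then have "pt (W k) (s - \<tau> - of_int k) = pt (W' k') (s - \<tau>' - of_int k')" if "s \<in> {s1, s2}" for s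
    using that eq by auto
  then have "W' k' = W k \<and> s - \<tau>' - of_int k' = s - \<tau> - of_int k \<or>
      W' k' = linv (W k) \<and> s - \<tau>' - of_int k' = 1 - (s - \<tau> - of_int k)" if "s \<in> {s1, s2}" for s
    using that assms(1-5) by (intro pt_inj) auto
  from this[of s1] this[of s2] show ?thesis using assms(1) linv_neq[of "W k"] by auto
qed

text \<open>The interval begins with a piece that stays on one edge for both curves, and two
  interior points of this piece suffice.\<close>

lemma geo_phase:
  assumes cd: "c < d" and eq: "\<And>s. s \<in> {c..d} \<Longrightarrow> geo W (s - \<tau>) = geo W' (s - \<tau>')"
  shows "frac \<tau> = frac \<tau>'"
proof -
  define k k' where "k = \<lfloor>c - \<tau>\<rfloor>" and "k' = \<lfloor>c - \<tau>'\<rfloor>"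
  have k: "of_int k \<le> c - \<tau>" "c - \<tau> < of_int k + 1" "of_int k' \<le> c - \<tau>'" "c - \<tau>' < of_int k' + 1"
    by (auto simp: k_def k'_def)
  define u where "u = min d (min (\<tau> + of_int k + 1) (\<tau>' + of_int k' + 1))"
  have u: "c < u" "u \<le> d" "u \<le> \<tau> + of_int k + 1" "u \<le> \<tau>' + of_int k' + 1" using k cd by (auto simp: u_def)
  define s1 s2 where "s1 = (2 * c + u) / 3" and "s2 = (c + 2 * u) / 3"
  have s: "c < s1" "s1 < s2" "s2 < u" using u(1) by (auto simp: s1_def s2_def field_simps)
  have "\<tau> + of_int k = \<tau>' + of_int k' \<and> W k = W' k'"
    by (rule geo_unique[of s1 s2]) (use s u k eq in auto)
  then have "\<tau> = \<tau>' + of_int (k' - k)" by simp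
  then show ?thesis by (simp add: frac_def)
qed

text \<open>Outside of the index interval the letter of the nearest index is repeated. A repetition
  never violates reducedness, because no letter is its own inverse.\<close>

lemma extend_red:
  fixes S :: "int set" and W :: "int \<Rightarrow> letter"
  assumes ne: "S \<noteq> {}" and conv: "\<And>i j k. i \<in> S \<Longrightarrow> k \<in> S \<Longrightarrow> i \<le> j \<Longrightarrow> j \<le> k \<Longrightarrow> j \<in> S"
    and W: "\<And>k. k \<in> S \<Longrightarrow> k + 1 \<in> S \<Longrightarrow> W (k + 1) \<noteq> linv (W k)"
  obtains W' where "red W'" "\<And>k. k \<in> S \<Longrightarrow> W' k = W k"
proof -
  define up where "up k = k + int (LEAST n. k + int n \<in> S)" for k
  define dn where "dn k = k - int (LEAST n. k - int n \<in> S)" for k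
  define near where "near k = (if \<exists>n. k + int n \<in> S then up k else dn k)" for k
  have near_in: "near k = k" if "k \<in> S" for k
  proof -
    have "(LEAST n. k + int n \<in> S) = 0" using that by (intro Least_eq_0) simp
    moreover have "\<exists>n. k + int n \<in> S" using that by (intro exI[of _ 0]) simp
    ultimately show ?thesis by (simp add: near_def up_def)
  qed
  have step: "near (k + 1) = near k \<or> k \<in> S \<and> k + 1 \<in> S" for k
  proof (cases "k \<in> S")
    case True
    show ?thesis
    proof (cases "k + 1 \<in> S")
      case False
      have "\<not> (\<exists>n. k + 1 + int n \<in> S)" using conv[OF True, of _ "k + 1"] False by fastforce
      moreover have "(LEAST n. k + 1 - int n \<in> S) = 1"
      proof (rule Least_equality)
        show "1 \<le> n" if "k + 1 - int n \<in> S" for n using that False by (cases n) auto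
      qed (use True in simp)
      ultimately show ?thesis using near_in[OF True] by (simp add: near_def dn_def)
    qed (use True in simp)
  next
    case False
    show ?thesis
    proof (cases "\<exists>n. k + int n \<in> S")
      case True
      then obtain n where n: "k + int n \<in> S" by blast
      have "(LEAST n. k + int n \<in> S) = Suc (LEAST n. k + int (Suc n) \<in> S)"
        using n False by (intro Least_Suc) auto
      moreover have "\<exists>n. k + 1 + int n \<in> S"
        using n False by (intro exI[of _ "n - 1"]) (cases n; auto simp: algebra_simps)
      ultimately show ?thesis using True by (simp add: near_def up_def algebra_simps)
    next
      case no_up: False
      obtain j where j: "j \<in> S" using ne by blast
      have "\<not> k \<le> j" using no_up j by (metis zle_iff_zadd)
      then have kj: "k - int (nat (k - j)) \<in> S" using j by simp
      have no_up': "\<not> (\<exists>n. k + 1 + int n \<in> S)"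
      proof
        assume "\<exists>n. k + 1 + int n \<in> S"
        then obtain n where "k + 1 + int n \<in> S" by blast
        then have "k + int (Suc n) \<in> S" by (simp add: algebra_simps)
        then show False using no_up by blast
      qed
      have "(LEAST n. k + 1 - int n \<in> S) = Suc (LEAST n. k + 1 - int (Suc n) \<in> S)"
      proof (rule Least_Suc)
        show "k + 1 - int (Suc (nat (k - j))) \<in> S" using kj by simp
        show "\<not> k + 1 - int 0 \<in> S" using no_up' by (metis add.right_neutral diff_zero of_nat_0)
      qed
      then show ?thesis using no_up no_up' by (simp add: near_def dn_def)
    qed
  qed
  have "red (\<lambda>k. W (near k))"
    unfolding red_def
  proof
    fix k
    show "W (near (k + 1)) \<noteq> linv (W (near k))"
      using step[of k] near_in[of k] near_in[of "k + 1"] W[of k] linv_neq[of "W (near k)"] by auto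
  qed
  then show ?thesis by (rule that) (simp add: near_in)
qed

text \<open>The curves may agree on one side of \<open>x\<close> only. The sign \<open>e\<close>
  names that side, and a second point at distance \<open>g\<close> on it remains on the edge
  \<open>k\<close>.\<close>

lemma geo_overlap_letter:
  fixes k :: int
  assumes x: "\<tau> + of_int k < x" "x < \<tau> + of_int k + 1" and h: "0 < h"
    and e: "e \<in> {1, -1}"
    and eq: "\<And>s. s \<in> {min x (x + e * h)..max x (x + e * h)} \<Longrightarrow> geo W (s - \<tau>) = geo W' (s - \<tau>)"
  shows "W k = W' k"
proof -
  define g where "g = min h (min (x - (\<tau> + of_int k)) (\<tau> + of_int k + 1 - x)) / 2"
  have g: "0 < g" "2 * g \<le> h" "2 * g \<le> x - (\<tau> + of_int k)" "2 * g \<le> \<tau> + of_int k + 1 - x"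
    using x h by (auto simp: g_def)
  show ?thesis
  proof (cases "e = 1")
    case True
    have "geo W (x - \<tau>) = geo W' (x - \<tau>)" "geo W (x + g - \<tau>) = geo W' (x + g - \<tau>)"
      using eq[of x] eq[of "x + g"] True h g by auto
    then show ?thesis using geo_unique[of x "x + g" k \<tau> k \<tau> W W'] x g by auto
  next
    case False
    then have "e = -1" using e by simp
    then have "geo W (x - \<tau>) = geo W' (x - \<tau>)" "geo W (x - g - \<tau>) = geo W' (x - g - \<tau>)"
      using eq[of x] eq[of "x - g"] h g by auto
    then show ?thesis using geo_unique[of "x - g" x k \<tau> k \<tau> W W'] x g by auto
  qed
qed

text \<open>The local models are glued: the phase of the model, and for each edge its letter, are
  locally constant in time, hence constant on connected sets. The edges that are met have an
  interval of indices, whose word is extended to both sides.\<close>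

proposition local_geodesic_model:
  assumes I: "is_interval I" "I \<noteq> {}" and \<gamma>: "local_geodesic_on rose I \<gamma>"
  obtains W \<tau> where "red W" "\<And>t. t \<in> I \<Longrightarrow> \<gamma> t = geo W (t - \<tau>)"
proof -
  have between: "s \<in> I" if "a \<in> I" "b \<in> I" "a \<le> s" "s \<le> b" for a b s
    using I(1) that unfolding is_interval_1 by blast
  have ex: "\<exists>\<delta>>0. \<exists>W \<tau>. red W \<and> (\<forall>s\<in>I. \<bar>s - t\<bar> \<le> \<delta> \<longrightarrow> \<gamma> s = geo W (s - \<tau>))" if t: "t \<in> I" for t
  proof -
    obtain \<epsilon> where \<epsilon>: "\<epsilon> > 0" "isometric_on rose ({t - \<epsilon>..t + \<epsilon>} \<inter> I) \<gamma>"
      using \<gamma> t unfolding local_geodesic_on_def by blast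
    obtain \<delta> W \<tau> where \<delta>: "\<delta> > 0" "red W" "\<forall>s\<in>{t - \<epsilon>..t + \<epsilon>} \<inter> I. \<bar>s - t\<bar> \<le> \<delta> \<longrightarrow> \<gamma> s = geo W (s - \<tau>)"
      using local_model[OF \<epsilon>(2), of t] t \<epsilon>(1) by auto
    have "\<gamma> s = geo W (s - \<tau>)" if "s \<in> I" "\<bar>s - t\<bar> \<le> min \<delta> \<epsilon>" for s
      using \<delta>(3) that by (auto simp: abs_le_iff)
    then show ?thesis using \<delta>(1,2) \<epsilon>(1) by (intro exI[of _ "min \<delta> \<epsilon>"]) auto
  qed
  then obtain D V T where DVT: "\<And>t. t \<in> I \<Longrightarrow> 0 < D t \<and> red (V t) \<and> (\<forall>s\<in>I. \<bar>s - t\<bar> \<le> D t \<longrightarrow> \<gamma> s = geo (V t) (s - T t))"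
    by metis
  obtain t0 where t0: "t0 \<in> I" using I(2) by blast
  show ?thesis
  proof (cases "I = {t0}")
    case True
    then show ?thesis using DVT[OF t0] that by auto
  next
    case False
    have conn: "connected I" using I(1) by (simp add: is_interval_connected)
    \<comment> \<open>The models at \<open>t\<close> and at a nearby \<open>x\<close> both describe
      the curve on an interval of length \<open>h\<close> between the two, which determines the
      phase.\<close>
    have phase: "frac (T a) = frac (T b)" if "a \<in> I" "b \<in> I" for a b
    proof (rule connected_local_const[OF conn that], intro ballI)
      fix t assume t: "t \<in> I"
      have "frac (T t) = frac (T x)" if x: "x \<in> I" "x \<noteq> t" "\<bar>x - t\<bar> < D t" for x
      proof -
        define h where "h = min (D x) \<bar>x - t\<bar>"
        have h: "0 < h" "h \<le> D x" "h \<le> \<bar>x - t\<bar>" using DVT[OF x(1)] x by (auto simp: h_def)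
        define c d where "c = (if x < t then x else x - h)" and "d = (if x < t then x + h else x)"
        have "geo (V t) (s - T t) = geo (V x) (s - T x)" if "s \<in> {c..d}" for s
        proof -
          have "s \<in> I" "\<bar>s - t\<bar> \<le> D t" "\<bar>s - x\<bar> \<le> D x"
            using that h x between[OF x(1) t, of s] between[OF t x(1), of s]
            by (auto simp: c_def d_def abs_if split: if_splits)
          then show ?thesis using DVT[OF t] DVT[OF x(1)] by metis
        qed
        moreover have "c < d" using h by (simp add: c_def d_def)
        ultimately show ?thesis using geo_phase by blast
      qed
      then show "\<forall>\<^sub>F x in at t within I. frac (T t) = frac (T x)"
        unfolding eventually_at using DVT[OF t] by (intro exI[of _ "D t"]) (auto simp: dist_real_def)
    qed
    define \<tau> where "\<tau> = T t0"
    \<comment> \<open>The phases agree modulo 1, so an integer shift of each word makes the phase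
      \<tau> common to all models.\<close>
    have "\<exists>W. red W \<and> (\<forall>s\<in>I. \<bar>s - t\<bar> \<le> D t \<longrightarrow> \<gamma> s = geo W (s - \<tau>))" if t: "t \<in> I" for t
    proof -
      have "frac (T t) = frac \<tau>" unfolding \<tau>_def by (rule phase[OF t t0])
      then have "T t = \<tau> + of_int (\<lfloor>T t\<rfloor> - \<lfloor>\<tau>\<rfloor>)" by (simp add: frac_def)
      then obtain m where m: "T t = \<tau> + of_int m" by blast
      have "geo (V t) (s - T t) = geo (\<lambda>k. V t (k + - m)) (s - \<tau>)" for s
        using geo_shift[of "V t" "s - \<tau>" "- m"] by (simp add: m diff_diff_eq)
      moreover have "red (\<lambda>k. V t (k + - m))" using DVT[OF t] red_shift by blast
      ultimately show ?thesis using DVT[OF t] by metis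
    qed
    then obtain U where U: "\<And>t. t \<in> I \<Longrightarrow> red (U t) \<and> (\<forall>s\<in>I. \<bar>s - t\<bar> \<le> D t \<longrightarrow> \<gamma> s = geo (U t) (s - \<tau>))"
      by metis
    \<comment> \<open>These are the times spent inside the open edge \<open>k\<close>. The vertex
      lies on all petals, so letters are read off inside edges only.\<close>
    define Ik where "Ik k = I \<inter> {\<tau> + of_int k<..<\<tau> + of_int k + 1}" for k :: int
    have E: "U t k = U x k" if t: "t \<in> I" and x: "x \<in> Ik k" "\<bar>x - t\<bar> < D t" for t x k
    proof (cases "x = t")
      case False
      have xI: "x \<in> I" using x by (simp add: Ik_def)
      define h where "h = min (D x) \<bar>x - t\<bar>"
      have h: "0 < h" "h \<le> D x" "h \<le> \<bar>x - t\<bar>" using DVT[OF xI] False by (auto simp: h_def)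
      define e where "e = (if x < t then 1 else -1 :: real)"
      show ?thesis
      proof (rule geo_overlap_letter[of \<tau> k x h e])
        fix s assume s: "s \<in> {min x (x + e * h)..max x (x + e * h)}"
        have "s \<in> I" "\<bar>s - t\<bar> \<le> D t" "\<bar>s - x\<bar> \<le> D x"
          using s h x between[OF xI t, of s] between[OF t xI, of s]
          by (auto simp: e_def abs_if split: if_splits)
        then show "geo (U t) (s - \<tau>) = geo (U x) (s - \<tau>)" using U[OF t] U[OF xI] by metis
      qed (use x h in \<open>auto simp: Ik_def e_def\<close>)
    qed simp
    have const: "U a k = U b k" if "a \<in> Ik k" "b \<in> Ik k" for a b k
    proof (rule connected_local_const[where f = "\<lambda>t. U t k", OF _ that])
      have "is_interval (Ik k)" unfolding Ik_def using I(1) by (intro is_interval_Int) auto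
      then show "connected (Ik k)" by (rule is_interval_connected)
      show "\<forall>t\<in>Ik k. \<forall>\<^sub>F x in at t within Ik k. U t k = U x k"
      proof
        fix t assume t: "t \<in> Ik k"
        then have "t \<in> I" by (simp add: Ik_def)
        then show "\<forall>\<^sub>F x in at t within Ik k. U t k = U x k"
          unfolding eventually_at using DVT E[of t _ k] by (intro exI[of _ "D t"]) (auto simp: dist_real_def)
      qed
    qed
    define S where "S = {k. Ik k \<noteq> {}}"
    define W where "W k = U (SOME t. t \<in> Ik k) k" for k
    have W: "U t k = W k" if "t \<in> Ik k" for t k
      unfolding W_def by (rule const[OF that]) (use that in \<open>rule someI\<close>)
    have "S \<noteq> {}"
    proof -
      obtain t1 where t1: "t1 \<in> I" "t1 \<noteq> t0" using False t0 by blast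
      define a b where "a = min t0 t1" and "b = max t0 t1"
      have ab: "a < b" "a \<in> I" "b \<in> I" using t0 t1 by (auto simp: a_def b_def min_def max_def)
      define k where "k = \<lfloor>a - \<tau>\<rfloor>"
      define x where "x = (a + min b (\<tau> + of_int k + 1)) / 2"
      have "of_int k \<le> a - \<tau>" "a - \<tau> < of_int k + 1" by (auto simp: k_def)
      then have "x \<in> Ik k" using between[OF ab(2,3), of x] ab(1) by (auto simp: x_def Ik_def)
      then show ?thesis by (auto simp: S_def)
    qed
    moreover have "j \<in> S" if ik: "i \<in> S" "k \<in> S" and "i \<le> j" "j \<le> k" for i j k
    proof (cases "i = j \<or> j = k")
      case False
      then have "i + 1 \<le> j" "j + 1 \<le> k" using that by auto
      then have *: "real_of_int i + 1 \<le> of_int j" "real_of_int j + 1 \<le> of_int k" by linarith+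
      obtain a b where ab: "a \<in> Ik i" "b \<in> Ik k" using ik by (auto simp: S_def)
      have "\<tau> + of_int j + 1/2 \<in> I"
        by (rule between[of a b]) (use ab * in \<open>auto simp: Ik_def\<close>)
      then have "\<tau> + of_int j + 1/2 \<in> Ik j" by (simp add: Ik_def)
      then show ?thesis unfolding S_def by blast
    qed (use that in auto)
    \<comment> \<open>Two consecutive edges that are met have their common vertex at a time
      \<open>t\<close> of the interval. The model at \<open>t\<close> sees both letters, and its
      word is reduced.\<close>
    moreover have "W (k + 1) \<noteq> linv (W k)" if kS: "k \<in> S" "k + 1 \<in> S" for k
    proof -
      obtain a b where ab: "a \<in> Ik k" "b \<in> Ik (k + 1)" using kS by (auto simp: S_def)
      define t where "t = \<tau> + of_int k + 1"
      have t: "t \<in> I" by (rule between[of a b]) (use ab in \<open>auto simp: Ik_def t_def\<close>)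
      have D: "0 < D t" using DVT[OF t] by simp
      have "max a (t - D t / 2) \<in> Ik k" "\<bar>max a (t - D t / 2) - t\<bar> < D t"
        using ab t D between[of a t "max a (t - D t / 2)"] by (auto simp: Ik_def t_def abs_if max_def)
      then have l: "U t k = W k" using E[OF t] W by metis
      have "min b (t + D t / 2) \<in> Ik (k + 1)" "\<bar>min b (t + D t / 2) - t\<bar> < D t"
        using ab t D between[of t b "min b (t + D t / 2)"] by (auto simp: Ik_def t_def abs_if min_def)
      then have r: "U t (k + 1) = W (k + 1)" using E[OF t] W by metis
      show ?thesis using U[OF t] l r unfolding red_def by metis
    qed
    ultimately obtain W' where W': "red W'" "\<And>k. k \<in> S \<Longrightarrow> W' k = W k"
      using extend_red[of S W] by metis
    have "\<gamma> t = geo W' (t - \<tau>)" if t: "t \<in> I" for t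
    proof -
      define k where "k = \<lfloor>t - \<tau>\<rfloor>"
      have k: "of_int k \<le> t - \<tau>" "t - \<tau> < of_int k + 1" by (auto simp: k_def)
      have g: "\<gamma> t = geo (U t) (t - \<tau>)" using U[OF t] DVT[OF t] t by auto
      show ?thesis
      proof (cases "t - \<tau> = of_int k")
        case True
        then show ?thesis using g pt_0 by (simp add: geo_def)
      next
        case False
        then have "t \<in> Ik k" using k t by (auto simp: Ik_def)
        then have "W' k = U t k" using W W'(2) by (auto simp: S_def)
        then show ?thesis using g by (simp add: geo_def k_def)
      qed
    qed
    with W'(1) show ?thesis by (rule that)
  qed
qed

lemma Loc_Geod_rose_cases:
  assumes "\<gamma> \<in> Loc_Geod rose"
  obtains W \<tau> where "red W" "0 \<le> \<tau>" "\<tau> < 1" "\<gamma> = (\<lambda>t. geo W (t - \<tau>))"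
proof -
  obtain W \<tau> where W: "red W" "\<And>t. \<gamma> t = geo W (t - \<tau>)"
    using local_geodesic_model[of UNIV \<gamma>] assms by (auto simp: Loc_Geod_def)
  have "geo W (t - \<tau>) = geo (\<lambda>k. W (k + - \<lfloor>\<tau>\<rfloor>)) (t - frac \<tau>)" for t
    using geo_shift[of W "t - frac \<tau>" "- \<lfloor>\<tau>\<rfloor>"] by (simp add: frac_def)
  then have "\<gamma> = (\<lambda>t. geo (\<lambda>k. W (k + - \<lfloor>\<tau>\<rfloor>)) (t - frac \<tau>))"
    using W(2) by auto
  with red_shift[OF W(1)] frac_bounds(1,3) show ?thesis by (rule that)
qed

text \<open>The model of a local geodesic is defined for all times and is the extension.\<close>

lemma locally_geodesically_complete_rose: "locally_geodesically_complete rose"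
  unfolding locally_geodesically_complete_def
proof (intro allI impI; elim conjE)
  fix I \<gamma> assume "is_interval I" "I \<noteq> {}" "local_geodesic_on rose I \<gamma>"
  then obtain W \<tau> where "red W" "\<And>t. t \<in> I \<Longrightarrow> \<gamma> t = geo W (t - \<tau>)"
    by (rule local_geodesic_model[of I \<gamma>]) (rule that)
  then show "\<exists>\<gamma>'\<in>Loc_Geod rose. \<forall>t\<in>I. \<gamma>' t = \<gamma> t"
    by (intro bexI[of _ "\<lambda>t. geo W (t - \<tau>)"] geo_Loc_Geod) auto
qed

section \<open>Projecting the lines\<close>

lemma openin_ucc_nhd:
  assumes "openin (ucc_topology X S) U" "\<gamma> \<in> U"
  obtains K \<epsilon> where "compact K" "\<epsilon> > 0" "{\<gamma>'\<in>S. \<forall>t\<in>K. mdist X (\<gamma> t) (\<gamma>' t) < \<epsilon>} \<subseteq> U"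
  using assms[unfolded openin_ucc_topology] by meson

text \<open>Both topologies come from \<open>sup_dist\<close>, so the claim is one about subspaces
  of a metric space.\<close>

lemma subtopology_ucc:
  assumes S: "\<And>\<gamma> t. \<gamma> \<in> S \<Longrightarrow> \<gamma> t \<in> mspace Q" and "S' \<subseteq> S"
  shows "subtopology (ucc_topology Q S) S' = ucc_topology Q S'"
proof -
  have 1: "Metric_space S (sup_dist Q)" using S by (rule Metric_space_sup_dist)
  have sub: "Submetric S (sup_dist Q) S'" by (intro Submetric.intro 1 Submetric_axioms.intro assms)
  have 2: "Metric_space.mtopology S' (sup_dist Q) = ucc_topology Q S'"
    using S assms(2) by (intro mtopology_sup_dist) auto
  have 3: "Metric_space.mtopology S (sup_dist Q) = ucc_topology Q S"
    using S by (rule mtopology_sup_dist)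
  show ?thesis using Submetric.mtopology_submetric[OF sub] 2 3 by simp
qed

lemma Loc_Geod_in: "\<gamma> \<in> Loc_Geod Q \<Longrightarrow> \<gamma> t \<in> mspace Q"
proof -
  assume "\<gamma> \<in> Loc_Geod Q"
  then obtain \<epsilon> where "\<epsilon> > 0" "isometric_on Q {t - \<epsilon>..t + \<epsilon>} \<gamma>"
    unfolding Loc_Geod_def local_geodesic_on_def by auto
  then show ?thesis unfolding isometric_on_def by auto
qed

lemma Geod_in: "\<gamma> \<in> Geod Q \<Longrightarrow> \<gamma> t \<in> mspace Q"
  by (auto simp: Geod_def isometric_on_def)

abbreviation proj :: "(real \<Rightarrow> real) \<Rightarrow> real \<Rightarrow> real set" where
  "proj \<gamma> \<equiv> (\<lambda>t. orbit_of shifts (\<gamma> t))"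

abbreviation line_orbit :: "(real \<Rightarrow> real) \<Rightarrow> (real \<Rightarrow> real) set" where
  "line_orbit \<gamma> \<equiv> orbit_of (line_action shifts) \<gamma>"

lemma line_orbit: "line_orbit \<gamma> = range (\<lambda>k. shift k \<circ> \<gamma>)"
  by (auto simp: orbit_of_def line_action_def shifts_def)

lemma line_orbit_shift:
  assumes "\<gamma> \<in> Geod LX"
  shows "line_orbit (shift m \<circ> \<gamma>) = line_orbit \<gamma>"
proof -
  have eq: "shift k \<circ> (shift m \<circ> \<gamma>) = shift (k + m) \<circ> \<gamma>" for k
    using Geod_in[OF assms] by (auto simp: shift_add)
  have "range (\<lambda>k. shift (k + m) \<circ> \<gamma>) = range (\<lambda>k. shift k \<circ> \<gamma>)"
  proof -
    have "shift k \<circ> \<gamma> \<in> range (\<lambda>k. shift (k + m) \<circ> \<gamma>)" for k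
      using rangeI[of "\<lambda>k. shift (k + m) \<circ> \<gamma>" "k - m"] by simp
    then show ?thesis by auto
  qed
  then show ?thesis unfolding line_orbit eq .
qed

lemma project_line_orbit:
  assumes "\<gamma> \<in> Geod LX"
  shows "project_line shifts (line_orbit \<gamma>) = proj \<gamma>"
proof -
  have "(SOME \<gamma>'. \<gamma>' \<in> line_orbit \<gamma>) \<in> line_orbit \<gamma>"
    unfolding some_in_eq by (auto simp: line_orbit)
  then obtain k where k: "(SOME \<gamma>'. \<gamma>' \<in> line_orbit \<gamma>) = shift k \<circ> \<gamma>" by (auto simp: line_orbit)
  show ?thesis
    unfolding project_line_def k using Geod_in[OF assms] by (auto simp: orbit_shift)
qed

lemma circ_frac_near:
  assumes "\<bar>x - y\<bar> \<le> 1/2"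
  shows "circ (frac x) (frac y) = \<bar>x - y\<bar>"
proof -
  define k where "k = \<lfloor>x\<rfloor> - \<lfloor>y\<rfloor>"
  have e: "frac x - frac y = x - y - of_int k" by (simp add: frac_def k_def)
  have "-1 < frac x - frac y" "frac x - frac y < 1" using frac_bounds[of x] frac_bounds[of y] by linarith+
  then have "-2 < real_of_int k" "real_of_int k < 2" using e assms by linarith+
  then have "k = -1 \<or> k = 0 \<or> k = 1" by linarith
  then show ?thesis using e assms \<open>-1 < frac x - frac y\<close> \<open>frac x - frac y < 1\<close>
    by (elim disjE) (auto simp: circ_def min_def abs_if split: if_splits)
qed

lemma dist_proj_line:
  "mdist rose (orbit_of shifts (on_line x)) (orbit_of shifts (on_line y)) = circ (frac x) (frac y)"
  by (simp add: dist_rose_orbit rose_dist_on_line)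

lemma orbit_in_rose: "u \<in> LX_set \<Longrightarrow> orbit_of shifts u \<in> mspace rose"
  by (simp add: mspace_rose)

lemma proj_in_Loc_Geod:
  assumes "\<gamma> \<in> Geod LX"
  shows "proj \<gamma> \<in> Loc_Geod rose"
proof -
  obtain c \<sigma> where \<gamma>: "\<sigma> \<in> {1, -1}" "\<gamma> = (\<lambda>t. on_line (c + \<sigma> * t))" using assms by (rule Geod_LX_cases)
  have "isometric_on rose {t - 1/8..t + 1/8} (proj \<gamma>)" for t
    unfolding isometric_on_def
  proof (intro conjI ballI)
    fix u v assume "u \<in> {t - 1/8..t + 1/8}" "v \<in> {t - 1/8..t + 1/8}"
    then have "\<bar>u - v\<bar> \<le> 1/2" unfolding atLeastAtMost_iff by linarith
    moreover have "\<bar>(c + \<sigma> * u) - (c + \<sigma> * v)\<bar> = \<bar>u - v\<bar>" using \<gamma>(1) by auto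
    ultimately show "mdist rose (proj \<gamma> u) (proj \<gamma> v) = \<bar>u - v\<bar>"
      using circ_frac_near[of "c + \<sigma> * u" "c + \<sigma> * v"] by (simp add: \<gamma>(2) dist_proj_line)
  qed (auto simp: \<gamma>(2) orbit_in_rose)
  then show ?thesis unfolding Loc_Geod_def local_geodesic_on_def
    by (auto intro!: exI[of _ "1/8"])
qed

section \<open>The quotient topology on classes of lines\<close>

lemma topspace_quotient_Geod:
  "topspace (quotient_Geod_top LX shifts) = line_orbit ` Geod LX"
proof -
  have "openin (quotient_Geod_top LX shifts) (line_orbit ` Geod LX)"
    unfolding quotient_Geod_top_def openin_quotient_topology Geod_top_def
  proof
    have "{x \<in> topspace (ucc_topology LX (Geod LX)). line_orbit x \<in> line_orbit ` Geod LX} = Geod LX" by auto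
    then show "openin (ucc_topology LX (Geod LX)) {x \<in> topspace (ucc_topology LX (Geod LX)). line_orbit x \<in> line_orbit ` Geod LX}"
      using openin_topspace[of "ucc_topology LX (Geod LX)"] by simp
  qed (simp add: orbit_space_def)
  moreover have "topspace (quotient_Geod_top LX shifts) \<subseteq> line_orbit ` Geod LX"
  proof -
    have "topspace (quotient_Geod_top LX shifts) \<subseteq> orbit_space (line_action shifts) (topspace (Geod_top LX))"
      using openin_topspace[of "quotient_Geod_top LX shifts"]
      unfolding quotient_Geod_top_def openin_quotient_topology by blast
    then show ?thesis by (simp add: orbit_space_def Geod_top_def)
  qed
  ultimately show ?thesis using openin_subset by fastforce
qed

text \<open>Closeness at the times 0 and 1/4 already rules out opposite directions: the difference
  of the feet would change by 1/2 and could not be within 1/8 of an integer both times. For equal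
  directions the distance to a suitable translate is constant.\<close>

lemma proj_line_separated:
  assumes \<gamma>: "\<gamma> \<in> Geod LX" and \<gamma>': "\<gamma>' \<in> Geod LX" and \<epsilon>: "\<epsilon> \<le> 1/8"
    and close: "mdist rose (proj \<gamma> 0) (proj \<gamma>' 0) < \<epsilon>" "mdist rose (proj \<gamma> (1/4)) (proj \<gamma>' (1/4)) < \<epsilon>"
  obtains k where "\<And>t. LX_dist (\<gamma> t) ((shift k \<circ> \<gamma>') t) = mdist rose (proj \<gamma> 0) (proj \<gamma>' 0)"
proof -
  obtain c \<sigma> where c: "\<sigma> \<in> {1, -1}" "\<gamma> = (\<lambda>t. on_line (c + \<sigma> * t))" using \<gamma> by (rule Geod_LX_cases)
  obtain c' \<sigma>' where c': "\<sigma>' \<in> {1, -1}" "\<gamma>' = (\<lambda>t. on_line (c' + \<sigma>' * t))" using \<gamma>' by (rule Geod_LX_cases)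
  have near: "\<exists>k. \<bar>x - (y + of_int k)\<bar> = circ (frac x) (frac y)" for x y
  proof -
    obtain k where "\<bar>of_int k + frac x - frac y\<bar> = circ (frac x) (frac y)"
      using circ_attained[of "frac x" "frac y"] frac_bounds by auto
    moreover have "x - (y + of_int (\<lfloor>x\<rfloor> - \<lfloor>y\<rfloor> - k)) = of_int k + frac x - frac y" by (simp add: frac_def)
    ultimately show ?thesis by metis
  qed
  obtain k where k: "\<bar>c - (c' + of_int k)\<bar> = circ (frac c) (frac c')" using near by blast
  obtain m where m: "\<bar>(c + \<sigma> / 4) - ((c' + \<sigma>' / 4) + of_int m)\<bar> = circ (frac (c + \<sigma> / 4)) (frac (c' + \<sigma>' / 4))"
    using near by blast
  have 1: "\<bar>c - (c' + of_int k)\<bar> < 1/8" "\<bar>(c + \<sigma> / 4) - ((c' + \<sigma>' / 4) + of_int m)\<bar> < 1/8"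
    using close \<epsilon> unfolding k m by (auto simp: c(2) c'(2) dist_proj_line)
  have "\<sigma> = \<sigma>'"
  proof (rule ccontr)
    assume "\<sigma> \<noteq> \<sigma>'"
    then have "\<sigma> / 4 - \<sigma>' / 4 = 1/2 \<or> \<sigma> / 4 - \<sigma>' / 4 = - (1/2)" using c(1) c'(1) by auto
    then have "1/4 < \<bar>real_of_int m - of_int k\<bar>" "\<bar>real_of_int m - of_int k\<bar> < 3/4" using 1 by linarith+
    then have "m - k = 0" by linarith
    then show False using \<open>1/4 < _\<close> by simp
  qed
  have "LX_dist (\<gamma> t) ((shift k \<circ> \<gamma>') t) = mdist rose (proj \<gamma> 0) (proj \<gamma>' 0)" for t
    using k by (simp add: c(2) c'(2) shift_on_line dist_proj_line \<open>\<sigma> = \<sigma>'\<close> algebra_simps)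
  then show ?thesis by (rule that)
qed

lemma proj_short:
  "u \<in> LX_set \<Longrightarrow> v \<in> LX_set \<Longrightarrow> mdist rose (orbit_of shifts u) (orbit_of shifts v) \<le> LX_dist u v"
  using rose_dist_le by (simp add: dist_rose_orbit)

lemma line_orbit_eq:
  assumes \<gamma>: "\<gamma> \<in> Geod LX" "\<gamma>' \<in> Geod LX" and eq: "proj \<gamma> = proj \<gamma>'"
  shows "line_orbit \<gamma> = line_orbit \<gamma>'"
proof -
  have 0: "mdist rose (proj \<gamma> t) (proj \<gamma>' t) = 0" for t
  proof -
    have "proj \<gamma>' t \<in> mspace rose" using Geod_in[OF \<gamma>(2)] orbit_in_rose by simp
    then show ?thesis unfolding fun_cong[OF eq, of t] by simp
  qed
  obtain k where k: "\<And>t. LX_dist (\<gamma> t) ((shift k \<circ> \<gamma>') t) = mdist rose (proj \<gamma> 0) (proj \<gamma>' 0)"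
    by (rule proj_line_separated[OF \<gamma>, of "1/8"]) (simp_all only: 0, auto)
  have "\<gamma> t = (shift k \<circ> \<gamma>') t" for t
  proof -
    have "mdist LX (\<gamma> t) ((shift k \<circ> \<gamma>') t) = 0" using k 0 by simp
    moreover have "(shift k \<circ> \<gamma>') t \<in> mspace LX" "\<gamma> t \<in> mspace LX"
      using Geod_in[OF \<gamma>(1), of t] Geod_in[OF \<gamma>(2), of t] shift_facts(1) by auto
    ultimately show ?thesis using mdist_zero by metis
  qed
  then have "\<gamma> = shift k \<circ> \<gamma>'" by blast
  then show ?thesis using line_orbit_shift[OF \<gamma>(2), of k] by simp
qed

lemma openin_quotient_Geod:
  assumes "U \<subseteq> line_orbit ` Geod LX"
  shows "openin (quotient_Geod_top LX shifts) U \<longleftrightarrow> openin (ucc_topology LX (Geod LX)) {\<gamma> \<in> Geod LX. line_orbit \<gamma> \<in> U}"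
  using assms unfolding quotient_Geod_top_def openin_quotient_topology Geod_top_def by (simp add: orbit_space_def)

lemma continuous_map_project_line:
  "continuous_map (quotient_Geod_top LX shifts) (ucc_topology rose (proj ` Geod LX)) (project_line shifts)"
  unfolding continuous_map_def
proof (intro conjI allI impI)
  let ?X = "quotient_Geod_top LX shifts"
  show "project_line shifts \<in> topspace ?X \<rightarrow> topspace (ucc_topology rose (proj ` Geod LX))"
    unfolding topspace_quotient_Geod topspace_ucc_topology by (auto simp: project_line_orbit)
  fix U assume U: "openin (ucc_topology rose (proj ` Geod LX)) U"
  have "{A \<in> topspace ?X. project_line shifts A \<in> U} \<subseteq> line_orbit ` Geod LX"
    unfolding topspace_quotient_Geod by blast
  moreover have "{\<gamma> \<in> Geod LX. line_orbit \<gamma> \<in> {A \<in> topspace ?X. project_line shifts A \<in> U}} = {\<gamma> \<in> Geod LX. proj \<gamma> \<in> U}"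
    unfolding topspace_quotient_Geod by (auto simp: project_line_orbit)
  moreover have "openin (ucc_topology LX (Geod LX)) {\<gamma> \<in> Geod LX. proj \<gamma> \<in> U}"
    unfolding openin_ucc_topology
  proof (intro conjI ballI)
    fix \<gamma> assume "\<gamma> \<in> {\<gamma> \<in> Geod LX. proj \<gamma> \<in> U}"
    then have \<gamma>: "\<gamma> \<in> Geod LX" "proj \<gamma> \<in> U" by auto
    obtain K \<epsilon> where K: "compact K" "\<epsilon> > 0"
        "{\<eta> \<in> proj ` Geod LX. \<forall>t\<in>K. mdist rose (proj \<gamma> t) (\<eta> t) < \<epsilon>} \<subseteq> U"
      by (rule openin_ucc_nhd[OF U \<gamma>(2)])
    have "proj \<gamma>' \<in> U" if \<gamma>': "\<gamma>' \<in> Geod LX" "\<forall>t\<in>K. mdist LX (\<gamma> t) (\<gamma>' t) < \<epsilon>" for \<gamma>'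
    proof -
      have "mdist rose (proj \<gamma> t) (proj \<gamma>' t) < \<epsilon>" if "t \<in> K" for t
      proof -
        have "mdist rose (proj \<gamma> t) (proj \<gamma>' t) \<le> LX_dist (\<gamma> t) (\<gamma>' t)"
          using Geod_in[OF \<gamma>(1), of t] Geod_in[OF \<gamma>'(1), of t] by (intro proj_short) auto
        also have "\<dots> < \<epsilon>" using \<gamma>'(2) that by simp
        finally show ?thesis .
      qed
      then show ?thesis using \<gamma>'(1) by (intro subsetD[OF K(3)]) simp
    qed
    then have "{\<gamma>' \<in> Geod LX. \<forall>t\<in>K. mdist LX (\<gamma> t) (\<gamma>' t) < \<epsilon>} \<subseteq> {\<gamma> \<in> Geod LX. proj \<gamma> \<in> U}" by blast
    then show "\<exists>K \<epsilon>. compact K \<and> 0 < \<epsilon> \<and>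
        {\<gamma>' \<in> Geod LX. \<forall>t\<in>K. mdist LX (\<gamma> t) (\<gamma>' t) < \<epsilon>} \<subseteq> {\<gamma> \<in> Geod LX. proj \<gamma> \<in> U}"
      by (intro exI[of _ K] exI[of _ \<epsilon>] conjI K(1,2))
  qed blast
  ultimately show "openin ?X {A \<in> topspace ?X. project_line shifts A \<in> U}"
    by (simp only: openin_quotient_Geod)
qed

text \<open>A neighbourhood downstairs that tests only the times 0 and 1/4 suffices: up to a
  translation the lines are then close at all times, at the distance seen at time 0.\<close>

lemma open_map_project_line:
  "open_map (quotient_Geod_top LX shifts) (ucc_topology rose (proj ` Geod LX)) (project_line shifts)"
  unfolding open_map_def
proof (intro allI impI)
  fix U assume U: "openin (quotient_Geod_top LX shifts) U"
  have Us: "U \<subseteq> line_orbit ` Geod LX" using openin_subset[OF U] topspace_quotient_Geod by simp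
  have Uo: "openin (ucc_topology LX (Geod LX)) {\<gamma> \<in> Geod LX. line_orbit \<gamma> \<in> U}"
    using U openin_quotient_Geod[OF Us] by simp
  show "openin (ucc_topology rose (proj ` Geod LX)) (project_line shifts ` U)"
    unfolding openin_ucc_topology
  proof (intro conjI ballI)
    show "project_line shifts ` U \<subseteq> proj ` Geod LX" using Us by (auto simp: project_line_orbit)
    fix \<eta> assume "\<eta> \<in> project_line shifts ` U"
    then obtain A where A: "A \<in> U" "\<eta> = project_line shifts A" by blast
    then obtain \<gamma> where "\<gamma> \<in> Geod LX" "A = line_orbit \<gamma>" using Us by blast
    then have \<gamma>: "\<gamma> \<in> Geod LX" "line_orbit \<gamma> \<in> U" "\<eta> = proj \<gamma>" using A by (auto simp: project_line_orbit)
    then have "\<gamma> \<in> {\<gamma> \<in> Geod LX. line_orbit \<gamma> \<in> U}" by blast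
    then obtain K \<epsilon> where K: "compact K" "\<epsilon> > 0"
        "{\<gamma>' \<in> Geod LX. \<forall>t\<in>K. mdist LX (\<gamma> t) (\<gamma>' t) < \<epsilon>} \<subseteq> {\<gamma> \<in> Geod LX. line_orbit \<gamma> \<in> U}"
      by (rule openin_ucc_nhd[OF Uo])
    define e where "e = min \<epsilon> (1/8)"
    have e: "0 < e" "e \<le> \<epsilon>" "e \<le> 1/8" using K(2) by (auto simp: e_def)
    have "\<theta> \<in> project_line shifts ` U"
      if \<theta>: "\<theta> \<in> proj ` Geod LX" "\<forall>t\<in>{0, 1/4}. mdist rose (\<eta> t) (\<theta> t) < e" for \<theta>
    proof -
      obtain \<gamma>' where \<gamma>': "\<gamma>' \<in> Geod LX" "\<theta> = proj \<gamma>'" using \<theta>(1) by blast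
      have cl: "mdist rose (proj \<gamma> 0) (proj \<gamma>' 0) < e" "mdist rose (proj \<gamma> (1/4)) (proj \<gamma>' (1/4)) < e"
        using \<theta>(2) \<gamma>(3) \<gamma>'(2) by auto
      obtain k where k: "\<And>t. LX_dist (\<gamma> t) ((shift k \<circ> \<gamma>') t) = mdist rose (proj \<gamma> 0) (proj \<gamma>' 0)"
        by (rule proj_line_separated[OF \<gamma>(1) \<gamma>'(1) e(3) cl]) (rule that)
      have "shift k \<circ> \<gamma>' \<in> Geod LX"
        using \<gamma>'(1) Geod_in[OF \<gamma>'(1)] by (auto simp: Geod_def isometric_on_def shift_facts dist_shift)
      moreover have "mdist LX (\<gamma> t) ((shift k \<circ> \<gamma>') t) < \<epsilon>" for t
        using k[of t] cl(1) e(2) by simp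
      ultimately have "shift k \<circ> \<gamma>' \<in> {\<gamma> \<in> Geod LX. line_orbit \<gamma> \<in> U}" by (intro subsetD[OF K(3)]) simp
      then have "line_orbit \<gamma>' \<in> U" using line_orbit_shift[OF \<gamma>'(1)] by simp
      then show ?thesis using project_line_orbit[OF \<gamma>'(1)] \<gamma>'(2) by (metis image_eqI)
    qed
    then have "{\<theta> \<in> proj ` Geod LX. \<forall>t\<in>{0, 1/4}. mdist rose (\<eta> t) (\<theta> t) < e} \<subseteq> project_line shifts ` U" by blast
    then show "\<exists>K \<epsilon>. compact K \<and> 0 < \<epsilon> \<and> {\<gamma>' \<in> proj ` Geod LX. \<forall>t\<in>K. mdist rose (\<eta> t) (\<gamma>' t) < \<epsilon>} \<subseteq> project_line shifts ` U"
      using e(1) by (intro exI[of _ "{0, 1/4}"] exI[of _ e]) simp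
  qed
qed

lemma embedding_project_line:
  "embedding_map (quotient_Geod_top LX shifts) (Loc_Geod_top rose) (project_line shifts)"
proof -
  let ?X = "quotient_Geod_top LX shifts" and ?f = "project_line shifts"
  have im: "?f ` topspace ?X = proj ` Geod LX"
    unfolding topspace_quotient_Geod image_image by (rule image_cong) (simp_all add: project_line_orbit)
  have "proj ` Geod LX \<subseteq> Loc_Geod rose" using proj_in_Loc_Geod by blast
  then have sub: "subtopology (Loc_Geod_top rose) (proj ` Geod LX) = ucc_topology rose (proj ` Geod LX)"
    unfolding Loc_Geod_top_def by (intro subtopology_ucc Loc_Geod_in)
  have "inj_on ?f (topspace ?X)"
  proof (rule inj_onI)
    fix A B assume "A \<in> topspace ?X" "B \<in> topspace ?X" and eq: "?f A = ?f B"
    then obtain \<gamma> \<gamma>' where "\<gamma> \<in> Geod LX" "\<gamma>' \<in> Geod LX" "A = line_orbit \<gamma>" "B = line_orbit \<gamma>'"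
      unfolding topspace_quotient_Geod by blast
    then show "A = B" using line_orbit_eq[of \<gamma> \<gamma>'] eq by (simp add: project_line_orbit)
  qed
  then have "homeomorphic_map ?X (ucc_topology rose (proj ` Geod LX)) ?f"
    by (intro bijective_open_imp_homeomorphic_map continuous_map_project_line open_map_project_line) (simp_all add: im)
  then show ?thesis by (simp add: embedding_map_def im sub)
qed

lemma project_line_psubset:
  "project_line shifts ` topspace (quotient_Geod_top LX shifts) \<subset> Loc_Geod rose"
proof
  show "project_line shifts ` topspace (quotient_Geod_top LX shifts) \<subseteq> Loc_Geod rose"
    unfolding topspace_quotient_Geod using project_line_orbit proj_in_Loc_Geod by auto
  \<comment> \<open>The curve that runs round the loop petal for ever. At time 1/2 its distance from
    the image of the line is at least 1/2.\<close>
  define \<beta> where "\<beta> = (\<lambda>t. geo (\<lambda>_. (True, True)) (t - 0))"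
  have "\<beta> \<in> Loc_Geod rose" unfolding \<beta>_def by (rule geo_Loc_Geod) (simp add: red_def)
  moreover have "\<beta> \<noteq> proj \<gamma>" if \<gamma>: "\<gamma> \<in> Geod LX" for \<gamma>
  proof
    assume eq: "\<beta> = proj \<gamma>"
    obtain c \<sigma> where c: "\<gamma> = (\<lambda>t. on_line (c + \<sigma> * t))" using \<gamma> by (rule Geod_LX_cases)
    have "orbit_of shifts (on_line x) = pt (False, True) (frac x)" for x
    proof -
      have "mdist rose (orbit_of shifts (on_line x)) (orbit_of shifts (on_line (frac x))) = 0"
        unfolding dist_proj_line using circ_eq_0[of "frac x" "frac x"] frac_bounds[of x] by simp
      then show ?thesis by (simp add: orbit_in_rose pt_def)
    qed
    then have "\<beta> (1/2) = pt (False, True) (frac (c + \<sigma> * (1/2)))" unfolding eq c by simp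
    moreover have "\<beta> (1/2) = pt (True, True) (1/2)" by (simp add: \<beta>_def geo_def frac_eq)
    moreover have "mdist rose (pt (True, True) (1/2)) (pt (False, True) (frac x)) \<noteq> 0" for x
    proof -
      have "mdist rose (pt (True, True) (1/2)) (pt (False, True) (frac x)) = hgt (1/2) + hgt (frac x)"
        using frac_bounds[of x] by (intro dist_pt_other) auto
      moreover have "hgt (1/2) = 1/2" by (simp add: hgt_def)
      moreover have "0 \<le> hgt (frac x)" using hgt_bounds[OF frac_bounds(1,2)] by blast
      ultimately show ?thesis by linarith
    qed
    moreover have "mdist rose (pt (True, True) (1/2)) (pt (True, True) (1/2)) = 0"
      using dist_pt_near[of "1/2" "1/2"] by simp
    ultimately show False by metis
  qed
  ultimately show "project_line shifts ` topspace (quotient_Geod_top LX shifts) \<noteq> Loc_Geod rose"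
    unfolding topspace_quotient_Geod using project_line_orbit by fastforce
qed

section \<open>Entropy of the flow on classes of lines\<close>

lemma metrizable_Loc_Geod_top: "metrizable_space (Loc_Geod_top Q)"
  unfolding Loc_Geod_top_def metrizable_space_def
  using Metric_space_sup_dist[of "Loc_Geod Q" Q] mtopology_sup_dist[of "Loc_Geod Q" Q] Loc_Geod_in by metis

lemma quotient_flow_periodic:
  assumes "A \<in> topspace (quotient_Geod_top LX shifts)"
  shows "quotient_flow 1 A = A"
proof -
  obtain \<gamma> where \<gamma>: "\<gamma> \<in> Geod LX" "A = line_orbit \<gamma>" using assms by (auto simp: topspace_quotient_Geod)
  obtain c \<sigma> where c: "\<sigma> \<in> {1, -1}" "\<gamma> = (\<lambda>t. on_line (c + \<sigma> * t))" using \<gamma>(1) by (rule Geod_LX_cases)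
  define m where "m = (if \<sigma> = 1 then 1 else -1 :: int)"
  have m: "of_int m = \<sigma>" using c(1) by (auto simp: m_def)
  have "flow 1 (shift k \<circ> \<gamma>) = shift k \<circ> (shift m \<circ> \<gamma>)" for k
    by (auto simp: flow_def c(2) shift_on_line m algebra_simps)
  then have "quotient_flow 1 A = line_orbit (shift m \<circ> \<gamma>)"
    unfolding quotient_flow_def \<gamma>(2) line_orbit by (simp add: image_image)
  then show ?thesis using line_orbit_shift[OF \<gamma>(1)] \<gamma>(2) by simp
qed

text \<open>All dynamical distances coincide with the metric itself, so total boundedness bounds the
  covering numbers uniformly in \<open>n\<close>. A single point gives the lower bound; without
  points the value would be \<open>- \<infinity>\<close>.\<close>

lemma h_top_identity:
  assumes met: "metrizable_space Y" and ne: "topspace Y \<noteq> {}"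
    and f: "\<And>y. y \<in> topspace Y \<Longrightarrow> f y = y"
  shows "h_top Y f = 0"
proof -
  have pow: "(f ^^ i) y = y" if "y \<in> topspace Y" for i y
    by (induction i) (simp_all add: f that)
  have dyn: "dyn_dist f \<rho> n x y = \<rho> x y" if "x \<in> topspace Y" "y \<in> topspace Y" "n > 0" for \<rho> n x y
  proof -
    have "(\<lambda>i. \<rho> ((f ^^ i) x) ((f ^^ i) y)) ` {..<n} = {\<rho> x y}"
      using that pow by (auto simp: image_iff)
    then show ?thesis unfolding dyn_dist_def by simp
  qed
  obtain \<rho> where \<rho>: "Metric_space (topspace Y) \<rho>" "Metric_space.mtopology (topspace Y) \<rho> = Y"
    using met unfolding metrizable_space_def by (metis Metric_space.topspace_mtopology)
  show ?thesis
  proof (rule h_top_eqI[OF \<rho>])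
    fix K and r :: real assume K: "compactin Y K" and r: "r > 0"
    interpret Metric_space "topspace Y" \<rho> by (rule \<rho>)
    have KY: "K \<subseteq> topspace Y" using K by (rule compactin_subset_topspace)
    have "mtotally_bounded K" using K \<rho>(2) compactin_imp_mtotally_bounded by simp
    then have "\<exists>F. finite F \<and> F \<subseteq> K \<and> K \<subseteq> (\<Union>x\<in>F. mball x r)"
      unfolding mtotally_bounded_def using r by simp
    then obtain F where F: "finite F" "F \<subseteq> K" "K \<subseteq> (\<Union>x\<in>F. mball x r)" by (elim exE conjE) (rule that)
    \<comment> \<open>\<open>Suc\<close> keeps the argument of the logarithm positive if
      \<open>K\<close>, and with it \<open>F\<close>, is empty.\<close>
    have "elog (covering_number (topspace Y) (dyn_dist f \<rho> n) K r) \<le> ereal (ln (real (Suc (card F))) + 0 * real n)"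
      if n: "n > 0" for n
    proof -
      have "covering_number (topspace Y) (dyn_dist f \<rho> n) K r \<le> enat (card F)"
      proof (rule covering_number_le)
        show "K \<subseteq> (\<Union>x\<in>F. {y \<in> topspace Y. dyn_dist f \<rho> n x y < r})"
        proof
          fix y assume "y \<in> K"
          then obtain x where "x \<in> F" "y \<in> mball x r" using F(3) by blast
          then show "y \<in> (\<Union>x\<in>F. {y \<in> topspace Y. dyn_dist f \<rho> n x y < r})"
            using dyn[of x y n \<rho>] n by (intro UN_I[of x]) auto
        qed
      qed (use F KY in auto)
      also have "\<dots> \<le> enat (Suc (card F))" by simp
      finally have "elog (covering_number (topspace Y) (dyn_dist f \<rho> n) K r) \<le> elog (enat (Suc (card F)))"
        by (rule elog_mono)
      then show ?thesis by (simp add: elog_enat)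
    qed
    then have "entropy_rate (topspace Y) f \<rho> K r \<le> ereal 0"
      unfolding entropy_rate_def
      by (intro Limsup_rate_le[where b = "ln (real (Suc (card F)))", OF filterlim_real_sequentially])
        (simp, rule eventually_mono[OF eventually_gt_at_top[of 0]], blast)
    then show "entropy_rate (topspace Y) f \<rho> K r \<le> 0" by (simp only: zero_ereal_def)
  next
    fix \<sigma> assume \<sigma>: "Metric_space (topspace Y) \<sigma>" "Metric_space.mtopology (topspace Y) \<sigma> = Y"
    obtain y where y: "y \<in> topspace Y" using ne by blast
    have "ereal (0 + 0 * real n) \<le> elog (covering_number (topspace Y) (dyn_dist f \<sigma> n) {y} 1)" for n
    proof -
      have "enat 1 \<le> covering_number (topspace Y) (dyn_dist f \<sigma> n) {y} 1"
      proof (rule covering_number_ge)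
        fix F assume "finite F" "{y} \<subseteq> (\<Union>x\<in>F. {z \<in> topspace Y. dyn_dist f \<sigma> n x z < 1})"
        then have "finite F" "F \<noteq> {}" by auto
        then show "1 \<le> card F" by (simp add: Suc_le_eq card_gt_0_iff)
      qed
      then have "elog (enat 1) \<le> elog (covering_number (topspace Y) (dyn_dist f \<sigma> n) {y} 1)" by (rule elog_mono)
      then show ?thesis by (simp add: elog_enat)
    qed
    then have "ereal 0 \<le> entropy_rate (topspace Y) f \<sigma> {y} 1"
      unfolding entropy_rate_def
      by (intro Limsup_rate_ge[where b = 0, OF filterlim_real_sequentially]) (auto intro!: always_eventually)
    then show "\<exists>K r. compactin Y K \<and> 0 < r \<and> 0 \<le> entropy_rate (topspace Y) f \<sigma> K r"
      using y by (intro exI[of _ "{y}"] exI[of _ 1]) (simp flip: zero_ereal_def)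
  qed
qed

lemma h_top_quotient_Geod: "h_top (quotient_Geod_top LX shifts) (quotient_flow 1) = 0"
proof (rule h_top_identity)
  have "quotient_Geod_top LX shifts homeomorphic_space
      subtopology (Loc_Geod_top rose) (project_line shifts ` topspace (quotient_Geod_top LX shifts))"
    using embedding_project_line unfolding embedding_map_def by (rule homeomorphic_map_imp_homeomorphic_space)
  then show "metrizable_space (quotient_Geod_top LX shifts)"
    using homeomorphic_metrizable_space metrizable_Loc_Geod_top metrizable_space_subtopology by blast
  show "topspace (quotient_Geod_top LX shifts) \<noteq> {}"
    unfolding topspace_quotient_Geod using on_line_in_Geod[of 1 0] by blast
qed (rule quotient_flow_periodic)

section \<open>The entropy of the space of local geodesics\<close>

definition redl :: "letter list \<Rightarrow> bool" where "redl w \<longleftrightarrow> successively (\<lambda>a b. b \<noteq> linv a) w"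

definition words :: "nat \<Rightarrow> letter list set" where "words n = {w. length w = n \<and> redl w}"

lemma redl_nth: "redl w \<longleftrightarrow> (\<forall>i. Suc i < length w \<longrightarrow> w ! Suc i \<noteq> linv (w ! i))"
  by (simp add: redl_def successively_conv_nth)

lemma finite_words [simp]: "finite (words n)"
  by (rule finite_subset[OF _ finite_lists_length_eq[of UNIV n]]) (auto simp: words_def)

lemma card_letters: "card (UNIV :: letter set) = 4"
  by (simp add: card_UNIV_bool card_cartesian_product flip: UNIV_Times_UNIV)

text \<open>A reduced word can be prolonged at the front by every letter except the inverse of its
  head.\<close>

lemma card_words: "card (words (Suc n)) = 4 * 3 ^ n"
proof (induction n)
  case 0
  have "words (Suc 0) = (\<lambda>l. [l]) ` UNIV" by (auto simp: words_def redl_def length_Suc_conv)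
  then show ?case by (simp add: card_image inj_on_def card_letters)
next
  case (Suc n)
  let ?S = "SIGMA w:words (Suc n). - {linv (hd w)}"
  have "bij_betw (\<lambda>(w, l). l # w) ?S (words (Suc (Suc n)))"
  proof (rule bij_betwI')
    fix x y assume "x \<in> ?S" "y \<in> ?S"
    show "((case x of (w, l) \<Rightarrow> l # w) = (case y of (w, l) \<Rightarrow> l # w)) = (x = y)"
      by (auto split: prod.splits)
  next
    fix x assume "x \<in> ?S"
    then show "(case x of (w, l) \<Rightarrow> l # w) \<in> words (Suc (Suc n))"
      by (auto simp: words_def redl_def successively_Cons linv_eq_iff split: prod.splits)
  next
    fix v assume v: "v \<in> words (Suc (Suc n))"
    then obtain l w where lw: "v = l # w" "length w = Suc n" by (auto simp: words_def length_Suc_conv)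
    then have "redl w" "hd w \<noteq> linv l"
      using v by (auto simp: words_def redl_def successively_Cons)
    then have "(w, l) \<in> ?S" using lw by (auto simp: words_def)
    then show "\<exists>x\<in>?S. v = (case x of (w, l) \<Rightarrow> l # w)" using lw by (intro bexI[of _ "(w, l)"]) auto
  qed
  then have "card (words (Suc (Suc n))) = card ?S" by (simp add: bij_betw_same_card)
  also have "\<dots> = (\<Sum>w\<in>words (Suc n). card (- {linv (hd w)} :: letter set))" by (rule card_SigmaI) auto
  also have "\<dots> = (\<Sum>w\<in>words (Suc n). 3)"
    by (simp add: Compl_eq_Diff_UNIV card_Diff_singleton card_letters)
  finally show ?case using Suc by simp
qed

text \<open>Clamping the index repeats the end letters of \<open>v\<close>, which keeps the word reduced.\<close>

definition ext :: "letter list \<Rightarrow> int \<Rightarrow> int \<Rightarrow> letter" where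
  "ext v m k = v ! nat (min (max (k - m) 0) (int (length v) - 1))"

lemma red_ext:
  assumes "redl v" "v \<noteq> []" shows "red (ext v m)"
  unfolding red_def
proof
  fix k
  have len: "length v > 0" using assms(2) by simp
  define i where "i = nat (min (max (k - m) 0) (int (length v) - 1))"
  define j where "j = nat (min (max (k + 1 - m) 0) (int (length v) - 1))"
  have ij: "j = i \<or> j = Suc i \<and> Suc i < length v"
    using len by (auto simp: i_def j_def min_def max_def)
  have "ext v m k = v ! i" "ext v m (k + 1) = v ! j" by (simp_all add: ext_def i_def j_def)
  then show "ext v m (k + 1) \<noteq> linv (ext v m k)" using ij assms(1) by (auto simp: redl_nth)
qed

lemma ext_nth: "i < length v \<Longrightarrow> ext v m (m + int i) = v ! i"
  by (simp add: ext_def min_def max_def)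

lemma ext_restriction:
  assumes "m \<le> k" "k < m + int n"
  shows "ext (map (\<lambda>i. W (m + int i)) [0..<n]) m k = W k"
proof -
  have "ext (map (\<lambda>i. W (m + int i)) [0..<n]) m (m + int (nat (k - m))) = W k"
    using assms by (subst ext_nth) auto
  then show ?thesis using assms by simp
qed

lemma words_restriction: "red W \<Longrightarrow> map (\<lambda>i. W (m + int i)) [0..<n] \<in> words n"
  by (auto simp: words_def redl_nth red_def) (metis add.assoc add.commute)

section \<open>Upper bound for the entropy of local geodesics\<close>

lemma flow_pow: "(flow 1 ^^ i) \<gamma> = (\<lambda>t. \<gamma> (t + real i))"
  by (induction i) (auto simp: flow_def fun_eq_iff algebra_simps)

lemma dyn_dist_less_iff:
  "0 < n \<Longrightarrow> dyn_dist f \<rho> n x y < r \<longleftrightarrow> (\<forall>i<n. \<rho> ((f ^^ i) x) ((f ^^ i) y) < r)"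
  unfolding dyn_dist_def by (subst Max_less_iff) auto

lemma geo_close:
  assumes W: "red W" "red W'" and agree: "\<And>k. of_int k \<le> t - \<tau>' \<Longrightarrow> t - \<tau>' < of_int k + 1 \<Longrightarrow> W' k = W k"
  shows "mdist rose (geo W' (t - \<tau>')) (geo W (t - \<tau>)) \<le> \<bar>\<tau> - \<tau>'\<bar>"
proof -
  have "geo W' (t - \<tau>') = geo W (t - \<tau>')"
    using agree[of "\<lfloor>t - \<tau>'\<rfloor>"] by (simp add: geo_def)
  then show ?thesis using dist_geo_le[OF W(1), of "t - \<tau>'" "t - \<tau>"] by simp
qed

text \<open>A local geodesic is approximated by recording its word on the window visited between the
  times \<open>- N\<close> and \<open>n + N\<close>, and its phase up to \<open>1 / M\<close>. The
  window exceeds \<open>n\<close> by a constant, so the number of centres is a constant times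
  \<open>3 ^ n\<close>.\<close>

lemma covering_number_Loc_Geod_le:
  assumes r: "r > 0"
  obtains C where "C > 0" "\<And>K n. 0 < n \<Longrightarrow> K \<subseteq> Loc_Geod rose \<Longrightarrow>
    covering_number (Loc_Geod rose) (dyn_dist (flow 1) (sup_dist rose) n) K r \<le> enat (C * 3 ^ n)"
proof -
  \<comment> \<open>The same number serves twice: times beyond \<open>N\<close> are damped below
    \<open>r / 2\<close> by the weight, and the mesh \<open>1 / M\<close> of the phases is below
    \<open>r / 2\<close>.\<close>
  obtain N :: nat where N: "1 / real (Suc N) < r / 2" using r nat_approx_posE half_gt_zero by blast
  define M where "M = Suc N"
  define C where "C = 4 * 3 ^ (2 * N + 3) * M"
  have "covering_number (Loc_Geod rose) (dyn_dist (flow 1) (sup_dist rose) n) K r \<le> enat (C * 3 ^ n)"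
    if n: "0 < n" and K: "K \<subseteq> Loc_Geod rose" for K n
  proof -
    \<comment> \<open>At times between \<open>- N\<close> and \<open>n + N\<close>, with phases in
      \<open>[0, 1]\<close>, the indices of the edges lie between \<open>- N - 1\<close> and
      \<open>n + N\<close>; the window of length \<open>L\<close> from \<open>m\<close> on contains
      them.\<close>
    define L where "L = Suc (n + 2 * N + 3)"
    define m where "m = - int N - 2"
    define c where "c = (\<lambda>(v, j). (\<lambda>t. geo (ext v m) (t - real j / real M)))"
    define F where "F = c ` (words L \<times> {..<M})"
    have "card F \<le> card (words L \<times> {..<M})" unfolding F_def by (rule card_image_le) simp
    also have "\<dots> = C * 3 ^ n" unfolding L_def card_cartesian_product card_words C_def by (simp add: power_add)
    finally have cardF: "card F \<le> C * 3 ^ n" .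
    have red_v: "red (ext v m)" if "v \<in> words L" for v
      using that by (intro red_ext) (auto simp: words_def L_def)
    have "covering_number (Loc_Geod rose) (dyn_dist (flow 1) (sup_dist rose) n) K r \<le> enat (card F)"
    proof (rule covering_number_le)
      show "finite F" by (simp add: F_def)
      show "F \<subseteq> Loc_Geod rose" using red_v by (auto simp: F_def c_def intro!: geo_Loc_Geod)
      show "K \<subseteq> (\<Union>x\<in>F. {y \<in> Loc_Geod rose. dyn_dist (flow 1) (sup_dist rose) n x y < r})"
      proof
        fix \<gamma> assume "\<gamma> \<in> K"
        then have \<gamma>L: "\<gamma> \<in> Loc_Geod rose" using K by blast
        then obtain W \<tau> where W: "red W" "0 \<le> \<tau>" "\<tau> < 1" "\<gamma> = (\<lambda>t. geo W (t - \<tau>))" by (rule Loc_Geod_rose_cases)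
        define v where "v = map (\<lambda>i. W (m + int i)) [0..<L]"
        define j where "j = nat \<lfloor>\<tau> * real M\<rfloor>"
        have M0: "0 < real M" by (simp add: M_def)
        have j1: "real j \<le> \<tau> * real M" "\<tau> * real M < real j + 1"
          using W(2) M0 by (auto simp: j_def)
        have "\<tau> * real M < real M" using W(3) M0 by simp
        then have jM: "j < M" using j1 by linarith
        have j2: "\<bar>\<tau> - real j / real M\<bar> \<le> 1 / real M"
        proof -
          have "\<tau> - real j / real M = (\<tau> * real M - real j) / real M" using M0 by (simp add: field_simps)
          moreover have "\<bar>\<tau> * real M - real j\<bar> \<le> 1" using j1 by linarith
          ultimately show ?thesis using M0 by (simp add: divide_right_mono)
        qed
        have jb: "0 \<le> real j / real M" "real j / real M \<le> 1" using jM by (simp_all add: M_def divide_le_eq)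
        have v: "v \<in> words L" unfolding v_def using W(1) by (rule words_restriction)
        have "c (v, j) \<in> F" using v jM by (auto simp: F_def)
        moreover have "dyn_dist (flow 1) (sup_dist rose) n (c (v, j)) \<gamma> < r"
          unfolding dyn_dist_less_iff[OF n]
        proof (intro allI impI)
          fix i assume i: "i < n"
          have "sup_dist rose ((flow 1 ^^ i) (c (v, j))) ((flow 1 ^^ i) \<gamma>) \<le> r / 2"
          proof (rule sup_dist_le_if_close[of "real N"])
            show "1 / (1 + real N) \<le> r / 2" using N by simp
            fix t assume t: "\<bar>t\<bar> \<le> real N"
            have "mdist rose (geo (ext v m) (t + real i - real j / real M)) (geo W (t + real i - \<tau>)) \<le> \<bar>\<tau> - real j / real M\<bar>"
            proof (rule geo_close[OF W(1) red_v[OF v]])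
              fix k assume k: "of_int k \<le> t + real i - real j / real M" "t + real i - real j / real M < of_int k + 1"
              have "real_of_int k \<le> real N + real n" "- real N - 2 < real_of_int k" using k t i jb by linarith+
              then have "m \<le> k" "k < m + int L" unfolding m_def L_def by linarith+
              then show "ext v m k = W k" unfolding v_def by (rule ext_restriction)
            qed
            also have "\<dots> \<le> r / 2" using j2 N by (simp add: M_def)
            finally show "mdist rose ((flow 1 ^^ i) (c (v, j)) t) ((flow 1 ^^ i) \<gamma> t) \<le> r / 2"
              by (simp add: flow_pow c_def W(4))
          qed simp
          then show "sup_dist rose ((flow 1 ^^ i) (c (v, j))) ((flow 1 ^^ i) \<gamma>) < r" using r by linarith
        qed
        ultimately show "\<gamma> \<in> (\<Union>x\<in>F. {y \<in> Loc_Geod rose. dyn_dist (flow 1) (sup_dist rose) n x y < r})"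
          using \<gamma>L by blast
      qed
    qed
    also have "\<dots> \<le> enat (C * 3 ^ n)" using cardF by simp
    finally show ?thesis .
  qed
  moreover have "C > 0" by (simp add: C_def M_def)
  ultimately show ?thesis using that by blast
qed

section \<open>Lower bound for the entropy of local geodesics\<close>

definition geo_set :: "(real \<Rightarrow> real set) set" where "geo_set = geo ` {W. red W}"

lemma geo_set_Loc_Geod: "geo_set \<subseteq> Loc_Geod rose"
  using geo_Loc_Geod[of _ 0] by (auto simp: geo_set_def)

text \<open>The reduced words form a closed subset of a product of finite discrete spaces, and on a
  compact set of times \<open>geo W\<close> depends on finitely many letters only, so it is
  continuous in \<open>W\<close>.\<close>

lemma compactin_geo_set: "compactin (Loc_Geod_top rose) geo_set"
proof -
  define T :: "(int \<Rightarrow> letter) topology" where "T = product_topology (\<lambda>_. discrete_topology UNIV) UNIV"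
  have top: "topspace T = UNIV" by (simp add: T_def)
  have cyl: "openin T {W. P (W k)}" for P k
  proof -
    have "continuous_map T (discrete_topology UNIV) (\<lambda>W. W k)"
      unfolding T_def by (rule continuous_map_product_projection) simp
    from openin_continuous_map_preimage[OF this, of "{l. P l}"] show ?thesis by (simp add: top)
  qed
  have "compact_space T"
    unfolding T_def compact_space_product_topology by (simp add: compact_space_discrete_topology)
  moreover have "closedin T {W. red W}"
    unfolding closedin_def
  proof
    have "topspace T - {W. red W} = (\<Union>k. \<Union>l. {W. W k = l} \<inter> {W. W (k + 1) = linv l})"
    proof (rule Set.set_eqI)
      fix W :: "int \<Rightarrow> letter"
      show "W \<in> topspace T - {W. red W} \<longleftrightarrow> W \<in> (\<Union>k. \<Union>l. {W. W k = l} \<inter> {W. W (k + 1) = linv l})"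
        by (simp add: top red_def del: split_paired_Ex)
    qed
    also have "openin T \<dots>"
    proof (rule openin_Union, erule imageE, simp only:, rule openin_Union, erule imageE, simp only:)
      fix k :: int and l :: letter
      show "openin T ({W. W k = l} \<inter> {W. W (k + 1) = linv l})"
        using cyl[of "\<lambda>m. m = l" k] cyl[of "\<lambda>m. m = linv l" "k + 1"] by (rule openin_Int)
    qed
    finally show "openin T (topspace T - {W. red W})" .
  qed (simp add: top)
  ultimately have "compactin T {W. red W}" by (rule closedin_compact_space)
  then have "compactin (subtopology T {W. red W}) {W. red W}" by (simp add: compactin_subtopology)
  moreover have "continuous_map (subtopology T {W. red W}) (Loc_Geod_top rose) geo"
    unfolding continuous_map_def
  proof (intro conjI allI impI)
    show "geo \<in> topspace (subtopology T {W. red W}) \<rightarrow> topspace (Loc_Geod_top rose)"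
      using geo_set_Loc_Geod by (auto simp: top Loc_Geod_top_def geo_set_def)
    fix U assume U: "openin (Loc_Geod_top rose) U"
    have nhd: "\<exists>A. openin T A \<and> W \<in> A \<and> A \<inter> {W. red W} \<subseteq> {W. red W \<and> geo W \<in> U}" if W: "red W" "geo W \<in> U" for W
    proof -
      obtain K \<epsilon> where K: "compact K" "\<epsilon> > 0" "{\<gamma>' \<in> Loc_Geod rose. \<forall>t\<in>K. mdist rose (geo W t) (\<gamma>' t) < \<epsilon>} \<subseteq> U"
        using U W(2) unfolding Loc_Geod_top_def by (rule openin_ucc_nhd)
      obtain b where b: "\<And>t. t \<in> K \<Longrightarrow> \<bar>t\<bar> \<le> b"
        using compact_imp_bounded[OF K(1)] by (auto simp: bounded_pos)
      define N where "N = \<lceil>b\<rceil> + 1"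
      define A where "A = (\<Inter>k\<in>{- N..N}. {W'. W' k = W k}) \<inter> topspace T"
      have "openin T A" unfolding A_def by (intro openin_INT cyl) simp
      moreover have "W \<in> A" by (simp add: A_def top)
      moreover have "geo W' \<in> U" if W': "W' \<in> A" "red W'" for W'
      proof -
        have "geo W' t = geo W t" if "t \<in> K" for t
        proof -
          have "\<lfloor>t\<rfloor> \<in> {- N..N}" using b[OF that] unfolding N_def atLeastAtMost_iff by linarith
          then show ?thesis using W'(1) by (simp add: A_def geo_def)
        qed
        moreover have "geo W' \<in> Loc_Geod rose" using geo_Loc_Geod[OF W'(2), of 0] by simp
        moreover have "mdist rose (geo W t) (geo W t) = 0" for t using geo_in by simp
        ultimately show ?thesis using K(2) by (intro subsetD[OF K(3)]) auto
      qed
      ultimately show ?thesis by (intro exI[of _ A]) auto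
    qed
    have "\<exists>B. openin (subtopology T {W. red W}) B \<and> W \<in> B \<and> B \<subseteq> {W. red W \<and> geo W \<in> U}"
      if WU: "W \<in> {W. red W \<and> geo W \<in> U}" for W
    proof -
      from WU have "red W" "geo W \<in> U" by simp_all
      then obtain A where A: "openin T A" "W \<in> A" "A \<inter> {W. red W} \<subseteq> {W. red W \<and> geo W \<in> U}"
        using nhd by blast
      then show ?thesis using \<open>red W\<close> by (intro exI[of _ "A \<inter> {W. red W}"] conjI openin_subtopology_Int) simp_all
    qed
    then have "openin (subtopology T {W. red W}) {W. red W \<and> geo W \<in> U}"
      by (subst openin_subopen) (rule ballI)
    then show "openin (subtopology T {W. red W}) {W \<in> topspace (subtopology T {W. red W}). geo W \<in> U}"
      by (simp add: top)
  qed
  ultimately show ?thesis unfolding geo_set_def by (rule image_compactin)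
qed

lemma geo_set_flow: "red W \<Longrightarrow> (flow 1 ^^ i) (geo W) = geo (\<lambda>k. W (k + int i))"
  using geo_shift[of W _ "int i"] by (auto simp: flow_pow)

text \<open>The metric \<rho> is known only through its topology. The open sets \<open>U l\<close>,
  which on \<open>geo_set\<close> single out the letter at index 0, cover this compact set, and a
  Lebesgue number for \<rho> makes close curves share the letter. As the flow brings every letter to
  index 0, distinct words of length \<open>n\<close> need distinct centres.\<close>

lemma covering_number_geo_set_ge:
  assumes met: "Metric_space (Loc_Geod rose) \<rho>" and top: "Metric_space.mtopology (Loc_Geod rose) \<rho> = Loc_Geod_top rose"
  obtains r where "r > 0" "\<And>n. enat (3 ^ n) \<le> covering_number (Loc_Geod rose) (dyn_dist (flow 1) \<rho> n) geo_set r \<or> n = 0"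
proof -
  interpret Metric_space "Loc_Geod rose" \<rho> by (rule met)
  \<comment> \<open>At time 1/4 the points on different rays are 1/2 apart, so the radius 1/8
    separates the letters.\<close>
  define U where "U l = {\<gamma> \<in> Loc_Geod rose. mdist rose (pt l (1/4)) (\<gamma> (1/4)) < 1/8}" for l
  have opn: "openin mtopology (U l)" for l
    unfolding top Loc_Geod_top_def openin_ucc_topology
  proof (intro conjI ballI)
    fix \<gamma> assume \<gamma>: "\<gamma> \<in> U l"
    then have g: "\<gamma> \<in> Loc_Geod rose" "mdist rose (pt l (1/4)) (\<gamma> (1/4)) < 1/8" by (auto simp: U_def)
    have "{\<gamma>' \<in> Loc_Geod rose. \<forall>t\<in>{1/4}. mdist rose (\<gamma> t) (\<gamma>' t) < 1/8 - mdist rose (pt l (1/4)) (\<gamma> (1/4))} \<subseteq> U l"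
    proof
      fix \<gamma>' assume g': "\<gamma>' \<in> {\<gamma>' \<in> Loc_Geod rose. \<forall>t\<in>{1/4}. mdist rose (\<gamma> t) (\<gamma>' t) < 1/8 - mdist rose (pt l (1/4)) (\<gamma> (1/4))}"
      have "mdist rose (pt l (1/4)) (\<gamma>' (1/4)) \<le> mdist rose (pt l (1/4)) (\<gamma> (1/4)) + mdist rose (\<gamma> (1/4)) (\<gamma>' (1/4))"
        using g(1) g' by (intro mdist_triangle pt_in Loc_Geod_in) auto
      then show "\<gamma>' \<in> U l" using g' by (auto simp: U_def)
    qed
    then show "\<exists>K \<epsilon>. compact K \<and> 0 < \<epsilon> \<and> {\<gamma>' \<in> Loc_Geod rose. \<forall>t\<in>K. mdist rose (\<gamma> t) (\<gamma>' t) < \<epsilon>} \<subseteq> U l"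
      using g(2) by (intro exI[of _ "{1/4}"] exI[of _ "1/8 - mdist rose (pt l (1/4)) (\<gamma> (1/4))"]) auto
  qed (auto simp: U_def)
  have quarter: "geo W (1/4) = pt (W 0) (1/4)" for W by (simp add: geo_def frac_eq)
  have U_letter: "geo W \<in> U l \<Longrightarrow> W 0 = l" for W l
  proof (rule ccontr)
    assume "geo W \<in> U l" "W 0 \<noteq> l"
    moreover from this have "mdist rose (pt l (1/4)) (pt (W 0) (1/4)) = 1/4 + 1/4" by (intro dist_pt_star) auto
    ultimately show False by (auto simp: U_def quarter)
  qed
  have "geo W \<in> U (W 0)" if "red W" for W
    using geo_set_Loc_Geod that dist_pt_near[of "1/4" "1/4" "W 0"] by (auto simp: U_def quarter geo_set_def)
  then have cover: "geo_set \<subseteq> \<Union>(range U)" by (auto simp: geo_set_def)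
  have "\<exists>\<epsilon>>0. \<forall>x\<in>geo_set. \<exists>V\<in>range U. mball x \<epsilon> \<subseteq> V"
  proof (rule lebesgue_number)
    show "compactin mtopology geo_set" unfolding top by (rule compactin_geo_set)
    show "openin mtopology V" if "V \<in> range U" for V using that opn by blast
  qed (rule cover)
  then obtain \<epsilon> where \<epsilon>: "\<epsilon> > 0" "\<And>x. x \<in> geo_set \<Longrightarrow> \<exists>V\<in>range U. mball x \<epsilon> \<subseteq> V"
    by (elim exE conjE) (rule that, assumption, erule bspec)
  have letter: "W 0 = W' 0" if W: "red W" "red W'" and d: "\<rho> (geo W) (geo W') < \<epsilon>" for W W'
  proof -
    have gs: "geo W \<in> geo_set" "geo W' \<in> geo_set" using W by (auto simp: geo_set_def)
    then have gl: "geo W \<in> Loc_Geod rose" "geo W' \<in> Loc_Geod rose" using geo_set_Loc_Geod by auto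
    obtain l where l: "mball (geo W) \<epsilon> \<subseteq> U l" using \<epsilon>(2)[OF gs(1)] by blast
    have "geo W \<in> mball (geo W) \<epsilon>" "geo W' \<in> mball (geo W) \<epsilon>" using gl d \<epsilon>(1) by auto
    then show ?thesis using l U_letter by blast
  qed
  \<comment> \<open>The centres need not lie in \<open>geo_set\<close>; with radius
    \<open>\<epsilon> / 2\<close>, two curves with a common centre are closer than
    \<epsilon>.\<close>
  have "enat (3 ^ n) \<le> covering_number (Loc_Geod rose) (dyn_dist (flow 1) \<rho> n) geo_set (\<epsilon> / 2)" if n: "0 < n" for n
  proof (rule covering_number_ge)
    fix F assume F: "finite F" "F \<subseteq> Loc_Geod rose"
      "geo_set \<subseteq> (\<Union>x\<in>F. {y \<in> Loc_Geod rose. dyn_dist (flow 1) \<rho> n x y < \<epsilon> / 2})"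
    define w where "w v = geo (ext v 0)" for v
    have red_v: "red (ext v 0)" if "v \<in> words n" for v
      using that n by (intro red_ext) (auto simp: words_def)
    have "\<exists>x\<in>F. dyn_dist (flow 1) \<rho> n x (w v) < \<epsilon> / 2" if "v \<in> words n" for v
    proof -
      have "w v \<in> geo_set" using red_v[OF that] by (simp add: w_def geo_set_def)
      then show ?thesis using F(3) by blast
    qed
    then obtain x where x: "\<And>v. v \<in> words n \<Longrightarrow> x v \<in> F \<and> dyn_dist (flow 1) \<rho> n (x v) (w v) < \<epsilon> / 2"
      by metis
    have "inj_on x (words n)"
    proof (rule inj_onI)
      fix v v' assume v: "v \<in> words n" "v' \<in> words n" and eq: "x v = x v'"
      show "v = v'"
      proof (rule nth_equalityI)
        show "length v = length v'" using v by (simp add: words_def)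
        fix i assume "i < length v"
        then have i: "i < n" "i < length v" "i < length v'" using v by (auto simp: words_def)
        have flow_in: "(flow 1 ^^ i) \<gamma> \<in> Loc_Geod rose" if "\<gamma> \<in> Loc_Geod rose" for \<gamma>
        proof -
          obtain W \<tau> where W: "red W" "\<gamma> = (\<lambda>t. geo W (t - \<tau>))" using \<open>\<gamma> \<in> _\<close> by (rule Loc_Geod_rose_cases)
          have "(flow 1 ^^ i) \<gamma> = (\<lambda>t. geo W (t - (\<tau> - real i)))" by (simp add: flow_pow W(2) algebra_simps)
          then show ?thesis using geo_Loc_Geod[OF W(1)] by simp
        qed
        have shifted: "(flow 1 ^^ i) (w u) = geo (\<lambda>k. ext u 0 (k + int i))" "red (\<lambda>k. ext u 0 (k + int i))"
          if "u \<in> words n" for u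
          using red_v[OF that] by (auto simp: w_def geo_set_flow intro: red_shift)
        have wL: "w u \<in> Loc_Geod rose" if "u \<in> words n" for u
          using red_v[OF that] geo_set_Loc_Geod by (auto simp: w_def geo_set_def)
        have xL: "x v \<in> Loc_Geod rose" using x v F(2) by blast
        have "\<rho> ((flow 1 ^^ i) (x v)) ((flow 1 ^^ i) (w v)) < \<epsilon> / 2"
          "\<rho> ((flow 1 ^^ i) (x v)) ((flow 1 ^^ i) (w v')) < \<epsilon> / 2"
          using x[OF v(1)] x[OF v(2)] i(1) dyn_dist_less_iff[OF n] eq by metis+
        then have "\<rho> ((flow 1 ^^ i) (w v)) ((flow 1 ^^ i) (w v')) < \<epsilon>"
          using triangle'[OF flow_in[OF wL[OF v(1)]] flow_in[OF xL] flow_in[OF wL[OF v(2)]]]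
            commute[of "(flow 1 ^^ i) (x v)" "(flow 1 ^^ i) (w v')"] commute[of "(flow 1 ^^ i) (x v)" "(flow 1 ^^ i) (w v)"] by linarith
        then have "\<rho> (geo (\<lambda>k. ext v 0 (k + int i))) (geo (\<lambda>k. ext v' 0 (k + int i))) < \<epsilon>"
          by (simp only: shifted v)
        from letter[OF shifted(2)[OF v(1)] shifted(2)[OF v(2)] this]
        show "v ! i = v' ! i" using ext_nth[of i v 0] ext_nth[of i v' 0] i by simp
      qed
    qed
    then have "card (words n) \<le> card F" using x F(1) by (intro card_inj_on_le) auto
    moreover obtain n' where "n = Suc n'" using n by (cases n) auto
    ultimately show "3 ^ n \<le> card F" by (simp add: card_words)
  qed
  then show ?thesis using that[of "\<epsilon> / 2"] \<epsilon>(1) by auto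
qed

lemma h_top_Loc_Geod: "h_top (Loc_Geod_top rose) (flow 1) = ereal (ln 3)"
proof -
  have ts: "topspace (Loc_Geod_top rose) = Loc_Geod rose" by (simp add: Loc_Geod_top_def)
  have met: "Metric_space (Loc_Geod rose) (sup_dist rose)" by (rule Metric_space_sup_dist) (rule Loc_Geod_in)
  have top: "Metric_space.mtopology (Loc_Geod rose) (sup_dist rose) = Loc_Geod_top rose"
    unfolding Loc_Geod_top_def by (rule mtopology_sup_dist) (rule Loc_Geod_in)
  show ?thesis
  proof (rule h_top_eqI[of _ "sup_dist rose"], unfold ts)
    fix K and r :: real assume K: "compactin (Loc_Geod_top rose) K" and r: "r > 0"
    have KL: "K \<subseteq> Loc_Geod rose" using compactin_subset_topspace[OF K] ts by simp
    obtain C where C: "C > 0" "\<And>K n. 0 < n \<Longrightarrow> K \<subseteq> Loc_Geod rose \<Longrightarrow>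
        covering_number (Loc_Geod rose) (dyn_dist (flow 1) (sup_dist rose) n) K r \<le> enat (C * 3 ^ n)"
      using r by (rule covering_number_Loc_Geod_le) blast
    have "elog (covering_number (Loc_Geod rose) (dyn_dist (flow 1) (sup_dist rose) n) K r) \<le> ereal (ln (real C) + ln 3 * real n)"
      if "0 < n" for n
    proof -
      have "elog (covering_number (Loc_Geod rose) (dyn_dist (flow 1) (sup_dist rose) n) K r) \<le> elog (enat (C * 3 ^ n))"
        by (rule elog_mono) (rule C(2)[OF that KL])
      also have "\<dots> = ereal (ln (real C) + ln 3 * real n)"
        using C(1) by (simp add: elog_enat ln_mult ln_realpow)
      finally show ?thesis .
    qed
    then show "entropy_rate (Loc_Geod rose) (flow 1) (sup_dist rose) K r \<le> ereal (ln 3)"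
      unfolding entropy_rate_def
      by (intro Limsup_rate_le[where b = "ln (real C)", OF filterlim_real_sequentially])
        (simp, rule eventually_mono[OF eventually_gt_at_top[of 0]], blast)
  next
    fix \<rho> assume \<rho>: "Metric_space (Loc_Geod rose) \<rho>" "Metric_space.mtopology (Loc_Geod rose) \<rho> = Loc_Geod_top rose"
    obtain r where r: "r > 0" "\<And>n. enat (3 ^ n) \<le> covering_number (Loc_Geod rose) (dyn_dist (flow 1) \<rho> n) geo_set r \<or> n = 0"
      using \<rho> by (rule covering_number_geo_set_ge) blast
    have "ereal (0 + ln 3 * real n) \<le> elog (covering_number (Loc_Geod rose) (dyn_dist (flow 1) \<rho> n) geo_set r)" if "0 < n" for n
    proof -
      have "ereal (0 + ln 3 * real n) = elog (enat (3 ^ n))" by (simp add: elog_enat ln_realpow)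
      also have "\<dots> \<le> elog (covering_number (Loc_Geod rose) (dyn_dist (flow 1) \<rho> n) geo_set r)"
        using r(2)[of n] that by (intro elog_mono) auto
      finally show ?thesis .
    qed
    then have "ereal (ln 3) \<le> entropy_rate (Loc_Geod rose) (flow 1) \<rho> geo_set r"
      unfolding entropy_rate_def
      by (intro Limsup_rate_ge[where b = 0, OF filterlim_real_sequentially])
        (simp, rule eventually_mono[OF eventually_gt_at_top[of 0]], blast)
    then show "\<exists>K r. compactin (Loc_Geod_top rose) K \<and> 0 < r \<and> ereal (ln 3) \<le> entropy_rate (Loc_Geod rose) (flow 1) \<rho> K r"
      using compactin_geo_set r(1) by blast
  qed (use met top in auto)
qed

section \<open>The universal cover of the rose\<close>

fun lcp :: "'a list \<Rightarrow> 'a list \<Rightarrow> nat" where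
  "lcp (x # xs) (y # ys) = (if x = y then Suc (lcp xs ys) else 0)"
| "lcp _ _ = 0"

lemma lcp_Nil [simp]: "lcp xs [] = 0" by (cases xs) auto

lemma lcp_commute: "lcp xs ys = lcp ys xs"
  by (induction xs ys rule: lcp.induct) auto

lemma lcp_le: "lcp xs ys \<le> length xs" "lcp xs ys \<le> length ys"
  by (induction xs ys rule: lcp.induct) auto

lemma lcp_self [simp]: "lcp xs xs = length xs"
  by (induction xs) auto

lemma lcp_append: "lcp (xs @ ys) (xs @ zs) = length xs + lcp ys zs"
  by (induction xs) auto

lemma lcp_take: "lcp (take m xs) (take n ys) = min (min m n) (lcp xs ys)"
proof (induction xs ys arbitrary: m n rule: lcp.induct)
  case (1 x xs y ys)
  then show ?case by (cases m; cases n) auto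
qed auto

lemma take_lcp: "n \<le> lcp xs ys \<Longrightarrow> take n xs = take n ys"
proof (induction xs ys arbitrary: n rule: lcp.induct)
  case (1 x xs y ys)
  then show ?case by (cases n) (auto split: if_splits)
qed auto

text \<open>This is behind the triangle inequality of \<open>tree_dist\<close>.\<close>

lemma lcp_ultrametric: "min (lcp xs ys) (lcp ys zs) \<le> lcp xs zs"
proof (induction xs ys arbitrary: zs rule: lcp.induct)
  case (1 x xs y ys)
  then show ?case by (cases zs) auto
qed auto

text \<open>
  The point at height \<open>h\<close> on the path from the root along the letters of \<open>w\<close>. The last edge of the path
  along \<open>v\<close> is encoded in the half-open interval of length 1 that ends at the code of \<open>v\<close>.
\<close>

definition tp :: "letter list \<Rightarrow> real \<Rightarrow> real" where
  "tp w h = (let v = take (nat \<lceil>h\<rceil>) w in real (to_nat v) - (real (length v) - h))"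

definition word :: "real \<Rightarrow> letter list" where "word u = from_nat (nat \<lceil>u\<rceil>)"

definition level :: "real \<Rightarrow> real" where "level u = real (length (word u)) - (of_int \<lceil>u\<rceil> - u)"

definition ok :: "letter list \<Rightarrow> real \<Rightarrow> bool" where
  "ok w h \<longleftrightarrow> redl w \<and> 0 \<le> h \<and> h \<le> real (length w)"

definition tree_set :: "real set" where "tree_set = {tp w h | w h. ok w h}"

text \<open>The minimum is the height at which the paths from the root to the two points part, that
  is, their Gromov product at the root.\<close>

definition tree_dist :: "real \<Rightarrow> real \<Rightarrow> real" where
  "tree_dist u v = level u + level v - 2 * min (min (level u) (level v)) (real (lcp (word u) (word v)))"

text \<open>The offset below the integer code \<open>to_nat v\<close> lies in \<open>[0, 1)\<close>,
  so rounding up recovers \<open>v\<close>.\<close>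

lemma decode:
  assumes "0 \<le> h" "h \<le> real (length w)"
  shows "word (tp w h) = take (nat \<lceil>h\<rceil>) w" "level (tp w h) = h"
proof -
  define n where "n = nat \<lceil>h\<rceil>"
  define v where "v = take n w"
  have n: "h \<le> real n" "real n < h + 1" using assms by (auto simp: n_def) linarith+
  have "n \<le> length w" using assms by (simp add: n_def nat_le_iff ceiling_le_iff)
  then have len: "length v = n" by (simp add: v_def)
  have tp: "tp w h = real (to_nat v) - (real n - h)"
    by (simp add: tp_def Let_def len flip: n_def v_def)
  have c: "\<lceil>tp w h\<rceil> = int (to_nat v)" unfolding tp using n by (intro ceiling_unique) auto
  show "word (tp w h) = take (nat \<lceil>h\<rceil>) w" by (simp add: word_def c v_def n_def)
  then have "length (word (tp w h)) = n" using len by (simp add: v_def n_def)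
  then show "level (tp w h) = h" by (simp add: level_def c) (simp add: tp)
qed

lemma tp_cong: "take (nat \<lceil>h\<rceil>) w = take (nat \<lceil>h\<rceil>) w' \<Longrightarrow> tp w h = tp w' h"
  by (simp add: tp_def)

text \<open>A point is described by every word that continues the path beyond it. The formula holds
  for all descriptions, since cutting the words at the rounded heights does not change the minimum
  with the heights.\<close>

lemma tree_dist_tp:
  assumes "ok w h" "ok w' h'"
  shows "tree_dist (tp w h) (tp w' h') = h + h' - 2 * min (min h h') (real (lcp w w'))"
proof -
  have "h \<le> real (nat \<lceil>h\<rceil>)" "h' \<le> real (nat \<lceil>h'\<rceil>)" using assms by (auto simp: ok_def)
  then have "min (min h h') (real (min (min (nat \<lceil>h\<rceil>) (nat \<lceil>h'\<rceil>)) (lcp w w'))) = min (min h h') (real (lcp w w'))"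
    unfolding of_nat_min by linarith
  then show ?thesis using assms by (simp only: tree_dist_def decode ok_def lcp_take)
qed

lemma tp_agree: "h \<le> real (lcp w w') \<Longrightarrow> tp w h = tp w' h"
  by (intro tp_cong take_lcp) (simp add: nat_le_iff ceiling_le_iff)

lemma tp_in: "ok w h \<Longrightarrow> tp w h \<in> tree_set" by (auto simp: tree_set_def)

lemma tree_cases:
  assumes "u \<in> tree_set" obtains w h where "ok w h" "u = tp w h"
  using assms by (auto simp: tree_set_def)

lemma Metric_space_tree: "Metric_space tree_set tree_dist"
proof
  fix u v
  show "0 \<le> tree_dist u v" unfolding tree_dist_def by (auto simp: min_def)
  show "tree_dist u v = tree_dist v u"
    by (simp add: tree_dist_def lcp_commute[of "word u"] min.commute[of "level u"])
next
  fix u v assume "u \<in> tree_set" "v \<in> tree_set"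
  then obtain w h w' h' where w: "ok w h" "u = tp w h" "ok w' h'" "v = tp w' h'" unfolding tree_set_def by blast
  show "tree_dist u v = 0 \<longleftrightarrow> u = v"
  proof
    assume "tree_dist u v = 0"
    then have "h + h' - 2 * min (min h h') (real (lcp w w')) = 0" using w tree_dist_tp by simp
    then have "h' = h" "h \<le> real (lcp w w')" by (auto simp: min_def split: if_splits)
    then show "u = v" using tp_agree w by simp
  next
    assume "u = v"
    then have "tree_dist u v = tree_dist (tp w h) (tp w h)" using w by simp
    also have "\<dots> = 0" unfolding tree_dist_tp[OF w(1) w(1)] using w(1) by (simp add: ok_def)
    finally show "tree_dist u v = 0" .
  qed
next
  fix u v x assume "u \<in> tree_set" "v \<in> tree_set" "x \<in> tree_set"
  then obtain w h w' h' w'' h'' where w: "ok w h" "u = tp w h" "ok w' h'" "v = tp w' h'" "ok w'' h''" "x = tp w'' h''"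
    unfolding tree_set_def by blast
  have "min (real (lcp w w')) (real (lcp w' w'')) \<le> real (lcp w w'')"
    using lcp_ultrametric[of w w' w''] unfolding of_nat_min[symmetric] of_nat_le_iff .
  then show "tree_dist u x \<le> tree_dist u v + tree_dist v x"
    unfolding w(2,4,6) tree_dist_tp[OF w(1,3)] tree_dist_tp[OF w(3,5)] tree_dist_tp[OF w(1,5)]
    by linarith
qed

definition tree :: "real metric" where "tree = metric (tree_set, tree_dist)"

lemma mspace_tree [simp]: "mspace tree = tree_set"
  by (simp add: tree_def Metric_space.mspace_metric Metric_space_tree)

lemma mdist_tree [simp]: "mdist tree = tree_dist"
  by (simp add: tree_def Metric_space.mdist_metric Metric_space_tree)

lemma tree_dist_same: "ok w s \<Longrightarrow> ok w t \<Longrightarrow> tree_dist (tp w s) (tp w t) = \<bar>s - t\<bar>"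
  by (simp add: tree_dist_tp) (auto simp: ok_def min_def)

lemma geodesic_space_tree: "geodesic_space tree"
proof -
  have "joined tree u v" if uv: "u \<in> tree_set" "v \<in> tree_set" for u v
  proof -
    obtain w h w' h' where w: "ok w h" "u = tp w h" "ok w' h'" "v = tp w' h'" using uv unfolding tree_set_def by blast
    \<comment> \<open>This is the height of the branching point, through which the geodesic
      passes.\<close>
    define g where "g = min (min h h') (real (lcp w w'))"
    have g: "0 \<le> g" "g \<le> h" "g \<le> h'" "g \<le> real (lcp w w')" using w by (auto simp: g_def ok_def)
    have iso: "isometric_on tree {g..k} (tp x)" if "ok x k" for x k
    proof -
      have "ok x s" if "s \<in> {g..k}" for s using that g(1) \<open>ok x k\<close> by (auto simp: ok_def)
      then show ?thesis by (auto simp: isometric_on_def tp_in tree_dist_same)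
    qed
    have 1: "joined tree u (tp w g)" unfolding w(2)
      by (rule joined_isometric[OF iso[OF w(1)]]) (use g in auto)
    have 2: "joined tree (tp w' g) v" unfolding w(4)
      by (rule joined_isometric[OF iso[OF w(3)]]) (use g in auto)
    have eq: "tp w g = tp w' g" using g(4) by (rule tp_agree)
    have okg: "ok w g" "ok w' g" using w g by (auto simp: ok_def)
    have "tree_dist u v = tree_dist u (tp w g) + tree_dist (tp w' g) v"
      unfolding w(2,4) tree_dist_same[OF w(1) okg(1)] tree_dist_same[OF okg(2) w(3)] tree_dist_tp[OF w(1,3)]
      using g by (simp flip: g_def)
    then show ?thesis using joined_trans[OF 1, of v] 2 by (simp add: eq)
  qed
  then show ?thesis by (simp add: geodesic_space_joined)
qed

section \<open>Contractibility of the tree\<close>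

lemma ok_Nil: "ok [] 0" by (simp add: ok_def redl_def)

text \<open>Each point slides down to the root along its path, its height being scaled by
  \<open>1 - s\<close>.\<close>

lemma contractible_tree: "contractible_space (mtopology_of tree)"
proof -
  let ?I = "{0..1::real}"
  define H where "H = (\<lambda>(s, u). tp (word u) ((1 - s) * level u))"
  have H: "H (s, tp w h) = tp w ((1 - s) * h) \<and> ok w ((1 - s) * h)" if "ok w h" "s \<in> ?I" for s w h
  proof -
    have h: "0 \<le> h" "h \<le> real (length w)" using that by (auto simp: ok_def)
    have sh: "0 \<le> (1 - s) * h" "(1 - s) * h \<le> h" using that h by (auto simp: mult_left_le_one_le)
    then have "(1 - s) * h \<le> real (nat \<lceil>h\<rceil>)" using real_nat_ceiling_ge[of h] by linarith
    then have "tp (take (nat \<lceil>h\<rceil>) w) ((1 - s) * h) = tp w ((1 - s) * h)"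
      by (intro tp_cong) (simp add: min_absorb1)
    then show ?thesis using that h sh by (simp add: H_def decode ok_def)
  qed
  have mt: "mtopology_of tree = Metric_space.mtopology (mspace tree) (mdist tree)" by (simp only: mtopology_of_def)
  have "continuous_map (prod_topology (top_of_set ?I) (mtopology_of tree)) (mtopology_of tree) H"
    unfolding mt
  proof (subst Metric_space.continuous_map_to_metric[OF Metric_space_mspace_mdist], intro ballI allI impI)
    fix x :: "real \<times> real" and \<epsilon> :: real
    assume x: "x \<in> topspace (prod_topology (top_of_set ?I) (Metric_space.mtopology (mspace tree) (mdist tree)))" and \<epsilon>: "\<epsilon> > 0"
    obtain s u where su: "x = (s, u)" by (cases x)
    have s: "s \<in> ?I" and u: "u \<in> tree_set"
      using x by (auto simp: su Metric_space.topspace_mtopology[OF Metric_space_tree])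
    obtain w h where w: "ok w h" "u = tp w h" using u by (rule tree_cases)
    have h0: "0 \<le> h" using w by (simp add: ok_def)
    \<comment> \<open>A change of \<open>s\<close> moves the height by at most
      \<open>\<delta> * h\<close>, whence the second bound; \<open>h + 1\<close> avoids a division
      by 0.\<close>
    define \<delta> where "\<delta> = min (\<epsilon> / 2) (\<epsilon> / (2 * (h + 1)))"
    have \<delta>: "\<delta> > 0" "\<delta> \<le> \<epsilon> / 2"
    proof -
      show "\<delta> > 0" using \<epsilon> h0 by (simp add: \<delta>_def)
      show "\<delta> \<le> \<epsilon> / 2" unfolding \<delta>_def by (rule min.cobounded1)
    qed
    have \<delta>h: "\<delta> * h \<le> \<epsilon> / 2"
    proof -
      have "\<delta> * h \<le> \<epsilon> / (2 * (h + 1)) * (h + 1)" using \<epsilon> h0 by (intro mult_mono) (auto simp: \<delta>_def)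
      also have "\<dots> = \<epsilon> / 2" using h0 by (simp add: field_simps)
      finally show ?thesis .
    qed
    define U where "U = (?I \<inter> ball s \<delta>) \<times> mball_of tree u \<delta>"
    have "openin (prod_topology (top_of_set ?I) (Metric_space.mtopology (mspace tree) (mdist tree))) U"
      unfolding U_def openin_prod_Times_iff
      by (intro disjI2 conjI openin_open_Int open_ball) (simp add: mball_of_def Metric_space.openin_mball[OF Metric_space_tree])
    moreover have "x \<in> U"
      using s u \<delta> mdist_zero[of u tree u] by (simp add: U_def su)
    moreover have "H y \<in> Metric_space.mball (mspace tree) (mdist tree) (H x) \<epsilon>" if y: "y \<in> U" for y
    proof -
      obtain t v where tv: "y = (t, v)" by (cases y)
      have t: "t \<in> ?I" "\<bar>s - t\<bar> < \<delta>" and v: "v \<in> tree_set" "tree_dist u v < \<delta>"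
        using y by (auto simp: U_def tv dist_real_def)
      obtain w' h' where w': "ok w' h'" "v = tp w' h'" using v(1) by (rule tree_cases)
      define L L' where "L = (1 - s) * h" and "L' = (1 - t) * h'"
      have d: "tree_dist u v = h + h' - 2 * min (min h h') (real (lcp w w'))"
        unfolding w(2) w'(2) by (rule tree_dist_tp[OF w(1) w'(1)])
      have hd: "\<bar>h - h'\<bar> \<le> tree_dist u v" unfolding d by (auto simp: min_def)
      have h'0: "0 \<le> h'" using w' by (simp add: ok_def)
      have Lh: "L \<le> h" "L' \<le> h'" unfolding L_def L'_def using s t h0 h'0 by (simp_all add: mult_left_le_one_le)
      define p q where "p = (t - s) * h" and "q = (1 - t) * (h - h')"
      have "L - L' = p + q" by (simp add: L_def L'_def p_def q_def algebra_simps)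
      then have pq: "\<bar>L - L'\<bar> \<le> \<bar>p\<bar> + \<bar>q\<bar>" by (simp only: abs_triangle_ineq)
      have "\<bar>p\<bar> \<le> \<delta> * h"
        unfolding p_def abs_mult abs_of_nonneg[OF h0] using t h0 by (intro mult_right_mono) auto
      then have "\<bar>p\<bar> \<le> \<epsilon> / 2" using \<delta>h by (rule order_trans)
      moreover have "\<bar>q\<bar> \<le> 1 * \<bar>h - h'\<bar>"
        unfolding q_def abs_mult using t by (intro mult_right_mono) auto
      then have "\<bar>q\<bar> \<le> tree_dist u v" using hd by (simp only: mult_1)
      then have "\<bar>q\<bar> < \<epsilon> / 2" by (rule le_less_trans[OF _ less_le_trans[OF v(2) \<delta>(2)]])
      ultimately have "\<bar>p\<bar> + \<bar>q\<bar> < \<epsilon> / 2 + \<epsilon> / 2" by (rule add_le_less_mono)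
      with pq have LL: "\<bar>L - L'\<bar> < \<epsilon>" by simp
      have HH: "H x = tp w L" "ok w L" "H y = tp w' L'" "ok w' L'"
        using H[OF w(1) s] H[OF w'(1) t(1)] by (simp_all only: su tv w(2) w'(2) L_def L'_def)
      have "tree_dist (H x) (H y) = L + L' - 2 * min (min L L') (real (lcp w w'))"
        unfolding HH(1,3) by (rule tree_dist_tp[OF HH(2,4)])
      also have "\<dots> < \<epsilon>"
      \<comment> \<open>Either the moved points lie on a common path and only their heights count,
        or they still part where the original points did and are no farther apart.\<close>
      proof (cases "min L L' \<le> real (lcp w w')")
        case True
        then show ?thesis using LL by linarith
      next
        case False
        then have "L + L' - 2 * min (min L L') (real (lcp w w')) \<le> tree_dist u v" unfolding d using Lh by linarith
        then show ?thesis using v \<delta> \<epsilon> by linarith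
      qed
      finally show ?thesis using HH by (simp add: Metric_space.in_mball[OF Metric_space_tree] tp_in)
    qed
    ultimately show "\<exists>U. openin (prod_topology (top_of_set ?I) (Metric_space.mtopology (mspace tree) (mdist tree))) U \<and>
        x \<in> U \<and> (\<forall>y\<in>U. H y \<in> Metric_space.mball (mspace tree) (mdist tree) (H x) \<epsilon>)"
      by (intro exI[of _ U] conjI ballI)
  qed
  moreover have ends: "H (0, u) = id u" "H (1, u) = tp [] 0" if u: "u \<in> tree_set" for u
  proof -
    obtain w h where w: "ok w h" "u = tp w h" using u by (rule tree_cases)
    show "H (0, u) = id u" using H[OF w(1), of 0] by (simp add: w)
    show "H (1, u) = tp [] 0" using H[OF w(1), of 1] tp_agree[of 0 w "[]"] by (simp add: w)
  qed
  ultimately have "homotopic_with (\<lambda>x. True) (mtopology_of tree) (mtopology_of tree) id (\<lambda>x. tp [] 0)"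
    by (intro homotopic_with[THEN iffD2] exI[of _ H] conjI ballI refl TrueI) (simp_all only: topspace_mtopology_of mspace_tree ends)
  then show ?thesis unfolding contractible_space_def by blast
qed

section \<open>The projection of the tree onto the rose\<close>

definition tree_proj :: "real \<Rightarrow> real set" where
  "tree_proj u = (if word u = [] then pt (False, True) 0
     else pt (last (word u)) (level u - (real (length (word u)) - 1)))"

text \<open>At height \<open>k\<close> the definition reads the incoming edge at parameter 1, or the
  convention for the root, while the formula reads the outgoing edge at parameter 0; all of these
  are the vertex of the rose.\<close>

lemma tree_proj_tp:
  assumes "ok w h" "k < length w" "real k \<le> h" "h \<le> real k + 1"
  shows "tree_proj (tp w h) = pt (w ! k) (h - real k)"
proof -
  have h: "0 \<le> h" "h \<le> real (length w)" using assms by (auto simp: ok_def)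
  show ?thesis
  proof (cases "h = real k")
    case True
    show ?thesis
    proof (cases k)
      case 0
      then have "word (tp w h) = []" using decode(1)[OF h] True by simp
      then show ?thesis using True 0 pt_0[of "(False, True)" "w ! 0"] by (simp add: tree_proj_def)
    next
      case (Suc j)
      have wd: "word (tp w h) = take k w" "level (tp w h) = real k" using decode[OF h] True by simp_all
      have "last (take k w) = w ! j" using assms(2) Suc by (simp add: take_Suc_conv_app_nth)
      moreover have "length (take k w) = k" "take k w \<noteq> []" using assms(2) Suc by auto
      ultimately have "tree_proj (tp w h) = pt (w ! j) 1" unfolding tree_proj_def wd by simp
      then show ?thesis using True pt_1[of "w ! j" "w ! k"] by simp
    qed
  next
    case False
    then have "\<lceil>h\<rceil> = int k + 1" using assms by (intro ceiling_unique) auto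
    then have n: "nat \<lceil>h\<rceil> = Suc k" by simp
    have wd: "word (tp w h) = take k w @ [w ! k]" "level (tp w h) = h"
      using decode[OF h] n assms(2) by (simp_all add: take_Suc_conv_app_nth)
    then show ?thesis unfolding tree_proj_def wd using assms(2) by simp
  qed
qed

text \<open>The edges at the vertex \<open>w\<close>; the one labelled by the inverse of the last letter of \<open>w\<close> leads back.\<close>

definition edge :: "letter list \<Rightarrow> letter \<Rightarrow> real \<Rightarrow> real" where
  "edge w l \<sigma> = (if w \<noteq> [] \<and> last w = linv l then tp w (real (length w) - \<sigma>) else tp (w @ [l]) (real (length w) + \<sigma>))"

lemma redl_snoc: "redl (w @ [l]) \<longleftrightarrow> redl w \<and> (w = [] \<or> last w \<noteq> linv l)"
proof -
  have "l \<noteq> linv (last w) \<longleftrightarrow> last w \<noteq> linv l" using linv_linv by metis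
  then show ?thesis by (cases "w = []") (simp_all add: redl_def successively_append_iff)
qed

lemma edge_cases:
  assumes "redl w" "0 \<le> \<sigma>" "\<sigma> \<le> 1"
  obtains "w \<noteq> []" "last w = linv l" "edge w l \<sigma> = tp w (real (length w) - \<sigma>)" "ok w (real (length w) - \<sigma>)"
  | "w = [] \<or> last w \<noteq> linv l" "edge w l \<sigma> = tp (w @ [l]) (real (length w) + \<sigma>)" "ok (w @ [l]) (real (length w) + \<sigma>)"
proof (cases "w \<noteq> [] \<and> last w = linv l")
  case True
  then have "1 \<le> length w" by (simp add: Suc_le_eq)
  then have "1 \<le> real (length w)" by linarith
  then have "ok w (real (length w) - \<sigma>)" using assms by (simp add: ok_def)
  moreover have "edge w l \<sigma> = tp w (real (length w) - \<sigma>)" unfolding edge_def if_P[OF True] ..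
  ultimately show ?thesis using that(1) True by blast
next
  case False
  then have "redl (w @ [l])" using assms(1) by (simp add: redl_snoc)
  then have "ok (w @ [l]) (real (length w) + \<sigma>)" using assms by (simp add: ok_def)
  moreover have "edge w l \<sigma> = tp (w @ [l]) (real (length w) + \<sigma>)" unfolding edge_def if_not_P[OF False] ..
  ultimately show ?thesis using that(2) False by blast
qed

lemma edge_in: "\<lbrakk>redl w; 0 \<le> \<sigma>; \<sigma> \<le> 1\<rbrakk> \<Longrightarrow> edge w l \<sigma> \<in> tree_set"
  by (rule edge_cases[of w \<sigma> l]) (auto simp: tp_in)

lemma tree_proj_edge:
  assumes "redl w" "0 \<le> \<sigma>" "\<sigma> \<le> 1"
  shows "tree_proj (edge w l \<sigma>) = pt l \<sigma>"
  using assms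
proof (cases rule: edge_cases[where l = l])
  case 1
  define k where "k = length w - 1"
  have lw: "length w = Suc k" using 1(1) by (simp add: k_def)
  have k: "k < length w" "real (length w) = real k + 1" "w ! k = linv l"
    using 1(1,2) lw by (simp_all add: last_conv_nth)
  have "tree_proj (tp w (real (length w) - \<sigma>)) = pt (w ! k) (real (length w) - \<sigma> - real k)"
    by (rule tree_proj_tp[OF 1(4) k(1)]) (use k assms in auto)
  then show ?thesis using k by (simp add: 1(3) pt_linv)
next
  case 2
  have "tree_proj (tp (w @ [l]) (real (length w) + \<sigma>)) = pt ((w @ [l]) ! length w) (real (length w) + \<sigma> - real (length w))"
    by (rule tree_proj_tp[OF 2(3)]) (use assms in auto)
  then show ?thesis by (simp add: 2(2))
qed

text \<open>The four edges at a vertex form a star with the letters as rays, as in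
  \<open>dist_pt_star\<close>, but up to radius 1.\<close>

lemma dist_edge:
  assumes w: "redl w" and \<sigma>: "0 \<le> \<sigma>" "\<sigma> \<le> 1" "0 \<le> \<tau>" "\<tau> \<le> 1"
  shows "tree_dist (edge w l \<sigma>) (edge w m \<tau>) = (if l = m then \<bar>\<sigma> - \<tau>\<bar> else \<sigma> + \<tau>)"
proof (cases rule: edge_cases[OF w \<sigma>(1,2), of l, case_names b f])
  case b
  show ?thesis
  proof (cases rule: edge_cases[OF w \<sigma>(3,4), of m, case_names b' f'])
    case b'
    then have "l = m" using b by (metis linv_linv)
    then show ?thesis unfolding b(3) b'(3) tree_dist_same[OF b(4) b'(4)] by simp
  next
    case f'
    then have "l \<noteq> m" using b by auto
    moreover have "lcp w (w @ [m]) = length w" using lcp_append[of w "[]" "[m]"] by simp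
    ultimately show ?thesis unfolding b(3) f'(2) tree_dist_tp[OF b(4) f'(3)] using \<sigma> by simp
  qed
next
  case f
  show ?thesis
  proof (cases rule: edge_cases[OF w \<sigma>(3,4), of m, case_names b' f'])
    case b'
    then have "l \<noteq> m" using f by auto
    moreover have "lcp (w @ [l]) w = length w" using lcp_append[of w "[l]" "[]"] by simp
    ultimately show ?thesis unfolding f(2) b'(3) tree_dist_tp[OF f(3) b'(4)] using \<sigma> by simp
  next
    case f'
    show ?thesis
    proof (cases "l = m")
      case True
      then show ?thesis unfolding f(2) f'(2) using tree_dist_same[of "w @ [m]"] f(3) f'(3) by simp
    next
      case False
      then have "lcp (w @ [l]) (w @ [m]) = length w" by (simp add: lcp_append)
      then show ?thesis unfolding f(2) f'(2) tree_dist_tp[OF f(3) f'(3)] using \<sigma> False by simp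
    qed
  qed
qed

lemma ok_vertex: "redl w \<Longrightarrow> ok w (real (length w))" by (simp add: ok_def)

lemma edge_0: "edge w l 0 = tp w (real (length w))"
  unfolding edge_def by (auto intro!: tp_cong)

lemma edge_ball:
  assumes w: "redl w" and v: "v \<in> tree_set" and d: "tree_dist (tp w (real (length w))) v \<le> 1"
  obtains l where "v = edge w l (tree_dist (tp w (real (length w))) v)"
proof -
  obtain w' h where w': "ok w' h" "v = tp w' h" using v by (rule tree_cases)
  define n where "n = lcp w w'"
  have n: "n \<le> length w" "n \<le> length w'" using lcp_le by (auto simp: n_def)
  have h: "0 \<le> h" "h \<le> real (length w')" "redl w'" using w' by (auto simp: ok_def)
  have dd: "tree_dist (tp w (real (length w))) v = real (length w) + h - 2 * min h (real n)"
    unfolding w'(2) tree_dist_tp[OF ok_vertex[OF w] w'(1)] using n by (simp add: n_def[symmetric] min_def)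
  show ?thesis
  proof (cases "h \<le> real n")
    case True
    then have v': "v = tp w h" using tp_agree[of h w w'] w' by (simp add: n_def)
    have dw: "tree_dist (tp w (real (length w))) v = real (length w) - h" unfolding dd using True by simp
    show ?thesis
    proof (cases "w = []")
      case True
      then have "h = 0" using \<open>h \<le> real n\<close> n h by simp
      then show ?thesis using that[of "(False, True)"] dw True v' edge_0[of "[]" "(False, True)"] by simp
    next
      case False
      then have "edge w (linv (last w)) (real (length w) - h) = tp w h" by (simp add: edge_def)
      then show ?thesis using that[of "linv (last w)"] dw v' by simp
    qed
  next
    case False
    then have dw: "tree_dist (tp w (real (length w))) v = real (length w - n) + (h - real n)" unfolding dd using n by simp
    \<comment> \<open>If the paths parted strictly before \<open>w\<close>, the way from
      \<open>w\<close> to the branching point would have length at least 1, and a further piece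
      towards \<open>v\<close> would follow.\<close>
    have "length w = n"
    proof (rule ccontr)
      assume "length w \<noteq> n"
      then have "1 \<le> real (length w - n)" using n by simp
      then show False using dw d False by linarith
    qed
    then have n_eq: "n = length w" by simp
    have "take n w = take n w'" by (rule take_lcp) (simp add: n_def)
    then have pre: "take (length w) w' = w" using n_eq by simp
    have len: "length w < length w'" using False h n_eq by linarith
    define l where "l = w' ! length w"
    have tk: "take (Suc (length w)) w' = w @ [l]" using len pre by (simp add: take_Suc_conv_app_nth l_def)
    then have "redl (w @ [l])" using h(3) unfolding redl_def by (metis append_take_drop_id successively_append_iff)
    then have nb: "\<not> (w \<noteq> [] \<and> last w = linv l)" by (simp add: redl_snoc)
    have "h \<le> real (Suc (length w))" using d dw n_eq by simp
    then have "nat \<lceil>h\<rceil> \<le> Suc (length w)" by (simp add: nat_le_iff ceiling_le_iff)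
    then have "take (nat \<lceil>h\<rceil>) w' = take (nat \<lceil>h\<rceil>) (take (Suc (length w)) w')" by (simp add: min_absorb1)
    then have "v = tp (w @ [l]) h" unfolding w'(2) tk by (rule tp_cong)
    then have "v = edge w l (tree_dist (tp w (real (length w))) v)"
      unfolding dw edge_def if_not_P[OF nb] using n_eq by simp
    then show ?thesis by (rule that)
  qed
qed

lemma tree_near_vertex:
  assumes "u \<in> tree_set"
  obtains w l \<sigma> where "redl w" "0 \<le> \<sigma>" "\<sigma> \<le> 1/2" "u = edge w l \<sigma>"
proof -
  obtain w h where w: "ok w h" "u = tp w h" using assms by (rule tree_cases)
  have h: "0 \<le> h" "h \<le> real (length w)" "redl w" using w by (auto simp: ok_def)
  \<comment> \<open>Rounding the height gives a vertex of the path at distance at most 1/2.\<close>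
  define m where "m = nat \<lfloor>h + 1/2\<rfloor>"
  have "\<lfloor>h + 1/2\<rfloor> \<ge> 0" using h by simp
  then have m: "real m \<le> h + 1/2" "h + 1/2 < real m + 1" unfolding m_def by linarith+
  have mw: "m \<le> length w" using m h by linarith
  define v where "v = take m w"
  have v: "redl v" "length v = m"
    using h(3) mw unfolding v_def redl_def by (metis append_take_drop_id successively_append_iff, simp)
  have "tp v (real (length v)) = tp w (real m)" unfolding v by (rule tp_cong) (simp add: v_def)
  moreover have "ok w (real m)" using h mw by (simp add: ok_def)
  ultimately have d: "tree_dist (tp v (real (length v))) u = \<bar>real m - h\<bar>" using w by (simp add: tree_dist_same)
  have half: "\<bar>real m - h\<bar> \<le> 1/2" using m by linarith
  then obtain l where "u = edge v l (tree_dist (tp v (real (length v))) u)"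
    using edge_ball[OF v(1) assms] d by auto
  then show ?thesis using that[OF v(1), of "\<bar>real m - h\<bar>" l] half d by simp
qed

text \<open>Points closer than 1/4 lie in the star of one vertex of the tree: one within 1/2 of it,
  the other within 3/4. The rays of the star carry the same letters as those at the vertex of the
  rose, and for small distances the two metrics agree.\<close>

interpretation tree: local_isometry tree rose tree_proj "1/4"
proof
  show "tree_proj ` mspace tree = mspace rose"
  proof (intro equalityI subsetI)
    fix x assume "x \<in> tree_proj ` mspace tree"
    then obtain u where "u \<in> tree_set" "x = tree_proj u" by auto
    then show "x \<in> mspace rose"
    proof (elim tree_near_vertex)
      fix w l \<sigma> assume "x = tree_proj u" "redl w" "0 \<le> \<sigma>" "\<sigma> \<le> 1/2" "u = edge w l \<sigma>"
      then show ?thesis using tree_proj_edge[of w \<sigma> l] pt_in[of \<sigma> l] by simp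
    qed
  next
    fix x assume "x \<in> mspace rose"
    then obtain l \<sigma> where "0 \<le> \<sigma>" "\<sigma> \<le> 1/2" "x = pt l \<sigma>" by (rule pt_surj)
    then have "x = tree_proj (edge [] l \<sigma>)" "edge [] l \<sigma> \<in> tree_set"
      using tree_proj_edge[of "[]" \<sigma> l] edge_in[of "[]" \<sigma> l] by (auto simp: redl_def)
    then show "x \<in> tree_proj ` mspace tree" by simp
  qed
next
  fix u v assume uv: "u \<in> mspace tree" "v \<in> mspace tree" and d: "mdist tree u v < 1/4"
  obtain w l \<sigma> where u: "redl w" "0 \<le> \<sigma>" "\<sigma> \<le> 1/2" "u = edge w l \<sigma>" using uv by (auto elim: tree_near_vertex)
  define \<tau> where "\<tau> = tree_dist (tp w (real (length w))) v"
  have "tree_dist (tp w (real (length w))) u = \<sigma>"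
    using dist_edge[OF u(1), of 0 \<sigma> l l] u by (simp add: edge_0)
  then have \<tau>: "0 \<le> \<tau>" "\<tau> \<le> 3/4"
    using mdist_triangle[of "tp w (real (length w))" tree u v] uv d u tp_in[OF ok_vertex[OF u(1)]] mdist_nonneg[of tree]
    by (auto simp: \<tau>_def)
  then obtain m where v: "v = edge w m \<tau>" using edge_ball[OF u(1), of v] uv by (auto simp: \<tau>_def)
  have td: "tree_dist u v = (if l = m then \<bar>\<sigma> - \<tau>\<bar> else \<sigma> + \<tau>)"
    unfolding u(4) v using u \<tau> by (intro dist_edge) auto
  have proj: "tree_proj u = pt l \<sigma>" "tree_proj v = pt m \<tau>"
    using tree_proj_edge[OF u(1), of \<sigma> l] tree_proj_edge[OF u(1), of \<tau> m] u \<tau> v by simp_all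
  show "mdist rose (tree_proj u) (tree_proj v) = mdist tree u v"
  proof (cases "l = m")
    case True
    then have "\<bar>\<sigma> - \<tau>\<bar> < 1/4" using td d by simp
    then show ?thesis unfolding proj mdist_tree td using True u \<tau> by (simp add: dist_pt_near)
  next
    case False
    then have "\<sigma> + \<tau> < 1/4" using td d by simp
    then show ?thesis unfolding proj mdist_tree td using False u \<tau> by (simp add: dist_pt_star)
  qed
next
  fix u x assume u: "u \<in> mspace tree" and x: "x \<in> mspace rose" and d: "mdist rose (tree_proj u) x < 1/4"
  obtain w l \<sigma> where w: "redl w" "0 \<le> \<sigma>" "\<sigma> \<le> 1/2" "u = edge w l \<sigma>" using u by (auto elim: tree_near_vertex)
  have proj: "tree_proj u = pt l \<sigma>" unfolding w(4) using w by (intro tree_proj_edge) auto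
  have v: "\<exists>v\<in>mspace tree. tree_proj v = x \<and> mdist tree u v = mdist rose (tree_proj u) x"
    if "x = pt m \<tau>" "0 \<le> \<tau>" "\<tau> \<le> 1" "mdist rose (pt l \<sigma>) (pt m \<tau>) = (if l = m then \<bar>\<sigma> - \<tau>\<bar> else \<sigma> + \<tau>)" for m \<tau>
    using that w proj by (intro bexI[of _ "edge w m \<tau>"]) (auto simp: tree_proj_edge dist_edge edge_in)
  obtain m \<tau> where m: "0 \<le> \<tau>" "\<tau> \<le> 1/2" "x = pt m \<tau>" using x by (rule pt_surj)
  consider "m = l" | "m = linv l" | "fst m \<noteq> fst l" using letter_cases by blast
  then show "\<exists>v\<in>mspace tree. tree_proj v = x \<and> mdist tree u v = mdist rose (tree_proj u) x"
  proof cases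
    case 1
    have "\<bar>\<sigma> - \<tau>\<bar> \<le> 1/2" using m w by linarith
    then show ?thesis using v[of l \<tau>] dist_pt_near[of \<sigma> \<tau> l] m w 1 by simp
  next
    case 2
    have x': "x = pt l (1 - \<tau>)" unfolding m(3) 2 by (rule pt_linv)
    have c: "mdist rose (pt l \<sigma>) (pt l (1 - \<tau>)) = circ \<sigma> (1 - \<tau>)" using m w by (intro dist_pt_same) auto
    show ?thesis
    \<comment> \<open>The shorter arc from the image of \<open>u\<close> to \<open>x\<close> runs
      along the petal of \<open>l\<close> or through the vertex; accordingly the lift lies on the
      edge of \<open>l\<close> or on that of \<open>linv l\<close>.\<close>
    proof (cases "circ \<sigma> (1 - \<tau>) = \<bar>\<sigma> - (1 - \<tau>)\<bar>")
      case True
      then show ?thesis using v[of l "1 - \<tau>"] x' c m by simp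
    next
      case False
      then have "circ \<sigma> (1 - \<tau>) = \<sigma> + \<tau>" using m w by (auto simp: circ_def min_def)
      then show ?thesis using v[of m \<tau>] x' c m 2 by simp
    qed
  next
    case 3
    have "mdist rose (pt l \<sigma>) (pt m \<tau>) = hgt \<sigma> + hgt \<tau>" using m w 3 by (intro dist_pt_other) auto
    moreover have "hgt \<sigma> = \<sigma>" "hgt \<tau> = \<tau>" using m w by (auto simp: hgt_def)
    moreover have "l \<noteq> m" using 3 by blast
    ultimately show ?thesis using v[of m \<tau>] m by simp
  qed
qed simp

lemma universal_cover_tree: "universal_cover tree tree_proj rose"
  using geodesic_space_tree contractible_tree by (rule tree.universal_cover)

section \<open>Deck transformations\<close>

text \<open>Of the many descriptions of a point this is the one with the shortest word, which
  \<open>word\<close> and \<open>level\<close> recover.\<close>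

definition canon :: "letter list \<Rightarrow> real \<Rightarrow> bool" where
  "canon w h \<longleftrightarrow> redl w \<and> (if w = [] then h = 0 else real (length w) - 1 < h \<and> h \<le> real (length w))"

lemma canon_ok: "canon w h \<Longrightarrow> ok w h"
proof -
  assume c: "canon w h"
  show "ok w h"
  proof (cases "w = []")
    case False
    then have "1 \<le> length w" by (simp add: Suc_le_eq)
    then have "1 \<le> real (length w)" by linarith
    then show ?thesis using c False by (simp add: canon_def ok_def)
  qed (use c in \<open>simp add: canon_def ok_def\<close>)
qed

lemma canon_decode:
  assumes "canon w h" shows "word (tp w h) = w" "level (tp w h) = h"
proof -
  have h: "0 \<le> h" "h \<le> real (length w)" using canon_ok[OF assms] by (auto simp: ok_def)
  have "nat \<lceil>h\<rceil> = length w"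
  proof (cases "w = []")
    case False
    then have "\<lceil>h\<rceil> = int (length w)" using assms by (intro ceiling_unique) (auto simp: canon_def)
    then show ?thesis by simp
  qed (use assms in \<open>simp add: canon_def\<close>)
  then show "word (tp w h) = w" "level (tp w h) = h" using decode[OF h] by simp_all
qed

lemma redl_take: "redl w \<Longrightarrow> redl (take n w)"
  unfolding redl_def by (metis append_take_drop_id successively_append_iff)

lemma tree_canon:
  assumes "u \<in> tree_set" obtains w h where "canon w h" "u = tp w h"
proof -
  obtain w h where w: "ok w h" "u = tp w h" using assms by (rule tree_cases)
  then have h: "0 \<le> h" "h \<le> real (length w)" "redl w" by (auto simp: ok_def)
  define n where "n = nat \<lceil>h\<rceil>"
  have n: "h \<le> real n" "real n < h + 1" using h by (auto simp: n_def) linarith+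
  have "n \<le> length w" using h by (simp add: n_def nat_le_iff ceiling_le_iff)
  then have "canon (take n w) h" using n h by (auto simp: canon_def redl_take)
  moreover have "u = tp (take n w) h" unfolding w(2) by (rule tp_cong) (simp add: n_def)
  ultimately show ?thesis by (rule that)
qed

lemma tree_proj_canon:
  "canon w h \<Longrightarrow> tree_proj (tp w h) = (if w = [] then pt (False, True) 0 else pt (last w) (h - (real (length w) - 1)))"
  by (simp add: tree_proj_def canon_decode)

lemma redl_Cons: "redl (x # xs) \<longleftrightarrow> xs = [] \<or> hd xs \<noteq> linv x \<and> redl xs"
  by (simp add: redl_def successively_Cons)

lemma redl_Nil: "redl []" by (simp add: redl_def)

text \<open>
  Left multiplication by a letter. Only on the edge between the root and the vertex of the inverse
  letter, which is mapped to the edge from the root to the vertex of the letter, it changes the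
  orientation with respect to the root.
\<close>

definition tr :: "letter \<Rightarrow> real \<Rightarrow> real" where
  "tr a u = (let w = word u; h = level u in
     if w \<noteq> [] \<and> hd w = linv a then (if 1 \<le> h then tp (tl w) (h - 1) else tp [a] (1 - h)) else tp (a # w) (h + 1))"

lemma tr_cases:
  assumes c: "canon w h"
  obtains w' where "w = linv a # w'" "1 \<le> h" "tr a (tp w h) = tp w' (h - 1)" "canon w' (h - 1)" "w' = [] \<or> hd w' \<noteq> a"
  | "w = [linv a]" "0 < h" "h < 1" "tr a (tp w h) = tp [a] (1 - h)" "canon [a] (1 - h)"
  | "w = [] \<or> hd w \<noteq> linv a" "tr a (tp w h) = tp (a # w) (h + 1)" "canon (a # w) (h + 1)"
proof (cases "w \<noteq> [] \<and> hd w = linv a")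
  case True
  then obtain w' where w': "w = linv a # w'" by (cases w) auto
  have r: "redl w" "real (length w') < h" "h \<le> real (length w') + 1" using c by (auto simp: canon_def w')
  show ?thesis
  proof (cases "1 \<le> h")
    case h: True
    have t: "tr a (tp w h) = tp w' (h - 1)"
      unfolding tr_def Let_def canon_decode[OF c] using h by (simp add: w')
    have "w' = [] \<or> hd w' \<noteq> a \<and> redl w'" using r(1) unfolding w' redl_Cons by simp
    moreover from this have "canon w' (h - 1)"
    proof (cases "w' = []")
      case True
      then show ?thesis using r h by (simp add: canon_def redl_Nil)
    qed (use r in \<open>simp add: canon_def\<close>)
    ultimately show ?thesis using that(1)[OF w' h t] by blast
  next
    case h: False
    then have e: "w' = []" using r by (cases w') auto
    have t: "tr a (tp w h) = tp [a] (1 - h)"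
      unfolding tr_def Let_def canon_decode[OF c] using h by (simp add: w')
    have "canon [a] (1 - h)" using r h e by (simp add: canon_def redl_Cons)
    then show ?thesis using that(2) w' e t r h by simp
  qed
next
  case False
  have t: "tr a (tp w h) = tp (a # w) (h + 1)" unfolding tr_def Let_def canon_decode[OF c] if_not_P[OF False] ..
  have "redl (a # w)" using False c by (auto simp: redl_Cons canon_def)
  then have "canon (a # w) (h + 1)" using c by (auto simp: canon_def split: if_splits)
  then show ?thesis using that(3) t False by blast
qed

lemma tr_in: "u \<in> tree_set \<Longrightarrow> tr a u \<in> tree_set"
proof -
  assume "u \<in> tree_set"
  then obtain w h where w: "canon w h" "u = tp w h" by (rule tree_canon)
  show ?thesis unfolding w(2) by (rule tr_cases[OF w(1), of a]) (auto intro!: tp_in canon_ok)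
qed

lemma tr_inverse:
  assumes "u \<in> tree_set" shows "tr (linv a) (tr a u) = u"
proof -
  obtain w h where w: "canon w h" "u = tp w h" using assms by (rule tree_canon)
  show ?thesis
  proof (cases rule: tr_cases[OF w(1), of a])
    case (1 w')
    have ne: "\<not> (w' \<noteq> [] \<and> hd w' = linv (linv a))" using 1(5) by auto
    show ?thesis unfolding w(2) 1(3) unfolding tr_def Let_def canon_decode[OF 1(4)] if_not_P[OF ne] using 1(1) by simp
  next
    case 2
    then show ?thesis unfolding w(2) 2(4) by (simp add: tr_def canon_decode[OF 2(5)])
  next
    case 3
    have "1 \<le> h + 1" using canon_ok[OF w(1)] by (simp add: ok_def)
    then show ?thesis unfolding w(2) 3(2) by (simp add: tr_def canon_decode[OF 3(3)])
  qed
qed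

lemma tree_proj_tr:
  assumes "u \<in> tree_set" shows "tree_proj (tr a u) = tree_proj u"
proof -
  obtain w h where w: "canon w h" "u = tp w h" using assms by (rule tree_canon)
  show ?thesis
  proof (cases rule: tr_cases[OF w(1), of a])
    case (1 w')
    show ?thesis
    proof (cases "w' = []")
      case True
      then have "h = 1" using 1(2) w(1) by (simp add: canon_def 1(1))
      then show ?thesis unfolding w(2) 1(3) tree_proj_canon[OF 1(4)] tree_proj_canon[OF w(1)]
        using True 1(1) pt_1[of "linv a" "(False, True)"] by simp
    next
      case False
      then show ?thesis unfolding w(2) 1(3) tree_proj_canon[OF 1(4)] tree_proj_canon[OF w(1)]
        using 1(1) by simp
    qed
  next
    case 2
    then show ?thesis unfolding w(2) 2(4) tree_proj_canon[OF 2(5)] tree_proj_canon[OF w(1)] by (simp add: pt_linv)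
  next
    case 3
    show ?thesis
    proof (cases "w = []")
      case True
      then have "h = 0" using w(1) by (simp add: canon_def)
      then show ?thesis unfolding w(2) 3(2) tree_proj_canon[OF 3(3)] tree_proj_canon[OF w(1)]
        using True pt_1[of a "(False, True)"] by simp
    next
      case False
      then show ?thesis unfolding w(2) 3(2) tree_proj_canon[OF 3(3)] tree_proj_canon[OF w(1)]
        by (simp add: algebra_simps)
    qed
  qed
qed

lemma lcp_0: "xs = [] \<or> ys = [] \<or> hd xs \<noteq> hd ys \<Longrightarrow> lcp xs ys = 0"
  by (cases xs; cases ys) auto

text \<open>The cases place each point relative to the edge from the root to the vertex of
  \<open>linv a\<close>: at or beyond its far end, inside it, or on the side of the root. Two points
  beyond it, or two on the side of the root, change heights and common prefix by 1 together; in the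
  other cases the geodesic runs along a part of that edge, and its reversal balances the
  heights.\<close>

lemma tr_isometry:
  assumes "u \<in> tree_set" "v \<in> tree_set" shows "tree_dist (tr a u) (tr a v) = tree_dist u v"
proof -
  obtain w h where w: "canon w h" "u = tp w h" using assms(1) by (rule tree_canon)
  obtain x k where x: "canon x k" "v = tp x k" using assms(2) by (rule tree_canon)
  have nn: "0 \<le> h" "0 \<le> k" using canon_ok[OF w(1)] canon_ok[OF x(1)] by (auto simp: ok_def)
  note d = tree_dist_tp[OF canon_ok canon_ok]
  note d0 = d[OF w(1) x(1)]
  show ?thesis
  proof (cases rule: tr_cases[OF w(1), of a, case_names A B C])
    case (A w')
    show ?thesis
    proof (cases rule: tr_cases[OF x(1), of a, case_names A' B' C'])
      case (A' x')
      have "lcp w x = Suc (lcp w' x')" by (simp add: A(1) A'(1))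
      then show ?thesis unfolding w(2) x(2) A(3) A'(3) d0 d[OF A(4) A'(4)] by (simp add: min_def)
    next
      case B'
      have "lcp w x = 1" "lcp w' [a] = 0" using A(5) lcp_0[of w' "[a]"] by (auto simp: A(1) B'(1))
      then show ?thesis unfolding w(2) x(2) A(3) B'(4) d0 d[OF A(4) B'(5)] using A(2) B'(2,3) by simp
    next
      case C'
      have "lcp w x = 0" "lcp w' (a # x) = 0" using A(5) C'(1) by (auto intro!: lcp_0 simp: A(1))
      then show ?thesis unfolding w(2) x(2) A(3) C'(2) d0 d[OF A(4) C'(3)] using A(2) nn by simp
    qed
  next
    case B
    show ?thesis
    proof (cases rule: tr_cases[OF x(1), of a, case_names A' B' C'])
      case (A' x')
      have "lcp w x = 1" "lcp [a] x' = 0" using A'(5) lcp_0[of "[a]" x'] by (auto simp: B(1) A'(1))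
      then show ?thesis unfolding w(2) x(2) A'(3) B(4) d0 d[OF B(5) A'(4)] using A'(2) B(2,3) by simp
    next
      case B'
      have "lcp w x = 1" by (simp add: B(1) B'(1))
      then show ?thesis unfolding w(2) x(2) B'(4) B(4) d0 d[OF B(5) B'(5)] using B(2,3) B'(2,3) by (simp add: min_def)
    next
      case C'
      have "lcp w x = 0" using C'(1) by (auto intro!: lcp_0 simp: B(1))
      then show ?thesis unfolding w(2) x(2) C'(2) B(4) d0 d[OF B(5) C'(3)] using B(2,3) nn by simp
    qed
  next
    case C
    show ?thesis
    proof (cases rule: tr_cases[OF x(1), of a, case_names A' B' C'])
      case (A' x')
      have "lcp w x = 0" "lcp (a # w) x' = 0" using A'(5) C(1) by (auto intro!: lcp_0 simp: A'(1))
      then show ?thesis unfolding w(2) x(2) A'(3) C(2) d0 d[OF C(3) A'(4)] using A'(2) nn by simp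
    next
      case B'
      have "lcp w x = 0" using C(1) by (auto intro!: lcp_0 simp: B'(1))
      then show ?thesis unfolding w(2) x(2) C(2) B'(4) d0 d[OF C(3) B'(5)] using B'(2,3) nn by simp
    next
      case C'
      have "lcp (a # w) (a # x) = Suc (lcp w x)" by simp
      then show ?thesis unfolding w(2) x(2) C(2) C'(2) d0 d[OF C(3) C'(3)] by (simp add: min_def)
    qed
  qed
qed

section \<open>Deck transformations and their transitivity on the fibres\<close>

abbreviation deck :: "(real \<Rightarrow> real) set" where "deck \<equiv> deck_transformations tree tree_proj"

lemma tr_deck: "restrict (tr a) tree_set \<in> deck"
proof -
  have "bij_betw (restrict (tr a) tree_set) tree_set tree_set"
    by (rule bij_betw_byWitness[where f' = "tr (linv a)"])
      (use tr_inverse[of _ "linv a"] in \<open>auto simp: tr_in tr_inverse\<close>)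
  moreover from this have "homeomorphic_map (mtopology_of tree) (mtopology_of tree) (restrict (tr a) tree_set)"
    by (intro homeomorphic_map_isometry) (simp_all add: bij_betw_def tr_isometry)
  ultimately show ?thesis by (simp add: deck_transformations_def Bij_def tree_proj_tr)
qed

lemma id_deck: "restrict id tree_set \<in> deck"
proof -
  have "homeomorphic_map (mtopology_of tree) (mtopology_of tree) (restrict id tree_set)"
    by (rule homeomorphic_map_isometry) auto
  then show ?thesis by (simp add: deck_transformations_def Bij_def bij_betw_def inj_on_def)
qed

lemma compose_deck:
  assumes f: "f \<in> deck" and g: "g \<in> deck" shows "compose tree_set f g \<in> deck"
proof -
  have B: "f \<in> Bij tree_set" "g \<in> Bij tree_set" using f g by (auto simp: deck_transformations_def)
  have "homeomorphic_map (mtopology_of tree) (mtopology_of tree) (f \<circ> g)"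
    using f g by (intro homeomorphic_map_compose) (auto simp: deck_transformations_def)
  then have "homeomorphic_map (mtopology_of tree) (mtopology_of tree) (compose tree_set f g)"
    by (rule homeomorphic_map_eq) (simp add: compose_def)
  moreover have "tree_proj (compose tree_set f g x) = tree_proj x" if "x \<in> tree_set" for x
  proof -
    have "g x \<in> tree_set" using B(2) that by (auto simp: Bij_def bij_betw_def)
    then show ?thesis using f g that by (simp add: deck_transformations_def compose_def)
  qed
  ultimately show ?thesis using compose_Bij[OF B] by (simp add: deck_transformations_def)
qed

text \<open>The critical exponent depends on the deck group only through its orbits. These can be
  found by chains of single left multiplications, without determining the group.\<close>

definition moves :: "(real \<times> real) set" where "moves = {(u, tr a u) | u a. u \<in> tree_set}"

lemma movesI: "u \<in> tree_set \<Longrightarrow> (u, tr a u) \<in> moves"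
  unfolding moves_def by (intro CollectI exI[of _ u] exI[of _ a]) simp

lemma movesE:
  assumes "(u, v) \<in> moves" obtains a where "v = tr a u" "u \<in> tree_set"
  using assms by (auto simp: moves_def)

lemma moves_deck:
  assumes "(u, v) \<in> moves\<^sup>*" and u: "u \<in> tree_set"
  shows "v \<in> tree_set \<and> (\<exists>f\<in>deck. f u = v)"
  using assms(1)
proof (induction rule: rtrancl_induct)
  case base
  have "restrict id tree_set u = u" using u by simp
  then show ?case using id_deck u by (intro conjI bexI[of _ "restrict id tree_set"])
next
  case (step v x)
  obtain a where a: "x = tr a v" "v \<in> tree_set" using step.hyps(2) by (rule movesE)
  obtain f where f: "f \<in> deck" "f u = v" using step.IH by (elim conjE bexE)
  have "compose tree_set (restrict (tr a) tree_set) f u = x" using u f a by (simp add: compose_def)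
  moreover have "x \<in> tree_set" unfolding a(1) using a(2) by (rule tr_in)
  ultimately show ?case using compose_deck[OF tr_deck f(1), of a] by (intro conjI bexI)
qed

lemma sym_moves: "sym (moves\<^sup>*)"
proof (rule sym_rtrancl, rule symI)
  fix u v assume "(u, v) \<in> moves"
  then obtain a where a: "v = tr a u" "u \<in> tree_set" by (rule movesE)
  then have "(v, tr (linv a) v) \<in> moves" by (intro movesI) (simp add: tr_in)
  then show "(v, u) \<in> moves" using tr_inverse[OF a(2), of a] by (simp add: a(1))
qed

text \<open>Multiplication by the inverse of the first letter shortens the word until the root or an
  interior point of an edge at the root is left. In the latter case one more multiplication flips
  the edge, if necessary, so that its letter is positively oriented.\<close>

lemma moves_normal_form:
  assumes "canon w h"
  obtains "(tp w h, tp [] 0) \<in> moves\<^sup>*" | l s where "(tp w h, tp [l] s) \<in> moves\<^sup>*" "snd l" "0 < s" "s < 1" "canon [l] s"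
proof -
  have "(tp w h, tp [] 0) \<in> moves\<^sup>* \<or> (\<exists>l s. (tp w h, tp [l] s) \<in> moves\<^sup>* \<and> snd l \<and> 0 < s \<and> s < 1 \<and> canon [l] s)"
    using assms
  proof (induction w arbitrary: h)
    case Nil
    then have "h = 0" by (simp add: canon_def)
    then show ?case by simp
  next
    case (Cons a w)
    have mv: "(tp (a # w) h, tr (linv a) (tp (a # w) h)) \<in> moves"
      by (rule movesI[OF tp_in[OF canon_ok[OF Cons.prems]]])
    show ?case
    proof (cases rule: tr_cases[OF Cons.prems, of "linv a"])
      case (1 w')
      then have "(tp (a # w) h, tp w (h - 1)) \<in> moves" "canon w (h - 1)" using mv by simp_all
      note step = converse_rtrancl_into_rtrancl[OF this(1)] and IH = Cons.IH[OF this(2)]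
      show ?thesis
        using IH
      proof (elim disjE exE conjE)
        assume "(tp w (h - 1), tp [] 0) \<in> moves\<^sup>*"
        then show ?thesis by (intro disjI1 step)
      next
        fix l s assume "(tp w (h - 1), tp [l] s) \<in> moves\<^sup>*" "snd l" "0 < s" "s < 1" "canon [l] s"
        then show ?thesis by (intro disjI2 exI[of _ l] exI[of _ s] conjI step)
      qed
    next
      case 2
      show ?thesis
      proof (cases "snd a")
        case True
        then show ?thesis using 2(1-3) Cons.prems by (intro disjI2 exI[of _ a] exI[of _ h]) simp
      next
        case False
        then have "snd (linv a)" by (simp add: linv_def)
        moreover have "(tp (a # w) h, tp [linv a] (1 - h)) \<in> moves\<^sup>*" using mv 2(4) by auto
        ultimately show ?thesis using 2(2,3,5) by (intro disjI2 exI[of _ "linv a"] exI[of _ "1 - h"]) simp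
      qed
    next
      case 3
      then show ?thesis by simp
    qed
  qed
  then show ?thesis
  proof (elim disjE exE conjE)
    assume "(tp w h, tp [] 0) \<in> moves\<^sup>*"
    then show ?thesis by (rule that(1))
  next
    fix l s assume "(tp w h, tp [l] s) \<in> moves\<^sup>*" "snd l" "0 < s" "s < 1" "canon [l] s"
    then show ?thesis by (rule that(2))
  qed
qed

lemma moves_proj: "(u, v) \<in> moves\<^sup>* \<Longrightarrow> tree_proj v = tree_proj u"
proof (induction rule: rtrancl_induct)
  case (step v x)
  obtain a where a: "x = tr a v" "v \<in> tree_set" using step.hyps(2) by (rule movesE)
  show ?case unfolding a(1) tree_proj_tr[OF a(2)] by (rule step.IH)
qed simp

lemma pt_interior_neq_vertex:
  assumes "0 < s" "s < 1" shows "pt l s \<noteq> pt m 0"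
proof
  assume "pt l s = pt m 0"
  then have eq: "pt l s = pt l 0" by (rule trans) (rule pt_0)
  have "mdist rose (pt l 0) (pt l s) = 0" unfolding eq using pt_in[of 0 l] by simp
  then show False using dist_pt_same[of 0 s l] circ_0[of s] assms by (simp add: hgt_def min_def split: if_splits)
qed

text \<open>The projection is invariant under moves, and it determines the normal form: an interior
  parameter and a positive orientation leave no ambiguity. Two points of a fibre thus have a common
  normal form.\<close>

lemma moves_fibre:
  assumes "u \<in> tree_set" "v \<in> tree_set" and eq: "tree_proj u = tree_proj v"
  shows "(u, v) \<in> moves\<^sup>*"
proof -
  obtain w h where w: "canon w h" "u = tp w h" using assms(1) by (rule tree_canon)
  obtain x k where x: "canon x k" "v = tp x k" using assms(2) by (rule tree_canon)
  have root: "tree_proj (tp [] 0) = pt (False, True) 0"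
    using tree_proj_canon[of "[]" 0] by (simp add: canon_def redl_Nil)
  have int: "tree_proj (tp [l] s) = pt l s" if "canon [l] s" for l s
    using tree_proj_canon[OF that] by simp
  have glue: "(u, v) \<in> moves\<^sup>*" if "(u, z) \<in> moves\<^sup>*" "(v, z) \<in> moves\<^sup>*" for z
    by (rule rtrancl_trans[OF that(1) symD[OF sym_moves that(2)]])
  show ?thesis
  proof (cases rule: moves_normal_form[OF w(1)])
    case 1
    show ?thesis
    proof (cases rule: moves_normal_form[OF x(1), case_names 1 2])
      case 1
      then show ?thesis using glue[of "tp [] 0"] \<open>(tp w h, tp [] 0) \<in> moves\<^sup>*\<close> w(2) x(2) by simp
    next
      case (2 l s)
      have "pt l s = tree_proj v" using moves_proj[OF 2(1)] int[OF 2(5)] x(2) by simp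
      also have "\<dots> = pt (False, True) 0"
        using moves_proj[OF \<open>(tp w h, tp [] 0) \<in> moves\<^sup>*\<close>] root w(2) eq by simp
      finally show ?thesis using pt_interior_neq_vertex[OF 2(3,4), of l "(False, True)"] by simp
    qed
  next
    case (2 l s)
    show ?thesis
    proof (cases rule: moves_normal_form[OF x(1), case_names one two])
      case one
      have "pt l s = tree_proj u" using moves_proj[OF 2(1)] int[OF 2(5)] w(2) by simp
      also have "\<dots> = pt (False, True) 0" using moves_proj[OF one] root x(2) eq by simp
      finally show ?thesis using pt_interior_neq_vertex[OF 2(3,4), of l "(False, True)"] by simp
    next
      case (two m t)
      have "pt l s = pt m t"
        using moves_proj[OF 2(1)] moves_proj[OF two(1)] int[OF 2(5)] int[OF two(5)] w(2) x(2) eq by simp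
      then have "m = l \<and> t = s \<or> m = linv l \<and> t = 1 - s" using 2(3,4) two(3,4) by (intro pt_inj)
      then have "m = l" "t = s" using 2(2) two(2) by (auto simp: linv_def)
      then show ?thesis using glue[of "tp [l] s"] 2(1) two(1) w(2) x(2) by simp
    qed
  qed
qed

text \<open>Counting points of an orbit becomes counting points of a fibre.\<close>

lemma orbit_deck:
  assumes "u \<in> tree_set"
  shows "orbit_of deck u = {v \<in> tree_set. tree_proj v = tree_proj u}"
proof (intro equalityI subsetI)
  fix v assume "v \<in> orbit_of deck u"
  then obtain f where f: "f \<in> deck" "v = f u" unfolding orbit_of_def by blast
  then have "f \<in> Bij tree_set" "tree_proj (f u) = tree_proj u"
    using assms by (simp_all add: deck_transformations_def)
  then have "f u \<in> tree_set" using assms by (auto simp: Bij_def bij_betw_def)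
  then show "v \<in> {v \<in> tree_set. tree_proj v = tree_proj u}"
    using f(2) \<open>tree_proj (f u) = tree_proj u\<close> by simp
next
  fix v assume "v \<in> {v \<in> tree_set. tree_proj v = tree_proj u}"
  then have "(u, v) \<in> moves\<^sup>*" using moves_fibre[OF assms, of v] by simp
  from moves_deck[OF this assms] obtain f where "f \<in> deck" "f u = v" by (elim conjE bexE)
  then show "v \<in> orbit_of deck u" unfolding orbit_of_def by (intro image_eqI[of _ _ f]) simp_all
qed

section \<open>The critical exponent of the universal cover\<close>

lemma dist_root:
  assumes "u \<in> tree_set" shows "tree_dist (tp [] 0) u = level u"
proof -
  obtain w h where w: "canon w h" "u = tp w h" using assms by (rule tree_canon)
  show ?thesis unfolding w(2) tree_dist_tp[OF ok_Nil canon_ok[OF w(1)]] canon_decode(2)[OF w(1)]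
    using canon_ok[OF w(1)] by (simp add: ok_def)
qed

text \<open>Each half-open edge is mapped injectively to the rose, so a fibre has at most one point
  on it and can be counted by words.\<close>

lemma inj_on_word_fibre: "inj_on word {v \<in> tree_set. tree_proj v = x}"
proof (rule inj_onI)
  fix u v assume u: "u \<in> {v \<in> tree_set. tree_proj v = x}" and v: "v \<in> {v \<in> tree_set. tree_proj v = x}" and eq: "word u = word v"
  obtain w h where w: "canon w h" "u = tp w h" using u by (auto elim: tree_canon)
  obtain w' k where w': "canon w' k" "v = tp w' k" using v by (auto elim: tree_canon)
  have "w' = w" using eq canon_decode(1) w w' by metis
  note w' = w'[unfolded this]
  show "u = v"
  proof (cases "w = []")
    case True
    then show ?thesis using w w' by (simp add: canon_def)
  next
    case False
    define s t where "s = h - (real (length w) - 1)" and "t = k - (real (length w) - 1)"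
    have st: "0 < s" "s \<le> 1" "0 < t" "t \<le> 1" using w(1) w'(1) False by (auto simp: canon_def s_def t_def)
    have "pt (last w) s = pt (last w) t"
      using u v tree_proj_canon[OF w(1)] tree_proj_canon[OF w'(1)] False w w' by (simp add: s_def t_def)
    moreover have "mdist rose (pt (last w) t) (pt (last w) t) = 0" using pt_in[of t "last w"] st by simp
    ultimately have "circ s t = 0" using dist_pt_same[of s t "last w"] st by simp
    then have "s = t" using st by (auto simp: circ_def min_def abs_if split: if_splits)
    then show ?thesis using w w' by (simp add: s_def t_def)
  qed
qed

text \<open>The bound reproduces itself since
  \<open>2 * 3 ^ n + 4 * 3 ^ n = 2 * 3 ^ Suc n\<close>.\<close>

lemma card_words_upto: "card (\<Union>i\<le>n. words i) \<le> 2 * 3 ^ n"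
proof (induction n)
  case 0
  have "words 0 = {[]}" by (auto simp: words_def redl_Nil)
  then show ?case by simp
next
  case (Suc n)
  have "(\<Union>i\<le>Suc n. words i) = (\<Union>i\<le>n. words i) \<union> words (Suc n)" by (auto simp: atMost_Suc)
  then have "card (\<Union>i\<le>Suc n. words i) \<le> card (\<Union>i\<le>n. words i) + card (words (Suc n))"
    by (simp only: card_Un_le)
  then show ?case using Suc by (simp add: card_words)
qed

lemma word_edge:
  assumes w: "redl w" and s: "0 \<le> s" "s < 1"
  shows "word (edge w l s) = (if s = 0 \<or> (w \<noteq> [] \<and> last w = linv l) then w else w @ [l])"
proof (cases "s = 0")
  case True
  then show ?thesis using decode(1)[of "real (length w)" w] by (simp add: edge_0)
next
  case False
  show ?thesis
  proof (cases rule: edge_cases[OF w s(1) less_imp_le[OF s(2)], of l])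
    case 1
    have "\<lceil>real (length w) - s\<rceil> = int (length w)" using s by (intro ceiling_unique) auto
    then have "word (tp w (real (length w) - s)) = w" using 1(4) by (simp add: decode ok_def)
    then show ?thesis using 1(1-3) by simp
  next
    case 2
    have "\<lceil>real (length w) + s\<rceil> = int (length w) + 1" using s False by (intro ceiling_unique) auto
    then have "nat \<lceil>real (length w) + s\<rceil> = Suc (length w)" by simp
    then have "word (tp (w @ [l]) (real (length w) + s)) = w @ [l]" using 2(3) by (simp add: decode ok_def)
    then show ?thesis using 2(1,2) False by auto
  qed
qed

text \<open>An orbit point is determined by its word, whose length is less than its level plus 1 and
  thus bounded by its distance from \<open>y\<close> plus a constant; this gives the upper bound.
  For the lower bound, every vertex has an orbit point on its edge of a fixed letter. The constant
  \<open>L\<close> accounts for a base point other than the root.\<close>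

lemma h_crit_tree:
  assumes y: "y \<in> tree_set"
  shows "h_crit tree deck y = ereal (ln 3)"
proof -
  define L where "L = level y"
  define S where "S T = orbit_of deck y \<inter> mball_of tree y T" for T
  have root: "tp [] 0 \<in> tree_set" by (rule tp_in[OF ok_Nil])
  have L0: "0 \<le> L" using dist_root[OF y] mdist_nonneg[of tree "tp [] 0" y] by (simp add: L_def)
  have tri: "level z \<le> L + tree_dist y z" "tree_dist y z \<le> L + level z" if "z \<in> tree_set" for z
    using mdist_triangle[of "tp [] 0" tree y z] mdist_triangle[of y tree "tp [] 0" z] mdist_commute[of tree y "tp [] 0"]
      root y that dist_root by (simp_all add: L_def)
  have upper: "finite (S T) \<and> card (S T) \<le> 2 * 3 ^ nat \<lceil>L + T + 1\<rceil>" if T: "T > 0" for T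
  proof -
    define m where "m = nat \<lceil>L + T + 1\<rceil>"
    have sub: "word ` S T \<subseteq> (\<Union>i\<le>m. words i)"
    proof
      fix w assume "w \<in> word ` S T"
      then obtain z where z: "z \<in> tree_set" "tree_dist y z < T" "w = word z" using y by (auto simp: S_def)
      obtain v h where v: "canon v h" "z = tp v h" using z(1) by (rule tree_canon)
      have wv: "w = v" "level z = h" using canon_decode[OF v(1)] z(3) v(2) by simp_all
      have "h < L + T" using tri(1)[OF z(1)] z(2) wv(2) by linarith
      moreover have "real (length v) < h + 1" using v(1) by (auto simp: canon_def split: if_splits)
      ultimately have "real (length v) \<le> real m" unfolding m_def by linarith
      then have "length w \<le> m" "redl w" using v(1) wv(1) by (auto simp: canon_def)
      then show "w \<in> (\<Union>i\<le>m. words i)" by (auto simp: words_def)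
    qed
    have inj: "inj_on word (S T)"
      by (rule inj_on_subset[OF inj_on_word_fibre[of "tree_proj y"]]) (auto simp: S_def orbit_deck[OF y])
    have fin: "finite (\<Union>i\<le>m. words i)" by simp
    have "finite (S T)" using finite_subset[OF sub fin] inj by (rule finite_imageD)
    moreover have "card (S T) \<le> card (\<Union>i\<le>m. words i)" using inj sub fin by (rule card_inj_on_le)
    ultimately show ?thesis using card_words_upto[of m] by (simp add: m_def)
  qed
  have lower: "3 ^ n \<le> card (S T)" if n: "0 < n" "real n + 1 + L < T" for n T
  proof -
    have T: "T > 0" using n(2) L0 by linarith
    have "tree_proj y \<in> mspace rose" using tree.p_in y by simp
    then obtain l s where s: "snd l" "0 \<le> s" "s < 1" "tree_proj y = pt l s" by (rule pt_surj_pos)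
    have wd: "redl w" "length w = n" if "w \<in> words n" for w using that by (auto simp: words_def)
    have "(\<lambda>w. edge w l s) ` words n \<subseteq> S T"
    proof clarify
      fix w assume w: "w \<in> words n"
      have e: "edge w l s \<in> tree_set" "tree_proj (edge w l s) = tree_proj y"
        using edge_in[OF wd(1)[OF w], of s l] tree_proj_edge[OF wd(1)[OF w], of s l] s by simp_all
      have "level (edge w l s) \<le> real n + 1"
      proof (cases rule: edge_cases[OF wd(1)[OF w] s(2) less_imp_le[OF s(3)], of l])
        case 1
        then show ?thesis using decode(2)[of "real (length w) - s" w] s wd(2)[OF w] by (simp add: ok_def)
      next
        case 2
        then show ?thesis using decode(2)[of "real (length w) + s" "w @ [l]"] s wd(2)[OF w] by (simp add: ok_def)
      qed
      then have "tree_dist y (edge w l s) < T" using tri(2)[OF e(1)] n(2) by linarith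
      then show "edge w l s \<in> S T" using e y by (simp add: S_def orbit_deck[OF y])
    qed
    moreover have "inj_on (\<lambda>w. edge w l s) (words n)"
    proof (rule inj_onI)
      fix w w' assume w: "w \<in> words n" "w' \<in> words n" and "edge w l s = edge w' l s"
      then have "word (edge w l s) = word (edge w' l s)" by simp
      \<comment> \<open>The words are of the shape \<open>w\<close> or \<open>w @ [l]\<close>, of
        lengths \<open>n\<close> and \<open>n + 1\<close>, so different shapes cannot
        coincide.\<close>
      then show "w = w'"
        unfolding word_edge[OF wd(1)[OF w(1)] s(2,3)] word_edge[OF wd(1)[OF w(2)] s(2,3)]
        using wd(2)[OF w(1)] wd(2)[OF w(2)] by (auto split: if_splits)
    qed
    ultimately have "card (words n) \<le> card (S T)" using upper[OF T] by (metis card_inj_on_le)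
    moreover obtain n' where "n = Suc n'" using n(1) by (cases n) auto
    ultimately show ?thesis by (simp add: card_words)
  qed
  have up: "elog (ecard (S T)) \<le> ereal ((ln 2 + (L + 2) * ln 3) + ln 3 * T)" if T: "T > 0" for T
  proof -
    define m where "m = nat \<lceil>L + T + 1\<rceil>"
    have m: "real m \<le> L + T + 2" using L0 T unfolding m_def by linarith
    have "ecard (S T) \<le> enat (2 * 3 ^ m)" using upper[OF T] by (simp add: ecard_def m_def)
    then have "elog (ecard (S T)) \<le> elog (enat (2 * 3 ^ m))" by (rule elog_mono)
    also have "\<dots> = ereal (ln 2 + real m * ln 3)" by (simp add: elog_enat ln_mult ln_realpow)
    also have "\<dots> \<le> ereal (ln 2 + (L + T + 2) * ln 3)" using m by (simp add: mult_right_mono)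
    also have "ln 2 + (L + T + 2) * ln 3 = (ln 2 + (L + 2) * ln 3) + ln 3 * T" by (simp add: algebra_simps)
    finally show ?thesis .
  qed
  have lo: "ereal (- ((L + 3) * ln 3) + ln 3 * T) \<le> elog (ecard (S T))" if T: "T > L + 3" for T
  proof -
    \<comment> \<open>The choice gives \<open>n + 1 + L < T\<close>, as \<open>lower\<close>
      requires, and \<open>T > L + 3\<close> makes \<open>n\<close> positive.\<close>
    define n where "n = nat \<lfloor>T - L - 2\<rfloor>"
    have n: "0 < n" "real n \<le> T - L - 2" "T - L - 3 \<le> real n" using T unfolding n_def by linarith+
    have T0: "T > 0" using T L0 by linarith
    have "- ((L + 3) * ln 3) + ln 3 * T = (T - L - 3) * ln 3" by (simp add: algebra_simps)
    also have "\<dots> \<le> real n * ln 3" using n(3) by (intro mult_right_mono) auto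
    finally have "ereal (- ((L + 3) * ln 3) + ln 3 * T) \<le> elog (enat (3 ^ n))" by (simp add: elog_enat ln_realpow)
    also have "\<dots> \<le> elog (ecard (S T))"
      using lower[of n T] n(1,2) upper[OF T0] by (intro elog_mono) (simp add: ecard_def)
    finally show ?thesis .
  qed
  have "Limsup at_top (\<lambda>T. elog (ecard (S T)) / ereal T) \<le> ereal (ln 3)"
    by (rule Limsup_rate_le[OF filterlim_ident _ eventually_mono[OF eventually_gt_at_top up]]) simp
  moreover have "ereal (ln 3) \<le> Limsup at_top (\<lambda>T. elog (ecard (S T)) / ereal T)"
    by (rule Limsup_rate_ge[OF filterlim_ident _ eventually_mono[OF eventually_gt_at_top lo]]) simp
  ultimately show ?thesis unfolding h_crit_def S_def by (rule antisym)
qed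

theorem theorem5:
  shows "\<exists>(X :: real metric) (\<Gamma> :: (real \<Rightarrow> real) set).
     proper_space X \<and> geodesic_space X \<and> line_convex X \<and> gromov_hyperbolic X \<and> bounded_geometry X \<and>
     subgroup \<Gamma> (Isom X) \<and> discrete_action X \<Gamma> \<and> torsion_free X \<Gamma> \<and> cocompact X \<Gamma> \<and>
     Metric_space (orbit_space \<Gamma> (mspace X)) (quotient_dist X) \<and>
     (let Q = quotient_metric X \<Gamma> in
        locally_CAT_minus_1 Q \<and>
        locally_geodesically_complete Q \<and>
        compact_space (mtopology_of Q) \<and>
        \<not> simply_connected_space (mtopology_of X) \<and>
        \<not> universal_cover X (orbit_of \<Gamma>) Q \<and>
        embedding_map (quotient_Geod_top X \<Gamma>) (Loc_Geod_top Q) (project_line \<Gamma>) \<and>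
        project_line \<Gamma> ` topspace (quotient_Geod_top X \<Gamma>) \<subset> Loc_Geod Q \<and>
        (\<exists>(Y :: real metric) p. universal_cover Y p Q \<and>
           (\<forall>x\<in>mspace X. \<forall>y\<in>mspace Y.
              h_top (Loc_Geod_top Q) (flow 1) = h_crit Y (deck_transformations Y p) y \<and>
              h_crit Y (deck_transformations Y p) y > h_crit X \<Gamma> x \<and>
              h_crit X \<Gamma> x = h_top (quotient_Geod_top X \<Gamma>) (quotient_flow 1))))"
  unfolding Let_def
proof (rule exI[of _ LX], rule exI[of _ shifts], fold rose_def, intro conjI)
  show "cocompact LX shifts" using compact_space_rose by (simp add: cocompact_def rose_def)
  show "\<not> universal_cover LX (orbit_of shifts) rose"
    using not_simply_connected_LX by (simp add: universal_cover_def)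
  show "\<exists>(Y :: real metric) p. universal_cover Y p rose \<and> (\<forall>x\<in>mspace LX. \<forall>y\<in>mspace Y.
      h_top (Loc_Geod_top rose) (flow 1) = h_crit Y (deck_transformations Y p) y \<and>
      h_crit LX shifts x < h_crit Y (deck_transformations Y p) y \<and>
      h_crit LX shifts x = h_top (quotient_Geod_top LX shifts) (quotient_flow 1))"
  proof (rule exI[of _ tree], rule exI[of _ tree_proj], intro conjI ballI universal_cover_tree)
    fix x y assume "x \<in> mspace LX" "y \<in> mspace tree"
    then have "h_crit LX shifts x = 0" "h_crit tree deck y = ereal (ln 3)"
      by (simp_all add: h_crit_LX h_crit_tree)
    then show "h_top (Loc_Geod_top rose) (flow 1) = h_crit tree deck y" "h_crit LX shifts x < h_crit tree deck y"
      "h_crit LX shifts x = h_top (quotient_Geod_top LX shifts) (quotient_flow 1)"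
      by (simp_all add: h_top_Loc_Geod h_top_quotient_Geod)
  qed
qed (fact proper_space_LX geodesic_space_LX line_convex_LX gromov_hyperbolic_LX bounded_geometry_LX
    subgroup_shifts discrete_shifts torsion_free_shifts Metric_space_rose locally_CAT_minus_1_rose
    locally_geodesically_complete_rose compact_space_rose not_simply_connected_LX
    embedding_project_line project_line_psubset)+

end
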